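(* For any $g$, the degree of the second projection $\pi_2$ for any good component of $T_p(V)$ is $1$.
   Context: $K=\mathbb Q(\sqrt{-\Delta})$ is an imaginary quadratic field of class number $1$, $p$ is an odd prime inert in $K$, $g=\mathfrak r+\mathfrak s$, and $N$ is a level prime to $p$ all of whose prime divisors split in $K$. $X$ is (an irreducible component of) the Siegel modular variety of genus $g$ and level $N$, attached to $G=GSp_{2g}$, the standard $h_X$, and the standard level subgroup $\mathcal K=\mathcal K_N\subset G(\mathbb A_f)$ (defined as for $\Gamma_0(N)$ in genus one, with $g\times g$ blocks). Let $E=\mathrm{diag}(1_{\mathfrak r},-1_{\mathfrak s})$ and let $G_V=GU(\mathfrak r,\mathfrak s)$ be the group over $\mathbb Q$ of matrices $\mathfrak g=h+k\sqrt{-\Delta}$ with $\mathfrak gE\bar{\mathfrak g}^t=\lambda E$, embedded in $G$ by $\alpha(\mathfrak g)=\begin{pmatrix} h& kE\\ -\Delta Ek& EhE\end{pmatrix}$. $V\subset X$ is the (irreducible) Shimura subvariety attached to $G_V$, the standard $h_V$ and $\mathcal K_V=\mathcal K\cap\alpha(G_V(\mathbb A_f))$; its points parametrize abelian $g$-folds with multiplication by $O_K$. $T_p$ is the Hecke correspondence on $X$ of the double coset of $\mathrm{diag}(1_g,p1_g)$: for $t\in X$ with abelian $g$-fold $A_t$, the points of $T_p(t)$ correspond to the quotients $A_t/W$, $W$ running over the $g$-dimensional $\mathbb F_p$-subspaces of the $p$-torsion $(A_t)_p$ isotropic for the Riemann form. For $t\in V$, $(A_t)_p$ is a module over $O_K/p=\mathbb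 F_{p^2}$. For generic $t\in V$, the component of $T_p(V)$ containing the point corresponding to $W$ is called good if $\mathbb F_{p^2}W=(A_t)_p$. The restriction of $T_p$ to $V$ is a linear combination $\sum_i\rho_i T_{V,i}$ of distinct irreducible correspondences $T_{V,i}$ between $V$ and subvarieties $V_i\subset X$ (the irreducible components of $T_p(V)$). $\Gamma_{V,i}\subset V\times V_i$ is the graph of $T_{V,i}$ and $\pi_1:\Gamma_{V,i}\to V$, $\pi_2:\Gamma_{V,i}\to V_i$ are the projections. *)

theory Defs
  imports "HOL-Analysis.Analysis" "HOL-Algebra.Ideal_Product"
    "HOL-Computational_Algebra.Computational_Algebra"
begin

section \<open>The imaginary quadratic field\<close>

definition sqrt_neg :: "nat \<Rightarrow> complex" where
  "sqrt_neg \<Delta> = \<i> * of_real (sqrt (real \<Delta>))"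

definition imag_quad_field :: "nat \<Rightarrow> complex set" where
  "imag_quad_field \<Delta> = {of_rat a + of_rat b * sqrt_neg \<Delta> | a b. True}"

definition ring_of_integers :: "nat \<Rightarrow> complex ring" where
  "ring_of_integers \<Delta> =
     \<lparr>carrier = {z \<in> imag_quad_field \<Delta>. algebraic_int z},
      mult = (*), one = 1, zero = 0, add = (+)\<rparr>"

definition nonzero_ideals :: "nat \<Rightarrow> complex set set" where
  "nonzero_ideals \<Delta> = {I. ideal I (ring_of_integers \<Delta>) \<and> I \<noteq> {0}}"

definition ideal_equiv :: "nat \<Rightarrow> (complex set \<times> complex set) set" where
  "ideal_equiv \<Delta> = {(I, J). I \<in> nonzero_ideals \<Delta> \<and> J \<in> nonzero_ideals \<Delta> \<and>
     (\<exists>a \<in> carrier (ring_of_integers \<Delta>) - {0}. \<exists>b \<in> carrier (ring_of_integers \<Delta>) - {0}.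
        (\<lambda>x. a * x) ` I = (\<lambda>x. b * x) ` J)}"

definition class_number :: "nat \<Rightarrow> nat" where
  "class_number \<Delta> = card (nonzero_ideals \<Delta> // ideal_equiv \<Delta>)"

definition inert_prime :: "nat \<Rightarrow> nat \<Rightarrow> bool" where
  "inert_prime \<Delta> p \<longleftrightarrow>
     primeideal (PIdl\<^bsub>ring_of_integers \<Delta>\<^esub> (of_nat p)) (ring_of_integers \<Delta>)"

definition split_prime :: "nat \<Rightarrow> nat \<Rightarrow> bool" where
  "split_prime \<Delta> q \<longleftrightarrow>
     (\<exists>P Q. primeideal P (ring_of_integers \<Delta>) \<and> primeideal Q (ring_of_integers \<Delta>) \<and> P \<noteq> Q \<and>
        PIdl\<^bsub>ring_of_integers \<Delta>\<^esub> (of_nat q) = P \<cdot>\<^bsub>ring_of_integers \<Delta>\<^esub> Q)"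


section \<open>Closed analytic sets, irreducible components, genericity\<close>

text \<open>The first argument \<open>sc\<close> is the complex scalar multiplication on the (real) Euclidean
  space \<open>'a\<close>; a function is holomorphic if it is differentiable with complex linear derivative.\<close>

definition holomorphic_wrt ::
  "(complex \<Rightarrow> 'a \<Rightarrow> 'a) \<Rightarrow> ('a::euclidean_space \<Rightarrow> complex) \<Rightarrow> 'a set \<Rightarrow> bool" where
  "holomorphic_wrt sc f U \<longleftrightarrow>
     (\<forall>x\<in>U. \<exists>f'. (f has_derivative f') (at x) \<and> (\<forall>c v. f' (sc c v) = c * f' v))"

text \<open>Here \<open>\<Omega>\<close> is meant to be open in a complex linear subspace of \<open>'a\<close> (such as the
  Siegel space inside the symmetric matrices). Holomorphic functions on such a set extend
  locally to the ambient space, so local equations may be taken there.\<close>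

definition analytic_subset ::
  "(complex \<Rightarrow> 'a \<Rightarrow> 'a) \<Rightarrow> ('a::euclidean_space) set \<Rightarrow> 'a set \<Rightarrow> bool" where
  "analytic_subset sc \<Omega> Z \<longleftrightarrow> Z \<subseteq> \<Omega> \<and>
     (\<forall>x\<in>\<Omega>. \<exists>U F. open U \<and> x \<in> U \<and> finite F \<and> (\<forall>f\<in>F. holomorphic_wrt sc f U) \<and>
        Z \<inter> U = {u \<in> \<Omega> \<inter> U. \<forall>f\<in>F. f u = 0})"

text \<open>The next notions are relative to a predicate \<open>cl\<close> that singles out the closed
  subvarieties of an ambient variety.\<close>

definition irreducible_wrt :: "('a set \<Rightarrow> bool) \<Rightarrow> 'a set \<Rightarrow> bool" where
  "irreducible_wrt cl Y \<longleftrightarrow> cl Y \<and> Y \<noteq> {} \<and>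
     (\<forall>A B. cl A \<and> cl B \<and> Y = A \<union> B \<longrightarrow> Y = A \<or> Y = B)"

definition irreducible_component :: "('a set \<Rightarrow> bool) \<Rightarrow> 'a set \<Rightarrow> 'a set \<Rightarrow> bool" where
  "irreducible_component cl S Y \<longleftrightarrow> irreducible_wrt cl Y \<and> Y \<subseteq> S \<and>
     (\<forall>Y'. irreducible_wrt cl Y' \<and> Y \<subseteq> Y' \<and> Y' \<subseteq> S \<longrightarrow> Y' = Y)"

text \<open>A property holds generically on an irreducible \<open>Y\<close> if it holds off a proper closed
  subvariety.\<close>

definition generically :: "('a set \<Rightarrow> bool) \<Rightarrow> 'a set \<Rightarrow> ('a \<Rightarrow> bool) \<Rightarrow> bool" where
  "generically cl Y P \<longleftrightarrow> (\<exists>Z. cl Z \<and> Z \<subset> Y \<and> (\<forall>y \<in> Y - Z. P y))"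


section \<open>The Siegel modular variety\<close>

type_synonym 'g cmatrix = "complex^'g^'g"
type_synonym 'g rmatrix = "real^'g^'g"
type_synonym 'g bmatrix = "real^('g + 'g)^('g + 'g)"

abbreviation cmat :: "real^'n^'m \<Rightarrow> complex^'n^'m" where
  "cmat \<equiv> map_matrix of_real"

definition block_matrix ::
  "'a^'g^'g \<Rightarrow> 'a^'g^'g \<Rightarrow> 'a^'g^'g \<Rightarrow> 'a^'g^'g \<Rightarrow> 'a^('g + 'g)^('g + 'g)" where
  "block_matrix A B C D = (\<chi> i j. case i of
      Inl i' \<Rightarrow> (case j of Inl j' \<Rightarrow> A $ i' $ j' | Inr j' \<Rightarrow> B $ i' $ j')
    | Inr i' \<Rightarrow> (case j of Inl j' \<Rightarrow> C $ i' $ j' | Inr j' \<Rightarrow> D $ i' $ j'))"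

definition block_A :: "'a^('g + 'g)^('g + 'g) \<Rightarrow> 'a^'g^'g" where
  "block_A M = (\<chi> i j. M $ Inl i $ Inl j)"
definition block_B :: "'a^('g + 'g)^('g + 'g) \<Rightarrow> 'a^'g^'g" where
  "block_B M = (\<chi> i j. M $ Inl i $ Inr j)"
definition block_C :: "'a^('g + 'g)^('g + 'g) \<Rightarrow> 'a^'g^'g" where
  "block_C M = (\<chi> i j. M $ Inr i $ Inl j)"
definition block_D :: "'a^('g + 'g)^('g + 'g) \<Rightarrow> 'a^'g^'g" where
  "block_D M = (\<chi> i j. M $ Inr i $ Inr j)"

definition symplectic_form :: "'g::finite bmatrix" where
  "symplectic_form = block_matrix 0 (mat 1) (- mat 1) 0"

text \<open>The arithmetic group \<open>GSp\<^sub>2\<^sub>g(\<rat>)\<^sup>+ \<inter> \<K>\<^sub>N\<close>: integral symplectic matrices whose lower left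
  block is divisible by \<open>N\<close>.\<close>

definition Gamma0 :: "nat \<Rightarrow> 'g::finite bmatrix set" where
  "Gamma0 N = {M. (\<forall>i j. M $ i $ j \<in> \<int>) \<and>
     M ** symplectic_form ** transpose M = symplectic_form \<and>
     (\<forall>i j. \<exists>m::int. block_C M $ i $ j = of_int (int N * m))}"

definition siegel_space :: "'g::finite cmatrix set" where
  "siegel_space = {\<tau>. transpose \<tau> = \<tau> \<and>
     (\<forall>x::real^'g. x \<noteq> 0 \<longrightarrow> 0 < x \<bullet> (map_matrix Im \<tau> *v x))}"

definition automorphy :: "'g::finite bmatrix \<Rightarrow> 'g cmatrix \<Rightarrow> 'g cmatrix" where
  "automorphy M \<tau> = cmat (block_C M) ** \<tau> + cmat (block_D M)"

definition siegel_action :: "'g::finite bmatrix \<Rightarrow> 'g cmatrix \<Rightarrow> 'g cmatrix" where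
  "siegel_action M \<tau> =
     (cmat (block_A M) ** \<tau> + cmat (block_B M)) ** matrix_inv (automorphy M \<tau>)"

definition siegel_pt :: "nat \<Rightarrow> 'g::finite cmatrix \<Rightarrow> 'g cmatrix set" where
  "siegel_pt N \<tau> = {siegel_action M \<tau> | M. M \<in> Gamma0 N}"

definition siegel_variety :: "nat \<Rightarrow> 'g::finite cmatrix set set" where
  "siegel_variety N = siegel_pt N ` siegel_space"

text \<open>Closed subvarieties of \<open>X\<close> and of \<open>X \<times> X\<close>: the subsets whose inverse image in the
  Siegel space (in its square) is analytic. An algebraic variety has the same irreducible
  components as the underlying analytic space.\<close>

definition scale_matrix :: "complex \<Rightarrow> 'g::finite cmatrix \<Rightarrow> 'g cmatrix" where
  "scale_matrix c A = mat c ** A"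

definition scale_pair ::
  "complex \<Rightarrow> 'g::finite cmatrix \<times> 'g cmatrix \<Rightarrow> 'g cmatrix \<times> 'g cmatrix" where
  "scale_pair c = map_prod (scale_matrix c) (scale_matrix c)"

definition subvariety :: "nat \<Rightarrow> 'g::finite cmatrix set set \<Rightarrow> bool" where
  "subvariety N Y \<longleftrightarrow> Y \<subseteq> siegel_variety N \<and>
     analytic_subset scale_matrix siegel_space {\<tau> \<in> siegel_space. siegel_pt N \<tau> \<in> Y}"

definition subvariety2 ::
  "nat \<Rightarrow> ('g::finite cmatrix set \<times> 'g cmatrix set) set \<Rightarrow> bool" where
  "subvariety2 N C \<longleftrightarrow> C \<subseteq> siegel_variety N \<times> siegel_variety N \<and>
     analytic_subset scale_pair (siegel_space \<times> siegel_space)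
       {(\<tau>, \<sigma>) \<in> siegel_space \<times> siegel_space. (siegel_pt N \<tau>, siegel_pt N \<sigma>) \<in> C}"


section \<open>The unitary Shimura subvariety\<close>

text \<open>\<open>sig_matrix r\<close> is \<open>diag(1,\<dots>,1,-1,\<dots>,-1)\<close> with \<open>r\<close> entries 1; the rows and columns are
  ordered by the linear order of the index type.\<close>

definition sig_matrix :: "nat \<Rightarrow> 'g::{finite,linorder} rmatrix" where
  "sig_matrix r = (\<chi> i j. if i = j then (if card {k. k < i} < r then 1 else - 1) else 0)"

text \<open>A real point \<open>h + k \<surd>(-\<Delta>)\<close> of \<open>GU(r,s)\<close> is represented by the pair of real matrices
  \<open>(h, k)\<close>. We keep those of positive multiplier; they are the ones that \<open>\<alpha>\<close> maps into
  \<open>GSp\<^sub>2\<^sub>g(\<real>)\<^sup>+\<close>.\<close>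

definition GU_pos :: "nat \<Rightarrow> nat \<Rightarrow> ('g::{finite,linorder} rmatrix \<times> 'g rmatrix) set" where
  "GU_pos \<Delta> r = {(h, k). \<exists>l>0.
     (cmat h + mat (sqrt_neg \<Delta>) ** cmat k) ** cmat (sig_matrix r) **
        transpose (map_matrix cnj (cmat h + mat (sqrt_neg \<Delta>) ** cmat k))
     = mat (of_real l) ** cmat (sig_matrix r)}"

definition alpha_embedding ::
  "nat \<Rightarrow> nat \<Rightarrow> 'g::{finite,linorder} rmatrix \<times> 'g rmatrix \<Rightarrow> 'g bmatrix" where
  "alpha_embedding \<Delta> r = (\<lambda>(h, k). block_matrix
     h (k ** sig_matrix r)
     (mat (- real \<Delta>) ** sig_matrix r ** k) (sig_matrix r ** h ** sig_matrix r))"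

text \<open>The standard \<open>h\<^sub>V\<close> sends \<open>\<i>\<close> to \<open>\<i> E = (E / \<surd>\<Delta>) \<surd>(-\<Delta>)\<close>. Its image under \<open>\<alpha>\<close> has the
  blocks \<open>0, 1/\<surd>\<Delta>, -\<surd>\<Delta>, 0\<close> and acts by \<open>\<tau> \<mapsto> - \<tau>\<^sup>-\<^sup>1 / \<Delta>\<close>, with fixed point
  \<open>\<i> / \<surd>\<Delta>\<close>.\<close>

definition base_point :: "nat \<Rightarrow> 'g::finite cmatrix" where
  "base_point \<Delta> = mat (\<i> / of_real (sqrt (real \<Delta>)))"

definition unitary_domain :: "nat \<Rightarrow> nat \<Rightarrow> 'g::{finite,linorder} cmatrix set" where
  "unitary_domain \<Delta> r =
     {siegel_action (alpha_embedding \<Delta> r x) (base_point \<Delta>) | x. x \<in> GU_pos \<Delta> r}"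

definition unitary_variety :: "nat \<Rightarrow> nat \<Rightarrow> nat \<Rightarrow> 'g::{finite,linorder} cmatrix set set" where
  "unitary_variety \<Delta> N r = siegel_pt N ` unitary_domain \<Delta> r"


section \<open>The Hecke correspondence and its restriction\<close>

definition hecke_coset :: "nat \<Rightarrow> nat \<Rightarrow> 'g::finite bmatrix set" where
  "hecke_coset N p = {M ** block_matrix (mat 1) 0 0 (mat (real p)) ** M' | M M'.
     M \<in> Gamma0 N \<and> M' \<in> Gamma0 N}"

definition hecke_corr ::
  "nat \<Rightarrow> nat \<Rightarrow> ('g::finite cmatrix set \<times> 'g cmatrix set) set" where
  "hecke_corr N p = {(siegel_pt N \<tau>, siegel_pt N (siegel_action \<beta> \<tau>)) | \<tau> \<beta>.
     \<tau> \<in> siegel_space \<and> \<beta> \<in> hecke_coset N p}"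

definition hecke_restriction :: "nat \<Rightarrow> nat \<Rightarrow> nat \<Rightarrow> nat \<Rightarrow>
    ('g::{finite,linorder} cmatrix set \<times> 'g cmatrix set) set" where
  "hecke_restriction \<Delta> N r p = {(t, s) \<in> hecke_corr N p. t \<in> unitary_variety \<Delta> N r}"

text \<open>The irreducible components of the restricted correspondence are the graphs of the
  irreducible correspondences \<open>T\<^sub>V\<^sub>,\<^sub>i\<close>; if \<open>C\<close> is such a graph, then \<open>V\<^sub>i\<close> is \<open>snd ` C\<close>.\<close>

definition hecke_component :: "nat \<Rightarrow> nat \<Rightarrow> nat \<Rightarrow> nat \<Rightarrow>
    ('g::{finite,linorder} cmatrix set \<times> 'g cmatrix set) set \<Rightarrow> bool" where
  "hecke_component \<Delta> N r p = irreducible_component (subvariety2 N) (hecke_restriction \<Delta> N r p)"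

text \<open>The abelian variety at \<open>\<tau>\<close> is the quotient of the row vectors \<open>\<complex>\<^sup>g\<close> by the lattice
  \<open>{m \<tau> + n}\<close>, with \<open>m, n\<close> integral row vectors.\<close>

definition period_lattice :: "'g::finite cmatrix \<Rightarrow> (complex^'g) set" where
  "period_lattice \<tau> = {m v* \<tau> + n | m n. (\<forall>i. m $ i \<in> \<int>) \<and> (\<forall>i. n $ i \<in> \<int>)}"

definition torsion_lattice :: "nat \<Rightarrow> 'g::finite cmatrix \<Rightarrow> (complex^'g) set" where
  "torsion_lattice p \<tau> = {u /\<^sub>R real p | u. u \<in> period_lattice \<tau>}"

text \<open>A subgroup \<open>W\<close> of the \<open>p\<close>-torsion of \<open>A\<^sub>\<tau>\<close> is represented by its inverse image in
  \<open>\<complex>\<^sup>g\<close>, a lattice between \<open>period_lattice \<tau>\<close> and \<open>torsion_lattice p \<tau>\<close>. If \<open>\<beta>\<close> is in the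
  double coset and \<open>C, D\<close> are its lower blocks, then \<open>u \<mapsto> p\<^sup>-\<^sup>1 u (C \<tau> + D)\<close> induces an
  isomorphism of \<open>A\<^sub>\<beta>\<^sub>\<tau>\<close> onto \<open>A\<^sub>\<tau> / W\<close>, where \<open>W\<close> is the subspace represented below; this is
  the \<open>W\<close> to which the point \<open>\<beta> \<tau>\<close> of \<open>T\<^sub>p\<close> corresponds.\<close>

definition hecke_subspace ::
  "nat \<Rightarrow> 'g::finite bmatrix \<Rightarrow> 'g cmatrix \<Rightarrow> (complex^'g) set" where
  "hecke_subspace p \<beta> \<tau> =
     {(u v* automorphy \<beta> \<tau>) /\<^sub>R real p | u. u \<in> period_lattice (siegel_action \<beta> \<tau>)}"

text \<open>For \<open>\<tau>\<close> in the unitary domain, \<open>\<surd>(-\<Delta>)\<close> acts on the integral row vectors \<open>(m, n)\<close> by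
  right multiplication with \<open>\<alpha>(\<surd>(-\<Delta>))\<close>, that is \<open>(m, n) \<mapsto> (-\<Delta> n E, m E)\<close>. Since
  \<open>\<tau> E \<tau> = - E / \<Delta>\<close> on this domain, the induced map on \<open>\<complex>\<^sup>g\<close> is \<open>u \<mapsto> u (-\<Delta> E \<tau>)\<close>.\<close>

definition mult_sqrt_neg ::
  "nat \<Rightarrow> nat \<Rightarrow> 'g::{finite,linorder} cmatrix \<Rightarrow> (complex, 'g) vec \<Rightarrow> (complex, 'g) vec" where
  "mult_sqrt_neg \<Delta> r \<tau> u = u v* (mat (- of_nat \<Delta>) ** cmat (sig_matrix r) ** \<tau>)"

text \<open>As \<open>p\<close> is odd, \<open>O\<^sub>K / p\<close> is spanned over the prime field by 1 and \<open>\<surd>(-\<Delta>)\<close>, so the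
  \<open>O\<^sub>K / p\<close>-span of a subspace \<open>W\<close> is \<open>W + \<surd>(-\<Delta>) W\<close>.\<close>

definition OK_span ::
  "nat \<Rightarrow> nat \<Rightarrow> 'g::{finite,linorder} cmatrix \<Rightarrow> (complex, 'g) vec set \<Rightarrow> (complex, 'g) vec set" where
  "OK_span \<Delta> r \<tau> W = {w + mult_sqrt_neg \<Delta> r \<tau> w' | w w'. w \<in> W \<and> w' \<in> W}"

definition good_component :: "nat \<Rightarrow> nat \<Rightarrow> nat \<Rightarrow> nat \<Rightarrow>
    ('g::{finite,linorder} cmatrix set \<times> 'g cmatrix set) set \<Rightarrow> bool" where
  "good_component \<Delta> N r p C \<longleftrightarrow> hecke_component \<Delta> N r p C \<and>
     generically (subvariety N) (unitary_variety \<Delta> N r) (\<lambda>t.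
       \<exists>\<tau> \<beta>. \<tau> \<in> unitary_domain \<Delta> r \<and> t = siegel_pt N \<tau> \<and> \<beta> \<in> hecke_coset N p \<and>
         (t, siegel_pt N (siegel_action \<beta> \<tau>)) \<in> C \<and>
         OK_span \<Delta> r \<tau> (hecke_subspace p \<beta> \<tau>) = torsion_lattice p \<tau>)"

text \<open>The degree of the second projection of \<open>C\<close> onto its image: the number of points of the
  fibre over a generic point of the image (in characteristic 0).\<close>

definition snd_degree :: "nat \<Rightarrow>
    ('g::finite cmatrix set \<times> 'g cmatrix set) set \<Rightarrow> nat \<Rightarrow> bool" where
  "snd_degree N C d \<longleftrightarrow>
     generically (subvariety N) (snd ` C) (\<lambda>s. finite {t. (t, s) \<in> C} \<and> card {t. (t, s) \<in> C} = d)"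

end

theory Submission
  imports Defs "HOL-Complex_Analysis.Conformal_Mappings"
begin

text \<open>
  Write \<open>D\<close> for the unitary domain, \<open>\<Gamma>\<close> for the arithmetic group and \<open>J\<close> for \<open>\<alpha>(\<surd>(-\<Delta>))\<close>.

  The idea is that a good Hecke translate remembers where it came from. Let \<open>A_s = A_t / W\<close>. The
  lattice \<open>L_s\<close> of \<open>A_s\<close> contains the lattice \<open>L_t\<close> of \<open>A_t\<close>, and \<open>W\<close> is good exactly if the
  \<open>O_K\<close>-span of \<open>L_s\<close> is \<open>p\<^sup>-\<^sup>1 L_t\<close>. So \<open>L_t\<close> can be recovered from \<open>A_s\<close> together with the action
  of \<open>K\<close> on its rational homology. For generic \<open>s\<close> there is only one such action up to complex
  conjugation, and conjugation does not change the span; hence \<open>t\<close> is determined by \<open>s\<close>.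

  In matrices this reads as follows. A component is the graph \<open>{([\<tau>], [\<beta> \<tau>]) | \<tau> \<in> D}\<close> of a single
  \<open>\<beta>\<close> in the double coset (\<open>hecke_component_is_graph\<close>), and for a good component \<open>\<beta>\<close> can be chosen
  so that \<open>\<int>\<^sup>2\<^sup>g \<beta> + \<int>\<^sup>2\<^sup>g \<beta> J = \<int>\<^sup>2\<^sup>g\<close> (\<open>good_component_is_good_graph\<close>). Two points over the same \<open>s\<close>
  give \<open>\<beta> \<tau> = \<gamma> \<beta> \<tau>'\<close> with \<open>\<gamma> \<in> \<Gamma>\<close>, so \<open>\<epsilon> = \<beta>\<^sup>-\<^sup>1 \<gamma> \<beta>\<close> carries \<open>\<tau>'\<close> to \<open>\<tau>\<close>. If \<open>\<epsilon>\<close> commutes or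
  anticommutes with \<open>J\<close>, it preserves \<open>\<int>\<^sup>2\<^sup>g \<beta> + \<int>\<^sup>2\<^sup>g \<beta> J\<close>, thus is integral, and lies in \<open>\<Gamma>\<close>
  (\<open>conjugate_in_Gamma0\<close>); then \<open>\<tau>\<close> and \<open>\<tau>'\<close> are the same point of \<open>V\<close>.

  The commutation holds whenever \<open>\<beta> D = \<gamma> \<beta> D\<close>. Indeed \<open>D\<close> is the set of all \<open>\<tau>\<close> fixed by \<open>J\<close>
  (\<open>unitary_domain_eq_fixset\<close>), and up to scalars \<open>J\<close> is the only element of the symplectic Lie
  algebra that fixes \<open>D\<close> pointwise (\<open>unitary_domain_rigid\<close>); a few explicit points of \<open>D\<close> suffice to
  see this. In definite signature \<open>D\<close> is a point, this argument fails, and the degree is trivially 1.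

  So the exceptional points are those in which two different translates \<open>\<gamma> \<beta> D\<close> meet. They form a
  closed subvariety because the family of translates is locally finite, by proper discontinuity
  applied to the conjugates of \<open>J\<close>. It is proper, and the components are irreducible, because \<open>D\<close> is
  irreducible in a strong sense: any two points of \<open>D\<close> lie on a holomorphic curve in \<open>D\<close>
  (\<open>unitary_domain_curve\<close>), and a curve that is not contained in an analytic set meets it in isolated
  points. Hence a locally finite family of analytic sets that covers \<open>D\<close> has a member that contains
  \<open>D\<close> (\<open>unitary_domain_locally_finite_cover\<close>).
\<close>

no_notation fps_nth (infixl "$" 75)

section \<open>Matrix algebra with scalars and blocks\<close>

text \<open>Scalar multiples of rectangular matrices over the ring of entries. The scalar matrices
  of the definitions are moved out of products in this form.\<close>

definition sm :: "'a::comm_ring_1 \<Rightarrow> 'a^'n^'m \<Rightarrow> 'a^'n^'m" where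
  "sm c A = (\<chi> i j. c * A $ i $ j)"

lemma sm_nth [simp]: "sm c A $ i $ j = c * A $ i $ j"
  by (simp add: sm_def)

lemma matrix_eq_iff: "A = B \<longleftrightarrow> (\<forall>i j. A $ i $ j = B $ i $ j)"
  by (simp add: vec_eq_iff)

lemma mat_mult_eq_sm: "mat c ** A = sm c A"
  by (simp add: matrix_eq_iff matrix_matrix_mult_def mat_def if_distrib if_distribR cong: if_cong)

lemma mult_mat_eq_sm: "A ** mat c = sm c A"
  by (simp add: matrix_eq_iff matrix_matrix_mult_def mat_def if_distrib if_distribR mult.commute
      cong: if_cong)

lemma sm_mult_left: "sm c A ** B = sm c (A ** B)"
  by (simp add: matrix_eq_iff matrix_matrix_mult_def sum_distrib_left mult.assoc)

lemma sm_mult_right: "A ** sm c B = sm c (A ** B)"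
  by (simp add: matrix_eq_iff matrix_matrix_mult_def sum_distrib_left mult.left_commute)

lemma sm_sm: "sm c (sm d A) = sm (c * d) A"
  by (simp add: matrix_eq_iff mult.assoc)

lemma sm_1 [simp]: "sm 1 A = A" and sm_0 [simp]: "sm 0 A = 0" and sm_zero [simp]: "sm c 0 = 0"
  by (simp_all add: matrix_eq_iff)

lemma sm_add: "sm c (A + B) = sm c A + sm c B"
  and sm_diff: "sm c (A - B) = sm c A - sm c B"
  and sm_minus: "sm c (- A) = - sm c A"
  and sm_minus_left: "sm (- c) A = - sm c A"
  by (simp_all add: matrix_eq_iff algebra_simps)

lemma sm_mat: "sm c (mat d) = mat (c * d)"
  by (simp add: matrix_eq_iff mat_def)

lemma sm_cancel: "c \<noteq> 0 \<Longrightarrow> sm c A = sm c B \<longleftrightarrow> A = (B :: 'a::field^'n^'m)"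
  by (simp add: matrix_eq_iff)

lemma minus_mult_left': "(- A) ** B = - (A ** (B :: 'a::comm_ring_1^'n^'m))"
  and minus_mult_right': "A ** (- B) = - (A ** (B :: 'a::comm_ring_1^'n^'m))"
  by (simp_all add: matrix_eq_iff matrix_matrix_mult_def sum_negf)

lemma diff_mult_left: "(A - A') ** B = A ** B - A' ** (B :: 'a::comm_ring_1^'n^'m)"
  and diff_mult_right: "A'' ** (B - B') = A'' ** B - A'' ** (B' :: 'a::comm_ring_1^'n^'m)"
  by (simp_all add: matrix_eq_iff matrix_matrix_mult_def sum_subtractf algebra_simps)

lemma add_mult_left: "(A + A') ** B = A ** B + A' ** (B :: 'a::comm_ring_1^'n^'m)"
  by (simp add: matrix_eq_iff matrix_matrix_mult_def sum.distrib algebra_simps)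

lemmas matrix_ring_simps = matrix_add_ldistrib add_mult_left diff_mult_left diff_mult_right
  minus_mult_left' minus_mult_right' sm_mult_left sm_mult_right sm_sm sm_add sm_diff sm_minus
  mat_mult_eq_sm mult_mat_eq_sm matrix_mul_assoc

lemma transpose_add: "transpose (A + B) = transpose A + transpose B"
  and transpose_diff: "transpose (A - B) = transpose A - transpose B"
  and transpose_minus: "transpose (- A) = - transpose A"
  and transpose_sm: "transpose (sm c A) = sm c (transpose A)"
  and transpose_zero [simp]: "transpose 0 = 0"
  by (simp_all add: matrix_eq_iff transpose_def)

lemmas transpose_simps = transpose_add transpose_diff transpose_minus transpose_sm
  matrix_transpose_mul

lemma cmat_mult: "cmat (A ** B) = cmat A ** cmat B"
  by (simp add: matrix_eq_iff matrix_matrix_mult_def)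

lemma cmat_add: "cmat (A + B) = cmat A + cmat B"
  and cmat_diff: "cmat (A - B) = cmat A - cmat B"
  and cmat_minus: "cmat (- A) = - cmat A"
  and cmat_sm: "cmat (sm c A) = sm (of_real c) (cmat A)"
  and cmat_transpose: "cmat (transpose A) = transpose (cmat A)"
  and cmat_zero [simp]: "cmat 0 = 0"
  by (simp_all add: matrix_eq_iff transpose_def)

lemma cmat_mat: "cmat (mat c) = mat (of_real c)"
  by (simp add: matrix_eq_iff mat_def)

lemmas cmat_simps = cmat_mult cmat_add cmat_diff cmat_minus cmat_sm cmat_transpose cmat_mat

lemma sum_plus_type: "(\<Sum>k\<in>(UNIV::('a::finite + 'b::finite) set). f k) = (\<Sum>k\<in>UNIV. f (Inl k)) + (\<Sum>k\<in>UNIV. f (Inr k))"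
proof -
  have "sum f (UNIV <+> UNIV) = (\<Sum>k\<in>UNIV. f (Inl k)) + (\<Sum>k\<in>UNIV. f (Inr k))"
    by (subst sum.Plus) (simp_all add: o_def)
  then show ?thesis
    by simp
qed

lemma all_plus_type: "(\<forall>i::'a + 'b. P i) \<longleftrightarrow> (\<forall>i. P (Inl i)) \<and> (\<forall>i. P (Inr i))"
  by (metis sumE)

lemma block_matrix_nth [simp]:
  "block_matrix A B C D $ Inl i $ Inl j = A $ i $ j"
  "block_matrix A B C D $ Inl i $ Inr j = B $ i $ j"
  "block_matrix A B C D $ Inr i $ Inl j = C $ i $ j"
  "block_matrix A B C D $ Inr i $ Inr j = D $ i $ j"
  by (simp_all add: block_matrix_def)

lemma block_nth [simp]:
  "block_A M $ i $ j = M $ Inl i $ Inl j" "block_B M $ i $ j = M $ Inl i $ Inr j"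
  "block_C M $ i $ j = M $ Inr i $ Inl j" "block_D M $ i $ j = M $ Inr i $ Inr j"
  by (simp_all add: block_A_def block_B_def block_C_def block_D_def)

lemma block_of_block_matrix [simp]:
  "block_A (block_matrix A B C D) = A" "block_B (block_matrix A B C D) = B"
  "block_C (block_matrix A B C D) = C" "block_D (block_matrix A B C D) = D"
  by (simp_all add: matrix_eq_iff)

lemma block_matrix_eta: "block_matrix (block_A M) (block_B M) (block_C M) (block_D M) = M"
  by (simp add: matrix_eq_iff all_plus_type)

lemma block_matrix_cases:
  obtains A B C D where "M = block_matrix A B C D"
  by (metis block_matrix_eta)

lemma block_matrix_eq_iff:
  "block_matrix A B C D = block_matrix A' B' C' D' \<longleftrightarrow> A = A' \<and> B = B' \<and> C = C' \<and> D = D'"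
  by (metis block_of_block_matrix)

lemma block_matrix_mult:
  "block_matrix A B C D ** block_matrix A' B' C' D' =
     block_matrix (A ** A' + B ** C') (A ** B' + B ** D') (C ** A' + D ** C') (C ** B' + D ** D')"
  by (simp add: matrix_eq_iff all_plus_type matrix_matrix_mult_def sum_plus_type)

lemma transpose_block_matrix: "transpose (block_matrix A B C D) =
    block_matrix (transpose A) (transpose C) (transpose B) (transpose D)"
  by (simp add: matrix_eq_iff all_plus_type transpose_def)

lemma block_matrix_add: "block_matrix A B C D + block_matrix A' B' C' D' =
    block_matrix (A + A') (B + B') (C + C') (D + D')"
  and block_matrix_minus: "- block_matrix A B C D = block_matrix (- A) (- B) (- C) (- D)"
  and block_matrix_sm: "sm c (block_matrix A B C D) = block_matrix (sm c A) (sm c B) (sm c C) (sm c D)"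
  by (simp_all add: matrix_eq_iff all_plus_type)

lemma mat_block: "(mat c :: 'a::zero^('g::finite + 'g)^('g + 'g)) = block_matrix (mat c) 0 0 (mat c)"
  by (simp add: matrix_eq_iff all_plus_type mat_def)

lemma cmat_block_matrix: "cmat (block_matrix A B C D) = block_matrix (cmat A) (cmat B) (cmat C) (cmat D)"
  by (simp add: matrix_eq_iff all_plus_type)

lemmas block_simps = block_matrix_mult transpose_block_matrix block_matrix_add block_matrix_minus
  block_matrix_sm cmat_block_matrix block_matrix_eq_iff

text \<open>A \<open>2g \<times> n\<close> matrix from its upper and lower half, matching the block
  form of the \<open>2g \<times> 2g\<close> matrices.\<close>

definition stack :: "'a^'n^'g \<Rightarrow> 'a^'n^'g \<Rightarrow> 'a^'n^('g + 'g)" where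
  "stack P Q = (\<chi> i. case i of Inl i' \<Rightarrow> P $ i' | Inr i' \<Rightarrow> Q $ i')"

lemma stack_nth [simp]: "stack P Q $ Inl i = P $ i" "stack P Q $ Inr i = Q $ i"
  by (simp_all add: stack_def)

lemma stack_eq_iff: "stack P Q = stack P' Q' \<longleftrightarrow> P = P' \<and> Q = Q'"
  by (auto simp: matrix_eq_iff all_plus_type)

lemma stack_cases: obtains P Q where "F = stack P Q"
proof
  show "F = stack (\<chi> i. F $ Inl i) (\<chi> i. F $ Inr i)"
    by (simp add: matrix_eq_iff all_plus_type)
qed

lemma block_matrix_stack: "block_matrix A B C D ** stack P Q = stack (A ** P + B ** Q) (C ** P + D ** Q)"
  by (simp add: matrix_eq_iff all_plus_type matrix_matrix_mult_def sum_plus_type)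

lemma stack_mult: "stack P Q ** X = stack (P ** X) (Q ** X)"
  by (simp add: matrix_eq_iff all_plus_type matrix_matrix_mult_def)

lemma sm_stack: "sm c (stack P Q) = stack (sm c P) (sm c Q)"
  by (simp add: matrix_eq_iff all_plus_type)

lemma transpose_stack_mult: "transpose (stack P Q) ** stack R S = transpose P ** R + transpose Q ** S"
  by (simp add: matrix_eq_iff matrix_matrix_mult_def transpose_def sum_plus_type)

section \<open>Symplectic similitudes\<close>

definition similitude :: "real \<Rightarrow> 'g::finite bmatrix \<Rightarrow> bool" where
  "similitude k M \<longleftrightarrow> M ** symplectic_form ** transpose M = sm k symplectic_form"

text \<open>The adjoint for the symplectic form. For a similitude of multiplier \<open>k\<close> it
  is \<open>k\<close> times the inverse, but unlike the inverse it is visibly integral, respects the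
  level structure and is defined for every matrix.\<close>

definition sadj :: "'g::finite bmatrix \<Rightarrow> 'g bmatrix" where
  "sadj M = - (symplectic_form ** transpose M ** symplectic_form)"

lemma symplectic_form_square: "symplectic_form ** symplectic_form = - mat 1"
  by (simp add: symplectic_form_def block_simps mat_block minus_mult_left' minus_mult_right')

lemma symplectic_form_transpose: "transpose symplectic_form = - symplectic_form"
  by (simp add: symplectic_form_def block_simps transpose_minus)

lemma sadj_block: "sadj (block_matrix A B C D) =
    block_matrix (transpose D) (- transpose B) (- transpose C) (transpose A)"
  by (simp add: sadj_def symplectic_form_def block_simps minus_mult_left' minus_mult_right')

lemma sadj_mult: "sadj (M ** M') = sadj M' ** sadj M"
proof -
  have "sadj M' ** sadj M = symplectic_form ** transpose M' ** (symplectic_form ** symplectic_form) **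
     transpose M ** symplectic_form"
    by (simp add: sadj_def matrix_ring_simps)
  also have "\<dots> = sadj (M ** M')"
    by (simp add: symplectic_form_square sadj_def matrix_transpose_mul matrix_ring_simps)
  finally show ?thesis ..
qed

lemma sadj_sadj [simp]: "sadj (sadj M) = M"
  by (cases M rule: block_matrix_cases) (simp add: sadj_block transpose_minus)

lemma sadj_mat [simp]: "sadj (mat c) = mat c"
  by (simp add: sadj_block mat_block)

lemma similitude_iff_mult_sadj: "similitude k M \<longleftrightarrow> M ** sadj M = mat k"
proof -
  have *: "M ** sadj M = - (M ** symplectic_form ** transpose M) ** symplectic_form"
    by (simp add: sadj_def matrix_ring_simps)
  have "M ** sadj M = mat k" if "similitude k M"
    using that unfolding similitude_def *
    by (simp add: matrix_ring_simps symplectic_form_square sm_mat)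
  moreover have "similitude k M" if "M ** sadj M = mat k"
  proof -
    have "M ** symplectic_form ** transpose M =
      (- (M ** symplectic_form ** transpose M) ** symplectic_form) ** symplectic_form"
      by (simp add: minus_mult_left' matrix_mul_assoc[symmetric] symplectic_form_square minus_mult_right')
    also have "\<dots> = sm k symplectic_form"
      using that by (simp add: * mat_mult_eq_sm)
    finally show ?thesis
      by (simp add: similitude_def)
  qed
  ultimately show ?thesis by blast
qed

lemma similitude_mult:
  assumes "similitude k M" "similitude l M'"
  shows "similitude (k * l) (M ** M')"
proof -
  have "(M ** M') ** sadj (M ** M') = M ** (M' ** sadj M') ** sadj M"
    by (simp add: sadj_mult matrix_mul_assoc)
  also have "\<dots> = mat (k * l)"
    using assms by (simp add: similitude_iff_mult_sadj matrix_ring_simps sm_mat mult.commute)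
  finally show ?thesis
    by (simp add: similitude_iff_mult_sadj)
qed

lemma similitude_sadj_mult:
  assumes "similitude k M" "k \<noteq> 0"
  shows "sadj M ** M = mat k"
proof -
  have "M ** sm (1 / k) (sadj M) = mat 1"
    using assms by (simp add: similitude_iff_mult_sadj sm_mult_right sm_mat)
  then have "sm (1 / k) (sadj M) ** M = mat 1"
    by (simp add: matrix_left_right_inverse)
  then have "sm k (sm (1 / k) (sadj M) ** M) = sm k (mat 1)"
    by simp
  then show ?thesis
    using assms by (simp add: sm_mult_left sm_sm sm_mat)
qed

lemma similitude_sadj: "similitude k M \<Longrightarrow> k \<noteq> 0 \<Longrightarrow> similitude k (sadj M)"
  by (simp add: similitude_iff_mult_sadj[of k "sadj M"] similitude_sadj_mult)

lemma similitude_transpose: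
  assumes "similitude k M" "k \<noteq> 0"
  shows "transpose M ** symplectic_form ** M = sm k symplectic_form"
proof -
  have "symplectic_form ** (sadj M ** M) = transpose M ** symplectic_form ** M"
    by (simp add: sadj_def matrix_ring_simps symplectic_form_square)
  then show ?thesis
    by (simp add: similitude_sadj_mult[OF assms] mult_mat_eq_sm)
qed

lemma similitude_mat: "similitude (c\<^sup>2) (mat c)"
  by (simp add: similitude_iff_mult_sadj matrix_ring_simps sm_mat power2_eq_square)

lemma similitude_one [simp]: "similitude 1 (mat 1)"
  using similitude_mat[of 1] by simp

section \<open>The action on the Siegel space\<close>

text \<open>The columns of \<open>frame \<tau>\<close> span the Lagrangian subspace attached to
  \<open>\<tau>\<close>. On frames the fractional linear action becomes a matrix product, up to the
  factor of automorphy on the right; composition of actions, fixed points and periods are all read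
  off from this product.\<close>

definition frame :: "'g::finite cmatrix \<Rightarrow> complex^'g^('g + 'g)" where
  "frame \<tau> = stack \<tau> (mat 1)"

lemma frame_mult: "frame \<tau> ** X = stack (\<tau> ** X) X"
  by (simp add: frame_def stack_mult)

lemma cmat_mult_frame:
  "cmat M ** frame \<tau> = stack (cmat (block_A M) ** \<tau> + cmat (block_B M)) (automorphy M \<tau>)"
  by (cases M rule: block_matrix_cases)
    (simp add: frame_def cmat_block_matrix block_matrix_stack automorphy_def)

lemma matrix_inv_right: "invertible A \<Longrightarrow> A ** matrix_inv A = mat 1"
  and matrix_inv_left: "invertible A \<Longrightarrow> matrix_inv A ** A = mat 1"
  unfolding invertible_def matrix_inv_def by (metis (mono_tags, lifting) someI_ex)+

lemma invertible_transpose: "invertible A \<Longrightarrow> invertible (transpose (A :: 'a::field^'n^'n))"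
  unfolding invertible_def by (metis matrix_transpose_mul transpose_mat)

lemma frame_eq_cancel:
  assumes "frame \<tau> ** X = frame \<sigma> ** Y" "invertible X"
  shows "\<tau> = \<sigma>"
proof -
  have "X = Y" "\<tau> ** X = \<sigma> ** X"
    using assms by (auto simp: frame_mult stack_eq_iff)
  then have "\<tau> ** X ** matrix_inv X = \<sigma> ** X ** matrix_inv X"
    by simp
  then show ?thesis
    using assms by (simp add: matrix_mul_assoc[symmetric] matrix_inv_right)
qed

lemma symplectic_stack:
  "transpose (stack P Q) ** cmat symplectic_form ** stack R S = transpose P ** S - transpose Q ** R"
  by (simp add: symplectic_form_def cmat_block_matrix matrix_mul_assoc[symmetric]
      block_matrix_stack cmat_simps transpose_stack_mult minus_mult_left' minus_mult_right')

text \<open>One computation for two purposes: with \<open>G = H\<close> it gives the symmetry of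
  \<open>M \<tau>\<close>, with \<open>G\<close> the complex conjugate of \<open>H\<close> its
  positivity.\<close>

lemma similitude_form:
  assumes "similitude k M" "k \<noteq> 0"
  shows "transpose (cmat M ** G) ** cmat symplectic_form ** (cmat M ** H) =
    sm (of_real k) (transpose G ** cmat symplectic_form ** H)"
proof -
  have "cmat (transpose M ** symplectic_form ** M) = cmat (sm k symplectic_form)"
    using similitude_transpose[OF assms] by simp
  then have *: "transpose (cmat M) ** cmat symplectic_form ** cmat M = sm (of_real k) (cmat symplectic_form)"
    by (simp add: cmat_simps)
  have "transpose (cmat M ** G) ** cmat symplectic_form ** (cmat M ** H) =
    transpose G ** (transpose (cmat M) ** cmat symplectic_form ** cmat M) ** H"
    by (simp add: matrix_transpose_mul matrix_mul_assoc)
  then show ?thesis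
    by (simp add: * sm_mult_left sm_mult_right)
qed

definition cadj :: "complex^'n^'m \<Rightarrow> complex^'m^'n" where
  "cadj A = transpose (map_matrix cnj A)"

lemma inner_cadj: "(A *v x) \<bullet> y = x \<bullet> (cadj A *v y)"
proof -
  have "(A *v x) \<bullet> y = (\<Sum>i\<in>UNIV. \<Sum>j\<in>UNIV. (A $ i $ j * x $ j) \<bullet> y $ i)"
    by (simp add: inner_vec_def matrix_vector_mult_def inner_sum_left)
  also have "\<dots> = (\<Sum>j\<in>UNIV. \<Sum>i\<in>UNIV. (A $ i $ j * x $ j) \<bullet> y $ i)"
    by (rule sum.swap)
  also have "\<dots> = (\<Sum>j\<in>UNIV. \<Sum>i\<in>UNIV. x $ j \<bullet> (cnj (A $ i $ j) * y $ i))"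
    by (simp add: inner_complex_def algebra_simps)
  finally show ?thesis
    by (simp add: inner_vec_def matrix_vector_mult_def cadj_def transpose_def inner_sum_right)
qed

lemma inner_i_swap: "(\<i> *s x) \<bullet> y = - ((\<i> *s y) \<bullet> (x :: complex^'n))"
  by (simp add: inner_vec_def inner_complex_def sum_negf[symmetric] algebra_simps)

lemma matrix_vector_smult: "(A :: complex^'n^'m) *v (c *s x) = c *s (A *v x)"
  by (simp add: vec_eq_iff matrix_vector_mult_def sum_distrib_left algebra_simps)

lemma cmat_cnj: "map_matrix cnj (cmat M ** G) = cmat M ** map_matrix cnj G"
  by (simp add: matrix_eq_iff matrix_matrix_mult_def)

lemma cnj_stack: "map_matrix cnj (stack P Q) = stack (map_matrix cnj P) (map_matrix cnj Q)"
  by (simp add: matrix_eq_iff all_plus_type)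

lemma sm_vector: "sm c A *v x = c *s (A *v x)"
  by (simp add: vec_eq_iff matrix_vector_mult_def sum_distrib_left mult.assoc)

text \<open>The values of the Hermitian form \<open>(w\<^sup>* \<tau> w - (\<tau> w)\<^sup>* w) / 2\<i>\<close>; a similitude carries it to
  a positive multiple, which is what makes the action preserve positivity.\<close>

definition im_form :: "'g::finite cmatrix \<Rightarrow> complex^'g \<Rightarrow> real" where
  "im_form \<tau> w = (\<i> *s w) \<bullet> (\<tau> *v w)"

lemma im_form_automorphy:
  assumes "similitude k M" "k \<noteq> 0"
  shows "(\<i> *s (automorphy M \<tau> *v w)) \<bullet> ((cmat (block_A M) ** \<tau> + cmat (block_B M)) *v w) =
    k * im_form \<tau> w"
proof -
  let ?U = "cmat (block_A M) ** \<tau> + cmat (block_B M)" and ?V = "automorphy M \<tau>"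
  let ?F = "frame \<tau>"
  have "transpose (cmat M ** map_matrix cnj ?F) ** cmat symplectic_form ** (cmat M ** ?F) =
    sm (of_real k) (transpose (map_matrix cnj ?F) ** cmat symplectic_form ** ?F)"
    by (rule similitude_form[OF assms])
  then have eq: "cadj ?U ** ?V - cadj ?V ** ?U = sm (of_real k) (cadj \<tau> - \<tau>)"
    unfolding cmat_cnj[symmetric] cmat_mult_frame cnj_stack
    by (simp add: symplectic_stack frame_def cnj_stack cadj_def[symmetric])
      (simp add: cadj_def transpose_def map_matrix_def mat_def matrix_eq_iff sm_def
         matrix_matrix_mult_def if_distrib if_distribR cong: if_cong)
  have real_smult: "(x::complex^'g) \<bullet> (of_real k *s y) = k * (x \<bullet> y)" for x y
    by (simp add: inner_vec_def inner_complex_def sum_distrib_left algebra_simps)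
  have "2 * ((\<i> *s (?V *v w)) \<bullet> (?U *v w)) =
    (\<i> *s (?V *v w)) \<bullet> (?U *v w) - (\<i> *s (?U *v w)) \<bullet> (?V *v w)"
    using inner_i_swap[of "?U *v w" "?V *v w"] by simp
  also have "\<dots> = - ((\<i> *s w) \<bullet> ((cadj ?U ** ?V - cadj ?V ** ?U) *v w))"
    by (simp add: matrix_vector_smult[symmetric] inner_cadj matrix_vector_mul_assoc
        matrix_vector_mult_diff_rdistrib inner_diff_right)
  also have "\<dots> = k * ((\<i> *s w) \<bullet> (\<tau> *v w) - (\<i> *s w) \<bullet> (cadj \<tau> *v w))"
    unfolding eq sm_vector real_smult
    by (simp add: matrix_vector_mult_diff_rdistrib inner_diff_right algebra_simps)
  also have "(\<i> *s w) \<bullet> (cadj \<tau> *v w) = - ((\<i> *s w) \<bullet> (\<tau> *v w))"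
    using inner_i_swap[of "\<tau> *v w" w] by (simp add: inner_cadj[symmetric] matrix_vector_smult)
  finally show ?thesis
    by (simp add: im_form_def)
qed

lemma im_form_real_imag:
  assumes "transpose \<tau> = \<tau>"
  shows "im_form \<tau> w = (\<chi> i. Re (w $ i)) \<bullet> (map_matrix Im \<tau> *v (\<chi> i. Re (w $ i))) +
    (\<chi> i. Im (w $ i)) \<bullet> (map_matrix Im \<tau> *v (\<chi> i. Im (w $ i)))"
proof -
  let ?a = "\<chi> i. Re (w $ i)" and ?b = "\<chi> i. Im (w $ i)"
  let ?X = "map_matrix Re \<tau>" and ?Y = "map_matrix Im \<tau>"
  have "im_form \<tau> w = (\<Sum>i\<in>UNIV. - Im (w $ i) * (\<Sum>j\<in>UNIV. Re (\<tau> $ i $ j) * Re (w $ j) - Im (\<tau> $ i $ j) * Im (w $ j))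
     + Re (w $ i) * (\<Sum>j\<in>UNIV. Re (\<tau> $ i $ j) * Im (w $ j) + Im (\<tau> $ i $ j) * Re (w $ j)))"
    by (simp add: im_form_def inner_vec_def inner_complex_def matrix_vector_mult_def)
  also have "\<dots> = ?a \<bullet> (?Y *v ?a) + ?b \<bullet> (?Y *v ?b) + ?a \<bullet> (?X *v ?b) - ?b \<bullet> (?X *v ?a)"
    by (simp add: inner_vec_def matrix_vector_mult_def sum.distrib sum_subtractf algebra_simps
        sum_negf)
  also have "?b \<bullet> (?X *v ?a) = ?a \<bullet> (?X *v ?b)"
  proof -
    have "transpose ?X = ?X"
      using assms by (simp add: matrix_eq_iff transpose_def)
    then have "?b v* ?X = ?X *v ?b"
      by (metis transpose_matrix_vector)
    then show ?thesis
      using dot_lmul_matrix[of ?b ?X ?a] by (simp add: inner_commute)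
  qed
  finally show ?thesis by simp
qed

text \<open>Positivity is tested on real vectors in the definition of the Siegel space. The factor
  of automorphy is complex, so complex test vectors are needed; their real and imaginary parts
  separate because \<open>\<tau>\<close> is symmetric.\<close>

lemma siegel_space_iff:
  "\<tau> \<in> siegel_space \<longleftrightarrow> transpose \<tau> = \<tau> \<and> (\<forall>w. w \<noteq> 0 \<longrightarrow> 0 < im_form \<tau> w)"
proof (cases "transpose \<tau> = \<tau>")
  case True
  have "0 < im_form \<tau> w" if pos: "\<forall>x::real^'a. x \<noteq> 0 \<longrightarrow> 0 < x \<bullet> (map_matrix Im \<tau> *v x)" and "w \<noteq> 0" for w
  proof -
    have nonneg: "0 \<le> x \<bullet> (map_matrix Im \<tau> *v x)" for x
      using pos by (cases "x = 0") (auto intro: less_imp_le)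
    have "(\<chi> i. Re (w $ i)) \<noteq> 0 \<or> (\<chi> i. Im (w $ i)) \<noteq> 0"
      using \<open>w \<noteq> 0\<close> by (auto simp: vec_eq_iff complex_eq_iff)
    then show ?thesis
      unfolding im_form_real_imag[OF True]
      by (metis add_pos_nonneg add_nonneg_pos nonneg pos)
  qed
  moreover have "0 < x \<bullet> (map_matrix Im \<tau> *v x)" if "\<forall>w. w \<noteq> 0 \<longrightarrow> 0 < im_form \<tau> w" "x \<noteq> 0" for x :: "real^'a"
  proof -
    have "(\<chi> i. complex_of_real (x $ i)) \<noteq> 0"
      using \<open>x \<noteq> 0\<close> by (auto simp: vec_eq_iff)
    then have "0 < im_form \<tau> (\<chi> i. complex_of_real (x $ i))"
      using that by blast
    then show ?thesis
      by (simp add: im_form_real_imag[OF True] zero_vec_def[symmetric])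
  qed
  ultimately show ?thesis
    using True by (auto simp: siegel_space_def)
qed (auto simp: siegel_space_def)

lemma siegel_spaceD: "\<tau> \<in> siegel_space \<Longrightarrow> transpose \<tau> = \<tau>"
  and siegel_space_pos: "\<tau> \<in> siegel_space \<Longrightarrow> w \<noteq> 0 \<Longrightarrow> 0 < im_form \<tau> w"
  by (simp_all add: siegel_space_iff)

lemma invertible_if_injective:
  fixes A :: "complex^'n^'n"
  assumes "\<And>w. A *v w = 0 \<Longrightarrow> w = 0"
  shows "invertible A"
  using assms by (metis invertible_left_inverse matrix_left_invertible_ker)

text \<open>A vector killed by the factor of automorphy has zero Hermitian length.\<close>

lemma automorphy_invertible:
  assumes "similitude k M" "k \<noteq> 0" "\<tau> \<in> siegel_space"
  shows "invertible (automorphy M \<tau>)"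
proof (rule invertible_if_injective)
  fix w assume "automorphy M \<tau> *v w = 0"
  then have "k * im_form \<tau> w = 0"
    using im_form_automorphy[OF assms(1,2), of \<tau> w] by simp
  then show "w = 0"
    using assms siegel_space_pos by force
qed

lemma similitude_frame:
  assumes "similitude k M" "k \<noteq> 0" "\<tau> \<in> siegel_space"
  shows "cmat M ** frame \<tau> = frame (siegel_action M \<tau>) ** automorphy M \<tau>"
proof -
  have "siegel_action M \<tau> ** automorphy M \<tau> = cmat (block_A M) ** \<tau> + cmat (block_B M)"
    using automorphy_invertible[OF assms]
    by (simp add: siegel_action_def matrix_mul_assoc[symmetric] matrix_inv_left)
  then show ?thesis
    by (simp add: cmat_mult_frame frame_mult)
qed

lemma siegel_action_eqI:
  assumes "similitude k M" "k \<noteq> 0" "\<tau> \<in> siegel_space" "cmat M ** frame \<tau> = frame \<sigma> ** X"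
  shows "siegel_action M \<tau> = \<sigma>"
  using frame_eq_cancel assms similitude_frame[OF assms(1-3)] automorphy_invertible[OF assms(1-3)]
  by metis

lemma similitude_symmetric:
  assumes "similitude k M" "k \<noteq> 0" "\<tau> \<in> siegel_space"
  shows "transpose (siegel_action M \<tau>) = siegel_action M \<tau>"
proof -
  let ?\<sigma> = "siegel_action M \<tau>" and ?a = "automorphy M \<tau>"
  have "transpose (frame ?\<sigma> ** ?a) ** cmat symplectic_form ** (frame ?\<sigma> ** ?a) =
    sm (of_real k) (transpose \<tau> - \<tau>)"
    unfolding similitude_frame[OF assms, symmetric] similitude_form[OF assms(1,2)]
    by (simp add: frame_def symplectic_stack)
  then have "transpose ?a ** (transpose ?\<sigma> - ?\<sigma>) ** ?a = 0"
    using siegel_spaceD[OF assms(3)]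
    by (simp add: frame_mult symplectic_stack matrix_ring_simps matrix_transpose_mul)
  then have "matrix_inv (transpose ?a) ** (transpose ?a ** (transpose ?\<sigma> - ?\<sigma>) ** ?a) ** matrix_inv ?a = 0"
    by simp
  moreover have "matrix_inv (transpose ?a) ** (transpose ?a ** (transpose ?\<sigma> - ?\<sigma>) ** ?a) ** matrix_inv ?a =
     (matrix_inv (transpose ?a) ** transpose ?a) ** (transpose ?\<sigma> - ?\<sigma>) ** (?a ** matrix_inv ?a)"
    by (simp add: matrix_mul_assoc)
  ultimately show ?thesis
    using automorphy_invertible[OF assms] by (simp add: matrix_inv_left matrix_inv_right invertible_transpose)
qed

lemma siegel_action_in:
  assumes "similitude k M" "0 < k" "\<tau> \<in> siegel_space"
  shows "siegel_action M \<tau> \<in> siegel_space"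
  unfolding siegel_space_iff
proof (intro conjI allI impI)
  have k: "k \<noteq> 0" using assms by simp
  note inv = automorphy_invertible[OF assms(1) k assms(3)]
  show "transpose (siegel_action M \<tau>) = siegel_action M \<tau>"
    using similitude_symmetric[OF assms(1) k assms(3)] .
  fix u :: "complex^'a" assume "u \<noteq> 0"
  define w where "w = matrix_inv (automorphy M \<tau>) *v u"
  have u: "automorphy M \<tau> *v w = u"
    by (simp add: w_def matrix_vector_mul_assoc matrix_inv_right[OF inv])
  then have "w \<noteq> 0"
    using \<open>u \<noteq> 0\<close> by auto
  have "siegel_action M \<tau> *v u = (cmat (block_A M) ** \<tau> + cmat (block_B M)) *v w"
    by (simp add: siegel_action_def w_def matrix_vector_mul_assoc)
  then have "im_form (siegel_action M \<tau>) u = k * im_form \<tau> w"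
    using im_form_automorphy[OF assms(1) k, of \<tau> w] by (simp add: im_form_def[of "siegel_action M \<tau>"] u)
  then show "0 < im_form (siegel_action M \<tau>) u"
    using assms(2) siegel_space_pos[OF assms(3) \<open>w \<noteq> 0\<close>] by simp
qed

lemma siegel_action_mult:
  assumes "similitude k M" "0 < k" "similitude l M'" "0 < l" "\<tau> \<in> siegel_space"
  shows "siegel_action (M ** M') \<tau> = siegel_action M (siegel_action M' \<tau>)"
proof (rule siegel_action_eqI[OF similitude_mult[OF assms(1,3)]])
  have "siegel_action M' \<tau> \<in> siegel_space"
    using siegel_action_in assms by blast
  then show "cmat (M ** M') ** frame \<tau> = frame (siegel_action M (siegel_action M' \<tau>)) **
     (automorphy M (siegel_action M' \<tau>) ** automorphy M' \<tau>)"
    using similitude_frame[OF assms(1)] similitude_frame[OF assms(3)] assms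
    by (simp add: cmat_mult) (metis less_irrefl matrix_mul_assoc)
qed (use assms in auto)

lemma siegel_action_mat:
  assumes "c \<noteq> 0" "\<tau> \<in> siegel_space"
  shows "siegel_action (mat c) \<tau> = \<tau>"
  by (rule siegel_action_eqI[OF similitude_mat, where X = "mat (of_real c)"])
    (use assms in \<open>auto simp: cmat_mat mat_mult_eq_sm mult_mat_eq_sm\<close>)

lemma siegel_action_one [simp]: "\<tau> \<in> siegel_space \<Longrightarrow> siegel_action (mat 1) \<tau> = \<tau>"
  by (simp add: siegel_action_mat)

lemma siegel_action_sadj:
  assumes "similitude k M" "0 < k" "\<tau> \<in> siegel_space"
  shows "siegel_action (sadj M) (siegel_action M \<tau>) = \<tau>"
    and "siegel_action M (siegel_action (sadj M) \<tau>) = \<tau>"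
proof -
  have s: "similitude k (sadj M)"
    using assms similitude_sadj by force
  have "sadj M ** M = mat k" "M ** sadj M = mat k"
    using assms similitude_sadj_mult similitude_iff_mult_sadj by force+
  then show "siegel_action (sadj M) (siegel_action M \<tau>) = \<tau>"
    "siegel_action M (siegel_action (sadj M) \<tau>) = \<tau>"
    using siegel_action_mult[OF s assms(2,1,2,3)] siegel_action_mult[OF assms(1,2) s assms(2,3)]
      siegel_action_mat[of k \<tau>] assms by auto
qed

section \<open>Fixed point sets\<close>

text \<open>The \<open>\<tau>\<close> for which \<open>j\<close> preserves the Lagrangian subspace,
  i.e. acts complex linearly on the real vector space whose complex structure is given by
  \<open>\<tau>\<close>. For a similitude these are the fixed points of its action. In this form the
  condition does not change if \<open>j\<close> is scaled, is polynomial in \<open>\<tau>\<close>,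
  and is transported by conjugation.\<close>

definition fixset :: "'g::finite bmatrix \<Rightarrow> 'g cmatrix set" where
  "fixset j = {\<tau> \<in> siegel_space. \<exists>X. cmat j ** frame \<tau> = frame \<tau> ** X}"

lemma fixset_iff_action:
  assumes "similitude k j" "k \<noteq> 0"
  shows "\<tau> \<in> fixset j \<longleftrightarrow> \<tau> \<in> siegel_space \<and> siegel_action j \<tau> = \<tau>"
  using siegel_action_eqI[OF assms] similitude_frame[OF assms] by (auto simp: fixset_def)

lemma fixset_iff_equation:
  "\<tau> \<in> fixset j \<longleftrightarrow> \<tau> \<in> siegel_space \<and>
     cmat (block_A j) ** \<tau> + cmat (block_B j) = \<tau> ** automorphy j \<tau>"
  by (auto simp: fixset_def cmat_mult_frame frame_mult stack_eq_iff)

lemma fixset_sm: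
  assumes "c \<noteq> 0"
  shows "fixset (sm c j) = fixset j"
proof -
  have "fixset j \<subseteq> fixset (sm d j)" for d and j :: "'a bmatrix"
  proof
    fix \<tau> assume "\<tau> \<in> fixset j"
    then obtain X where "\<tau> \<in> siegel_space" "cmat j ** frame \<tau> = frame \<tau> ** X"
      by (auto simp: fixset_def)
    then have "cmat (sm d j) ** frame \<tau> = frame \<tau> ** sm (of_real d) X"
      by (simp add: cmat_sm sm_mult_left sm_mult_right)
    then show "\<tau> \<in> fixset (sm d j)"
      using \<open>\<tau> \<in> siegel_space\<close> by (auto simp: fixset_def)
  qed
  from this[of j c] this[of "sm c j" "1 / c"] show ?thesis
    using assms by (simp add: sm_sm subset_antisym)
qed

lemma fixset_conj_sub:
  assumes M: "similitude k M" "0 < k" and \<tau>: "\<tau> \<in> fixset j"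
  shows "siegel_action M \<tau> \<in> fixset (M ** j ** sadj M)"
proof -
  have H: "\<tau> \<in> siegel_space" and k: "k \<noteq> 0"
    using \<tau> M by (auto simp: fixset_def)
  obtain X where X: "cmat j ** frame \<tau> = frame \<tau> ** X"
    using \<tau> by (auto simp: fixset_def)
  let ?a = "automorphy M \<tau>" and ?\<sigma> = "siegel_action M \<tau>"
  have inv: "invertible ?a"
    using automorphy_invertible[OF M(1) k H] .
  have fr: "cmat M ** frame \<tau> = frame ?\<sigma> ** ?a"
    using similitude_frame[OF M(1) k H] .
  have "cmat (M ** j ** sadj M) ** (cmat M ** frame \<tau>) = cmat (M ** j ** (sadj M ** M)) ** frame \<tau>"
    by (simp add: cmat_mult matrix_mul_assoc)
  also have "\<dots> = sm (of_real k) (cmat M ** (cmat j ** frame \<tau>))"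
    using similitude_sadj_mult[OF M(1) k]
    by (simp add: cmat_mult cmat_sm mult_mat_eq_sm sm_mult_left matrix_mul_assoc)
  also have "\<dots> = sm (of_real k) (frame ?\<sigma> ** ?a ** X)"
    by (simp add: X matrix_mul_assoc fr)
  finally have "cmat (M ** j ** sadj M) ** (frame ?\<sigma> ** ?a) ** matrix_inv ?a =
     sm (of_real k) (frame ?\<sigma> ** ?a ** X) ** matrix_inv ?a"
    by (simp add: fr)
  then have "cmat (M ** j ** sadj M) ** frame ?\<sigma> ** (?a ** matrix_inv ?a) =
     frame ?\<sigma> ** sm (of_real k) (?a ** X ** matrix_inv ?a)"
    by (simp add: matrix_mul_assoc sm_mult_left sm_mult_right)
  then show ?thesis
    using inv siegel_action_in[OF M H] by (auto simp: fixset_def matrix_inv_right)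
qed

lemma fixset_conj:
  assumes M: "similitude k M" "0 < k" and H: "\<tau> \<in> siegel_space"
  shows "siegel_action M \<tau> \<in> fixset (M ** j ** sadj M) \<longleftrightarrow> \<tau> \<in> fixset j"
proof
  assume "siegel_action M \<tau> \<in> fixset (M ** j ** sadj M)"
  then have "siegel_action (sadj M) (siegel_action M \<tau>) \<in> fixset (sadj M ** (M ** j ** sadj M) ** sadj (sadj M))"
    using fixset_conj_sub[of k "sadj M"] M similitude_sadj by force
  moreover have "sadj M ** (M ** j ** sadj M) ** sadj (sadj M) = sadj M ** M ** j ** (sadj M ** M)"
    by (simp add: matrix_mul_assoc)
  ultimately have "\<tau> \<in> fixset (sm (k * k) j)"
    using similitude_sadj_mult[OF M(1)] M siegel_action_sadj[OF M H]
    by (simp add: mat_mult_eq_sm mult_mat_eq_sm sm_sm)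
  then show "\<tau> \<in> fixset j"
    using M fixset_sm[of "k * k" j] by simp
qed (rule fixset_conj_sub[OF M])

section \<open>Square roots of positive definite matrices\<close>

lemma posdef_lower_bound:
  fixes P :: "real^'n^'n"
  assumes pos: "\<And>x. x \<noteq> 0 \<Longrightarrow> 0 < x \<bullet> (P *v x)"
  obtains m where "0 < m" "\<And>x. m * (norm x)\<^sup>2 \<le> x \<bullet> (P *v x)"
proof -
  have "\<exists>x\<in>sphere (0::real^'n) 1. \<forall>y\<in>sphere 0 1. x \<bullet> (P *v x) \<le> y \<bullet> (P *v y)"
    by (intro continuous_attains_inf continuous_intros compact_sphere
        linear_continuous_on matrix_vector_mul_bounded_linear)
      (auto intro!: exI[of _ "axis undefined 1"] simp: norm_axis_1)
  then obtain x0 :: "real^'n" where x0: "norm x0 = 1"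
    "\<And>y. norm y = 1 \<Longrightarrow> x0 \<bullet> (P *v x0) \<le> y \<bullet> (P *v y)"
    by auto
  define m where "m = x0 \<bullet> (P *v x0)"
  have "0 < m"
    unfolding m_def using x0 by (intro pos) auto
  have lower: "m * (norm x)\<^sup>2 \<le> x \<bullet> (P *v x)" for x
  proof (cases "x = 0")
    case False
    then have "m \<le> (x /\<^sub>R norm x) \<bullet> (P *v (x /\<^sub>R norm x))"
      unfolding m_def by (intro x0) simp
    then have "m \<le> (x \<bullet> (P *v x)) / (norm x)\<^sup>2"
      by (simp add: matrix_vector_mult_scaleR power2_eq_square field_simps)
    then show ?thesis
      using False by (simp add: field_simps)
  qed simp
  show ?thesis
    using that[OF \<open>0 < m\<close> lower] .
qed

text \<open>With \<open>m |x|\<^sup>2 \<le> x \<bullet> P x\<close> and \<open>|P x| \<le> K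
  |x|\<close> one has \<open>|x - c P x|\<^sup>2 \<le> (1 - 2 c m + c\<^sup>2 K\<^sup>2)
  |x|\<^sup>2\<close>, which is smallest for \<open>c = m / K\<^sup>2\<close>.\<close>

lemma linear_contraction_of_posdef:
  fixes P :: "real^'n^'n"
  assumes pos: "\<And>x. x \<noteq> 0 \<Longrightarrow> 0 < x \<bullet> (P *v x)"
  obtains c q where "0 < c" "0 \<le> q" "q < 1" "\<And>x. norm (x - c *\<^sub>R (P *v x)) \<le> q * norm x"
proof -
  obtain m where "0 < m" and lower: "\<And>x. m * (norm x)\<^sup>2 \<le> x \<bullet> (P *v x)"
    using posdef_lower_bound[OF pos] by metis
  define K where "K = onorm ((*v) P) + m"
  have "0 \<le> onorm ((*v) P)"
    by (rule onorm_pos_le) simp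
  then have K: "m \<le> K" "0 < K"
    using \<open>0 < m\<close> by (auto simp: K_def)
  have upper: "norm (P *v x) \<le> K * norm x" for x
  proof -
    have "norm (P *v x) \<le> onorm ((*v) P) * norm x"
      by (rule onorm) simp
    also have "\<dots> \<le> K * norm x"
      using \<open>0 < m\<close> by (intro mult_right_mono) (auto simp: K_def)
    finally show ?thesis .
  qed
  define c where "c = m / K\<^sup>2"
  define q where "q = sqrt (1 - m\<^sup>2 / K\<^sup>2)"
  have "m\<^sup>2 \<le> K\<^sup>2"
    using K \<open>0 < m\<close> by (intro power_mono) auto
  then have q: "0 \<le> 1 - m\<^sup>2 / K\<^sup>2" "1 - m\<^sup>2 / K\<^sup>2 < 1"
    using K \<open>0 < m\<close> by (auto simp: field_simps)
  show ?thesis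
  proof
    show "0 < c" "0 \<le> q" "q < 1"
      using K \<open>0 < m\<close> q by (auto simp: c_def q_def real_sqrt_lt_1_iff)
    fix x
    have "(norm (x - c *\<^sub>R (P *v x)))\<^sup>2 = (norm x)\<^sup>2 - 2 * c * (x \<bullet> (P *v x)) + c\<^sup>2 * (norm (P *v x))\<^sup>2"
      unfolding power2_norm_eq_inner
      by (simp add: inner_diff_left inner_diff_right inner_commute power2_eq_square algebra_simps)
    also have "\<dots> \<le> (norm x)\<^sup>2 - 2 * c * (m * (norm x)\<^sup>2) + c\<^sup>2 * (K * norm x)\<^sup>2"
      using lower[of x] upper[of x] \<open>0 < c\<close>
      by (intro add_mono diff_mono mult_left_mono power_mono) auto
    also have "\<dots> = (1 - m\<^sup>2 / K\<^sup>2) * (norm x)\<^sup>2"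
      using K by (simp add: c_def power2_eq_square field_simps)
    also have "\<dots> = (q * norm x)\<^sup>2"
      using q by (simp add: q_def power_mult_distrib)
    finally show "norm (x - c *\<^sub>R (P *v x)) \<le> q * norm x"
      using q by (auto simp: q_def intro: power2_le_imp_le)
  qed
qed

text \<open>For a contraction \<open>A\<close> the iteration \<open>Y \<mapsto> (A + Y\<^sup>2) / 2\<close> contracts the closed set of
  operators of norm at most \<open>q\<close> that inherit the symmetry and the commutation properties of \<open>A\<close>;
  its fixed point satisfies \<open>(1 - Y)\<^sup>2 = 1 - A\<close>.\<close>

lemma contraction_square_root:
  fixes A :: "'v::euclidean_space \<Rightarrow>\<^sub>L 'v"
  assumes q: "0 \<le> q" "q < 1" "norm A \<le> q" and sym: "\<And>x y. A x \<bullet> y = x \<bullet> A y"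
  obtains Y :: "'v \<Rightarrow>\<^sub>L 'v" where "norm Y \<le> q" "2 *\<^sub>R Y = A + (Y o\<^sub>L Y)"
    "\<And>x y. Y x \<bullet> y = x \<bullet> Y y" "\<And>T. T o\<^sub>L A = A o\<^sub>L T \<Longrightarrow> T o\<^sub>L Y = Y o\<^sub>L T"
proof -
  define s :: "('v \<Rightarrow>\<^sub>L 'v) set" where
    "s = {Y :: 'v \<Rightarrow>\<^sub>L 'v. norm Y \<le> q \<and> (\<forall>x y. blinfun_apply Y x \<bullet> y = x \<bullet> blinfun_apply Y y) \<and>
        (\<forall>T. T o\<^sub>L A = A o\<^sub>L T \<longrightarrow> T o\<^sub>L Y = Y o\<^sub>L T)}"
  define f :: "('v \<Rightarrow>\<^sub>L 'v) \<Rightarrow> ('v \<Rightarrow>\<^sub>L 'v)" where "f = (\<lambda>Y. (1/2) *\<^sub>R (A + (Y o\<^sub>L Y)))"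
  have "closed s"
    unfolding s_def
    by (intro closed_Collect_conj closed_Collect_all closed_Collect_imp closed_Collect_le
        closed_Collect_eq open_Collect_const continuous_intros
        bounded_bilinear.continuous_on[OF bounded_bilinear_blinfun_compose])
  then have "complete s"
    by (simp add: complete_eq_closed)
  moreover have "0 \<in> s"
    using q by (simp add: s_def)
  moreover have "f ` s \<subseteq> s"
  proof
    fix Z assume "Z \<in> f ` s"
    then obtain Y where Y: "Y \<in> s" "Z = f Y" by auto
    have "norm (A + (Y o\<^sub>L Y)) \<le> norm A + norm Y * norm Y"
      by (meson norm_triangle_mono norm_blinfun_compose order_refl)
    also have "\<dots> \<le> q + q * 1"
      using q Y by (intro add_mono mult_mono) (auto simp: s_def)
    finally have "norm Z \<le> q"
      by (simp add: Y f_def)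
    moreover have "Z x \<bullet> y = x \<bullet> Z y" for x y
    proof -
      have "\<And>x y. Y x \<bullet> y = x \<bullet> Y y"
        using Y by (simp add: s_def)
      then show ?thesis
        using sym by (simp add: Y(2) f_def blinfun.add_left blinfun.scaleR_left inner_add_left inner_add_right)
    qed
    moreover have "T o\<^sub>L Z = Z o\<^sub>L T" if T: "T o\<^sub>L A = A o\<^sub>L T" for T
    proof -
      have YT: "T o\<^sub>L Y = Y o\<^sub>L T"
        using Y T by (simp add: s_def)
      have pt: "T (Y x) = Y (T x)" "T (A x) = A (T x)" for x
        using YT T by (metis blinfun_apply_blinfun_compose)+
      show ?thesis
        by (rule blinfun_eqI)
          (simp add: Y f_def blinfun.add_left blinfun.scaleR_left blinfun.add_right blinfun.scaleR_right pt)
    qed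
    ultimately show "Z \<in> s"
      by (simp add: s_def)
  qed
  moreover have "dist (f Y) (f Z) \<le> q * dist Y Z" if "Y \<in> s" "Z \<in> s" for Y Z
  proof -
    have "(Y o\<^sub>L Y) - (Z o\<^sub>L Z) = (Y o\<^sub>L (Y - Z)) + ((Y - Z) o\<^sub>L Z)"
      by (rule blinfun_eqI) (simp add: blinfun.diff_left blinfun.diff_right blinfun.add_left)
    then have "f Y - f Z = (1/2) *\<^sub>R ((Y o\<^sub>L (Y - Z)) + ((Y - Z) o\<^sub>L Z))"
      by (simp add: f_def scaleR_diff_right[symmetric])
    also have "norm \<dots> \<le> (1/2) * (norm Y * norm (Y - Z) + norm (Y - Z) * norm Z)"
      by simp (intro norm_triangle_mono norm_blinfun_compose)
    also have "\<dots> \<le> (1/2) * (q * norm (Y - Z) + norm (Y - Z) * q)"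
      using that q by (intro mult_left_mono add_mono mult_right_mono) (auto simp: s_def)
    finally show ?thesis
      by (simp add: dist_norm algebra_simps)
  qed
  ultimately obtain Y where Y: "Y \<in> s" "f Y = Y"
    using Banach_fix[of s q f] q by blast
  show ?thesis
  proof (rule that[of Y])
    have "2 *\<^sub>R Y = 2 *\<^sub>R f Y"
      by (simp only: Y(2))
    then show "2 *\<^sub>R Y = A + (Y o\<^sub>L Y)"
      by (simp add: f_def)
  qed (use Y in \<open>auto simp: s_def\<close>)
qed

definition posdef :: "real^'n^'n \<Rightarrow> bool" where
  "posdef P \<longleftrightarrow> transpose P = P \<and> (\<forall>x. x \<noteq> 0 \<longrightarrow> 0 < x \<bullet> (P *v x))"

lemma matrix_inner_transpose: "(A *v x) \<bullet> y = x \<bullet> (transpose A *v (y :: real^'n))"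
  using dot_lmul_matrix[of y A x] by (simp add: inner_commute)

text \<open>The square root of \<open>c P = 1 - A\<close> is \<open>1 - Y\<close>, where
  \<open>Y\<close> is the fixed point for the contraction \<open>A\<close>.\<close>

lemma posdef_square_root:
  fixes P :: "real^'n^'n"
  assumes "posdef P"
  obtains S where "posdef S" "S ** S = P" "\<And>T. T ** P = P ** T \<Longrightarrow> T ** S = S ** T"
proof -
  have sym: "transpose P = P" and pos: "\<And>x. x \<noteq> 0 \<Longrightarrow> 0 < x \<bullet> (P *v x)"
    using assms by (auto simp: posdef_def)
  obtain c q where c: "0 < c" and q: "0 \<le> q" "q < 1"
    and bound: "\<And>x. norm (x - c *\<^sub>R (P *v x)) \<le> q * norm x"
    using linear_contraction_of_posdef[OF pos] by metis
  define A where "A = Blinfun (\<lambda>x. x - c *\<^sub>R (P *v x))"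
  have "bounded_linear (\<lambda>x. x - c *\<^sub>R (P *v x))"
    by (intro bounded_linear_sub bounded_linear_ident bounded_linear_const_scaleR
        matrix_vector_mul_bounded_linear)
  then have A: "A x = x - c *\<^sub>R (P *v x)" for x
    by (simp add: A_def bounded_linear_Blinfun_apply)
  have "norm A \<le> q"
    by (rule norm_blinfun_bound) (use q bound A in auto)
  moreover have "A x \<bullet> y = x \<bullet> A y" for x y
    using matrix_inner_transpose[of P x y] sym by (simp add: A inner_diff_left inner_diff_right)
  ultimately obtain Y where Y: "norm Y \<le> q" "2 *\<^sub>R Y = A + (Y o\<^sub>L Y)"
    "\<And>x y. Y x \<bullet> y = x \<bullet> Y y" "\<And>T. T o\<^sub>L A = A o\<^sub>L T \<Longrightarrow> T o\<^sub>L Y = Y o\<^sub>L T"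
    using contraction_square_root[OF q] by blast
  define S where "S = matrix (\<lambda>x. (1 / sqrt c) *\<^sub>R (x - Y x))"
  have "linear (\<lambda>x. (1 / sqrt c) *\<^sub>R (x - Y x))"
    by (intro linear_compose_scale_right linear_compose_sub linear_id[unfolded id_def]
        bounded_linear.linear[OF blinfun.bounded_linear_right])
  then have S: "S *v x = (1 / sqrt c) *\<^sub>R (x - Y x)" for x
    by (simp add: S_def matrix_works)
  have quad: "2 *\<^sub>R Y x = x - c *\<^sub>R (P *v x) + Y (Y x)" for x
  proof -
    have "(2 *\<^sub>R Y) x = (A + (Y o\<^sub>L Y)) x"
      by (simp only: Y(2))
    then show ?thesis
      by (simp add: blinfun.add_left blinfun.scaleR_left A)
  qed
  show ?thesis
  proof
    have "(S ** S) *v x = P *v x" for x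
    proof -
      have "(S ** S) *v x = (1 / sqrt c) *\<^sub>R (1 / sqrt c) *\<^sub>R (x - 2 *\<^sub>R Y x + Y (Y x))"
        by (simp add: matrix_vector_mul_assoc[symmetric] S blinfun.diff_right blinfun.scaleR_right
            scaleR_diff_right scaleR_add_right scaleR_2 algebra_simps)
      also have "\<dots> = (1 / sqrt c) *\<^sub>R (1 / sqrt c) *\<^sub>R (c *\<^sub>R (P *v x))"
        by (simp only: quad) simp
      finally show ?thesis
        using c by simp
    qed
    then show "S ** S = P"
      by (simp add: matrix_eq)
    have "x \<bullet> (transpose S *v y) = x \<bullet> (S *v y)" for x y
      by (simp only: matrix_inner_transpose[symmetric]) (simp add: S inner_diff_left inner_diff_right Y(3))
    then have "transpose S = S"
      by (metis matrix_eq vector_eq_rdot inner_commute)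
    moreover have "0 < x \<bullet> (S *v x)" if "x \<noteq> 0" for x
    proof -
      have "x \<bullet> Y x \<le> norm x * norm (Y x)"
        by (rule norm_cauchy_schwarz)
      also have "\<dots> \<le> norm x * (q * norm x)"
        by (intro mult_left_mono order_trans[OF norm_blinfun] mult_right_mono Y) auto
      also have "\<dots> < x \<bullet> x"
        using q that by (simp add: dot_square_norm power2_eq_square)
      finally show ?thesis
        using c by (simp add: S inner_diff_right)
    qed
    ultimately show "posdef S"
      by (simp add: posdef_def)
    fix T :: "real^'n^'n" assume T: "T ** P = P ** T"
    define T' where "T' = Blinfun ((*v) T)"
    have T': "T' x = T *v x" for x
      by (simp add: T'_def bounded_linear_Blinfun_apply)
    have "T' o\<^sub>L A = A o\<^sub>L T'"
      by (rule blinfun_eqI)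
        (simp add: T' A matrix_vector_mult_diff_distrib matrix_vector_mult_scaleR matrix_vector_mul_assoc T)
    then have "T' (Y x) = Y (T' x)" for x
      using Y(4) by (metis blinfun_apply_blinfun_compose)
    then have "(T ** S) *v x = (S ** T) *v x" for x
      by (simp add: matrix_vector_mul_assoc[symmetric] S T' matrix_vector_mult_scaleR matrix_vector_mult_diff_distrib)
    then show "T ** S = S ** T"
      by (simp add: matrix_eq)
  qed
qed

text \<open>\<open>U = T S\<close> is an involution. An eigenvector \<open>x\<close> of eigenvalue
  \<open>-1\<close> would satisfy \<open>T (S x) = - x\<close>, hence \<open>(S x) \<bullet> T (S x)
  = - x \<bullet> S x < 0\<close>. So \<open>U = 1\<close>.\<close>

lemma commuting_posdef_inverse:
  fixes S T :: "real^'n^'n"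
  assumes "posdef S" "posdef T" "T ** S = S ** T" "T ** T ** (S ** S) = mat 1"
  shows "T ** S = mat 1"
proof -
  define U where "U = T ** S"
  have "U ** U = T ** (S ** T) ** S"
    by (simp add: U_def matrix_mul_assoc)
  also have "\<dots> = mat 1"
    using assms(4) by (simp add: assms(3)[symmetric] matrix_mul_assoc)
  finally have UU: "U ** U = mat 1" .
  have "x = 0" if "(U + mat 1) *v x = 0" for x
  proof -
    have *: "T *v (S *v x) = - x"
      using that by (simp add: U_def matrix_vector_mult_add_rdistrib matrix_vector_mul_assoc add_eq_0_iff2)
    show ?thesis
    proof (rule ccontr)
      assume "x \<noteq> 0"
      then have "0 < x \<bullet> (S *v x)"
        using assms(1) by (simp add: posdef_def)
      moreover from this have "S *v x \<noteq> 0"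
        by auto
      then have "0 < (S *v x) \<bullet> (T *v (S *v x))"
        using assms(2) by (auto simp: posdef_def)
      ultimately show False
        by (simp add: * inner_commute)
    qed
  qed
  moreover have "(U + mat 1) *v ((U - mat 1) *v x) = 0" for x
    by (simp add: matrix_vector_mul_assoc matrix_ring_simps UU)
  ultimately have "(U - mat 1) *v x = 0" for x
    by blast
  then show ?thesis
    by (simp add: U_def matrix_eq matrix_vector_mult_diff_rdistrib)
qed

text \<open>Conjugating \<open>S\<close> by the symplectic form gives a positive square root of
  \<open>P\<^sup>-\<^sup>1\<close> that commutes with \<open>S\<close>; so it is
  \<open>S\<^sup>-\<^sup>1\<close>, and \<open>S\<close> is symplectic.\<close>

lemma symplectic_square_root:
  fixes P :: "'g::finite bmatrix"
  assumes "posdef P" and P: "P ** symplectic_form ** P = symplectic_form"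
  obtains S where "posdef S" "S ** S = P" "S ** symplectic_form ** S = symplectic_form"
    "\<And>T. T ** P = P ** T \<Longrightarrow> T ** S = S ** T"
proof -
  obtain S where S: "posdef S" "S ** S = P" "\<And>T. T ** P = P ** T \<Longrightarrow> T ** S = S ** T"
    using posdef_square_root[OF assms(1)] by blast
  let ?w = "symplectic_form :: 'g bmatrix"
  note ww = symplectic_form_square symplectic_form_transpose
  have ww': "Q ** ?w ** ?w = - Q" for Q :: "'g bmatrix"
    by (simp add: matrix_mul_assoc[symmetric] ww minus_mult_right')
  define T where "T = - (?w ** S ** ?w)"
  have T: "posdef T"
    unfolding posdef_def
  proof (intro conjI allI impI)
    show "transpose T = T"
      using S(1) by (simp add: T_def posdef_def transpose_simps ww matrix_ring_simps)
    fix x :: "real^('g + 'g)" assume "x \<noteq> 0"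
    have "x = - (?w *v (?w *v x))"
      by (simp add: matrix_vector_mul_assoc ww) (simp add: vec_eq_iff matrix_vector_mult_def sum_negf[symmetric] mat_def if_distrib if_distribR cong: if_cong)
    then have "?w *v x \<noteq> 0"
      using \<open>x \<noteq> 0\<close> by auto
    then have "0 < (?w *v x) \<bullet> (S *v (?w *v x))"
      using S(1) by (simp add: posdef_def)
    also have "\<dots> = x \<bullet> (T *v x)"
      by (simp add: matrix_inner_transpose ww T_def matrix_vector_mul_assoc minus_mult_left' matrix_mul_assoc)
    finally show "0 < x \<bullet> (T *v x)" .
  qed
  have TT: "T ** T = - (?w ** P ** ?w)"
    by (simp add: T_def matrix_ring_simps ww' S(2)[symmetric])
  have "P ** (T ** T) = mat 1" "T ** T ** P = mat 1"
    using P by (simp_all add: TT matrix_ring_simps ww) (metis matrix_mul_assoc minus_minus ww(1) minus_mult_right')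
  then have "T ** P = (P ** (T ** T)) ** T ** P" "P ** T = P ** T ** (T ** T ** P)"
    by simp_all
  then have "T ** P = P ** T"
    by (simp add: matrix_mul_assoc)
  then have "T ** S = S ** T"
    by (rule S(3))
  moreover have "T ** T ** (S ** S) = mat 1"
    using \<open>T ** T ** P = mat 1\<close> S(2) by simp
  ultimately have "T ** S = mat 1"
    using commuting_posdef_inverse[OF S(1) T] by blast
  moreover have "S ** ?w ** S = ?w ** (T ** S)"
    by (simp add: T_def matrix_ring_simps ww)
  ultimately have "S ** ?w ** S = ?w"
    by simp
  then show ?thesis
    using that S by blast
qed

section \<open>The unitary domain as a fixed point set\<close>

lemma sig_matrix_transpose [simp]: "transpose (sig_matrix r) = (sig_matrix r :: 'g::{finite,linorder} rmatrix)"
  by (simp add: matrix_eq_iff transpose_def sig_matrix_def)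

lemma sig_matrix_square [simp]: "sig_matrix r ** sig_matrix r = (mat 1 :: 'g::{finite,linorder} rmatrix)"
proof -
  have "(\<Sum>k\<in>UNIV. sig_matrix r $ i $ k * sig_matrix r $ k $ j) = (if i = j then 1 else 0 :: real)" for i j :: 'g
  proof -
    have "(\<Sum>k\<in>UNIV. sig_matrix r $ i $ k * sig_matrix r $ k $ j) =
      (\<Sum>k\<in>UNIV. if k = i then (if i = j then 1 else 0 :: real) else 0)"
      by (rule sum.cong) (auto simp: sig_matrix_def)
    then show ?thesis
      by simp
  qed
  then show ?thesis
    by (simp add: matrix_eq_iff matrix_matrix_mult_def mat_def)
qed

lemma sig_matrix_square' [simp]: "Q ** sig_matrix r ** sig_matrix r = (Q :: 'g::{finite,linorder} rmatrix)"
  by (simp add: matrix_mul_assoc[symmetric])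

lemma cmat_sig_square [simp]:
  "cmat (sig_matrix r) ** cmat (sig_matrix r) = (mat 1 :: 'g::{finite,linorder} cmatrix)"
  "Q ** cmat (sig_matrix r) ** cmat (sig_matrix r) = (Q :: 'g::{finite,linorder} cmatrix)"
  by (simp_all add: cmat_mult[symmetric] cmat_mat matrix_mul_assoc[symmetric])

text \<open>The image under \<open>\<alpha>\<close> of multiplication by \<open>\<surd>(-\<Delta>)\<close>.\<close>

definition cm_matrix :: "nat \<Rightarrow> nat \<Rightarrow> 'g::{finite,linorder} bmatrix" where
  "cm_matrix \<Delta> r = block_matrix 0 (sig_matrix r) (sm (- real \<Delta>) (sig_matrix r)) 0"

lemma cm_matrix_square: "cm_matrix \<Delta> r ** cm_matrix \<Delta> r = mat (- real \<Delta>)"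
  unfolding cm_matrix_def block_simps mat_block[of "- real \<Delta>"]
  by (simp add: matrix_ring_simps sm_mat)

lemma cm_matrix_similitude: "similitude (real \<Delta>) (cm_matrix \<Delta> r)"
  unfolding similitude_iff_mult_sadj cm_matrix_def sadj_block block_simps mat_block[of "real \<Delta>"]
  by (simp add: matrix_ring_simps sm_mat transpose_simps sm_minus_left)

lemma fixset_cm_matrix:
  assumes "0 < \<Delta>"
  shows "\<tau> \<in> fixset (cm_matrix \<Delta> r) \<longleftrightarrow> \<tau> \<in> siegel_space \<and>
     \<tau> ** cmat (sig_matrix r) ** \<tau> = sm (- 1 / of_nat \<Delta>) (cmat (sig_matrix r))"
proof -
  let ?E = "cmat (sig_matrix r) :: 'a cmatrix"
  have "?E = \<tau> ** (sm (- of_nat \<Delta>) ?E ** \<tau>) \<longleftrightarrow> sm (- 1 / of_nat \<Delta>) ?E = \<tau> ** ?E ** \<tau>"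
  proof -
    have "?E = \<tau> ** (sm (- of_nat \<Delta>) ?E ** \<tau>) \<longleftrightarrow>
      sm (- 1 / of_nat \<Delta>) ?E = sm (- 1 / of_nat \<Delta>) (\<tau> ** (sm (- of_nat \<Delta>) ?E ** \<tau>))"
      using assms by (subst sm_cancel) auto
    also have "sm (- 1 / of_nat \<Delta>) (\<tau> ** (sm (- of_nat \<Delta>) ?E ** \<tau>)) = \<tau> ** ?E ** \<tau>"
      using assms by (simp add: sm_mult_left sm_mult_right sm_sm matrix_mul_assoc)
    finally show ?thesis .
  qed
  then show ?thesis
    by (auto simp: fixset_iff_equation cm_matrix_def automorphy_def cmat_sm)
qed

lemma alpha_embedding_block: "alpha_embedding \<Delta> r (h, k) =
  block_matrix h (k ** sig_matrix r) (sm (- real \<Delta>) (sig_matrix r ** k)) (sig_matrix r ** h ** sig_matrix r)"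
  by (simp add: alpha_embedding_def mat_mult_eq_sm sm_mult_left)

lemma sqrt_neg_cnj: "cnj (sqrt_neg \<Delta>) = - sqrt_neg \<Delta>"
  and sqrt_neg_square: "sqrt_neg \<Delta> * sqrt_neg \<Delta> = - of_nat \<Delta>"
proof -
  show "cnj (sqrt_neg \<Delta>) = - sqrt_neg \<Delta>"
    by (simp add: sqrt_neg_def)
  show "sqrt_neg \<Delta> * sqrt_neg \<Delta> = - of_nat \<Delta>"
    by (simp add: sqrt_neg_def complex_eq_iff)
qed

text \<open>The real and the imaginary part of the unitary relation are the blocks of the symplectic
  relation for \<open>\<alpha>(h, k)\<close>.\<close>

lemma GU_pos_iff:
  fixes h k :: "'g::{finite,linorder} rmatrix"
  assumes "0 < \<Delta>"
  shows "(h, k) \<in> GU_pos \<Delta> r \<longleftrightarrow> (\<exists>l>0. similitude l (alpha_embedding \<Delta> r (h, k)))"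
proof -
  let ?E = "sig_matrix r :: 'g rmatrix" and ?s = "sqrt_neg \<Delta>"
  let ?R = "h ** ?E ** transpose h + sm (real \<Delta>) (k ** ?E ** transpose k)"
  let ?I = "k ** ?E ** transpose h - h ** ?E ** transpose k"
  have conj: "transpose (map_matrix cnj (cmat h + mat ?s ** cmat k)) =
     cmat (transpose h) - sm ?s (cmat (transpose k))"
    by (simp add: matrix_eq_iff transpose_def mat_mult_eq_sm sqrt_neg_cnj)
  have prod: "(cmat h + mat ?s ** cmat k) ** cmat ?E **
      transpose (map_matrix cnj (cmat h + mat ?s ** cmat k)) = cmat ?R + sm ?s (cmat ?I)"
    unfolding conj by (simp add: matrix_ring_simps cmat_simps sqrt_neg_square sm_minus_left)
  have eq: "(cmat h + mat ?s ** cmat k) ** cmat ?E **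
        transpose (map_matrix cnj (cmat h + mat ?s ** cmat k)) = mat (of_real l) ** cmat ?E \<longleftrightarrow>
      ?R = sm l ?E \<and> ?I = 0" for l
  proof -
    have "of_real a + ?s * of_real b = (of_real c :: complex) \<longleftrightarrow> a = c \<and> b = 0" for a b c
      using assms by (auto simp: complex_eq_iff sqrt_neg_def)
    then have "cmat ?R + sm ?s (cmat ?I) = cmat (sm l ?E) \<longleftrightarrow> ?R = sm l ?E \<and> ?I = 0"
      by (simp only: matrix_eq_iff vector_add_component sm_nth nth_map_matrix zero_index) blast
    then show ?thesis
      unfolding prod unfolding mat_mult_eq_sm cmat_sm .
  qed
  have "similitude l (alpha_embedding \<Delta> r (h, k)) \<longleftrightarrow> ?R = sm l ?E \<and> ?I = 0" for l
  proof -
    have E: "A = sm l ?E \<longleftrightarrow> A ** ?E = mat l" for A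
      by (metis sig_matrix_square sig_matrix_square' mult_mat_eq_sm mat_mult_eq_sm sm_mult_left)
    have E': "A = 0 \<longleftrightarrow> A ** ?E = 0" for A :: "'g rmatrix"
      by (metis sig_matrix_square' times0_left)
    have eqs: "alpha_embedding \<Delta> r (h, k) ** sadj (alpha_embedding \<Delta> r (h, k)) =
       block_matrix (?R ** ?E) ?I (sm (real \<Delta>) (- ?E ** ?I ** ?E)) (?E ** ?R)"
      unfolding alpha_embedding_block sadj_block block_simps
      by (simp add: transpose_simps matrix_ring_simps sm_minus_left)
    have "similitude l (alpha_embedding \<Delta> r (h, k)) \<longleftrightarrow>
      ?R ** ?E = mat l \<and> ?I = 0 \<and> ?E ** ?R = mat l \<and> sm (real \<Delta>) (- ?E ** ?I ** ?E) = 0"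
      unfolding similitude_iff_mult_sadj eqs mat_block[of l] block_matrix_eq_iff by blast
    moreover have "?E ** ?R = mat l" if "?R = sm l ?E"
      unfolding that by (simp add: sm_mult_right sm_mat)
    ultimately show ?thesis
      unfolding E by (auto simp: minus_mult_left')
  qed
  then show ?thesis
    unfolding GU_pos_def mem_Collect_eq prod.case eq by simp
qed

lemma alpha_embedding_commutes:
  "alpha_embedding \<Delta> r (h, k) ** cm_matrix \<Delta> r = cm_matrix \<Delta> r ** alpha_embedding \<Delta> r (h, k)"
  unfolding alpha_embedding_block cm_matrix_def block_simps
  by (simp add: matrix_ring_simps sm_minus_left)

lemma posdef_invertible:
  assumes "posdef P"
  shows "invertible P"
proof -
  have "x = 0" if "P *v x = 0" for x
    using assms that by (force simp: posdef_def)
  then show ?thesis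
    by (metis invertible_left_inverse matrix_left_invertible_ker)
qed

lemma posdef_inverse:
  fixes P :: "real^'n^'n"
  assumes "posdef P"
  shows "posdef (matrix_inv P)"
  unfolding posdef_def
proof (intro conjI allI impI)
  note inv = matrix_inv_left[OF posdef_invertible[OF assms]] matrix_inv_right[OF posdef_invertible[OF assms]]
  have sym: "transpose P = P"
    using assms by (simp add: posdef_def)
  have "transpose (matrix_inv P) ** P = mat 1"
    using arg_cong[OF inv(2), of transpose] by (simp add: matrix_transpose_mul sym)
  then have "transpose (matrix_inv P) ** P ** matrix_inv P = matrix_inv P"
    by simp
  then show "transpose (matrix_inv P) = matrix_inv P"
    by (simp add: matrix_mul_assoc[symmetric] inv)
  fix x :: "real^'n" assume "x \<noteq> 0"
  have x: "P *v (matrix_inv P *v x) = x"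
    by (simp add: matrix_vector_mul_assoc inv)
  then have "matrix_inv P *v x \<noteq> 0"
    using \<open>x \<noteq> 0\<close> by auto
  then have "0 < (matrix_inv P *v x) \<bullet> (P *v (matrix_inv P *v x))"
    using assms by (simp add: posdef_def)
  then show "0 < x \<bullet> (matrix_inv P *v x)"
    by (simp add: x inner_commute)
qed

text \<open>For \<open>\<tau> = X + \<i> Y\<close> this is the Gram matrix of the Hermitian metric that \<open>\<tau>\<close> induces on the
  real column vectors of length \<open>2g\<close>. It is symplectic, and the columns of \<open>frame \<tau>\<close> span an
  eigenspace of its product with the symplectic form, so it determines \<open>\<tau>\<close>.\<close>

definition siegel_gram :: "'g::finite cmatrix \<Rightarrow> 'g bmatrix" where
  "siegel_gram \<tau> = (let X = map_matrix Re \<tau>; Y = map_matrix Im \<tau>; Z = matrix_inv Y in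
     block_matrix (Y + X ** Z ** X) (X ** Z) (Z ** X) Z)"

lemma siegel_real_imag:
  fixes \<tau> :: "'g::finite cmatrix"
  assumes "\<tau> \<in> siegel_space"
  obtains X Y Z where "X = map_matrix Re \<tau>" "Y = map_matrix Im \<tau>" "Z = matrix_inv Y"
    "transpose X = X" "transpose Y = Y" "transpose Z = Z" "posdef Y" "posdef Z"
    "Y ** Z = mat 1" "Z ** Y = mat 1" "\<And>Q :: 'g rmatrix. Q ** Y ** Z = Q" "\<And>Q :: 'g rmatrix. Q ** Z ** Y = Q"
    "\<tau> = cmat X + sm \<i> (cmat Y)"
    "siegel_gram \<tau> = block_matrix (Y + X ** Z ** X) (X ** Z) (Z ** X) Z"
proof -
  let ?X = "map_matrix Re \<tau>" and ?Y = "map_matrix Im \<tau>"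
  let ?Z = "matrix_inv ?Y"
  have sym: "transpose \<tau> = \<tau>"
    using assms by (rule siegel_spaceD)
  have X: "transpose ?X = ?X" and Y: "transpose ?Y = ?Y"
    using sym by (simp_all add: matrix_eq_iff transpose_def)
  have pY: "posdef ?Y"
    using assms Y by (simp add: posdef_def siegel_space_def)
  have pZ: "posdef ?Z"
    by (rule posdef_inverse[OF pY])
  have inv: "?Y ** ?Z = mat 1" "?Z ** ?Y = mat 1"
    using matrix_inv_left matrix_inv_right posdef_invertible[OF pY] by auto
  show ?thesis
  proof (rule that[OF refl refl refl])
    show "transpose ?Z = ?Z"
      using pZ by (simp add: posdef_def)
    show "\<tau> = cmat ?X + sm \<i> (cmat ?Y)"
      by (simp add: matrix_eq_iff complex_eq[symmetric])
  qed (use X Y pY pZ inv in \<open>simp_all add: matrix_mul_assoc[symmetric] siegel_gram_def Let_def\<close>)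
qed

lemma siegel_gram_posdef:
  assumes "\<tau> \<in> siegel_space"
  shows "posdef (siegel_gram \<tau>)"
proof -
  obtain X Y Z where *: "transpose X = X" "transpose Y = Y" "transpose Z = Z" "posdef Y" "posdef Z"
    and P: "siegel_gram \<tau> = block_matrix (Y + X ** Z ** X) (X ** Z) (Z ** X) Z"
    using siegel_real_imag[OF assms] by metis
  show ?thesis
    unfolding posdef_def
  proof (intro conjI allI impI)
    show "transpose (siegel_gram \<tau>) = siegel_gram \<tau>"
      by (simp add: P block_simps transpose_simps * matrix_mul_assoc)
    fix z :: "real^('a + 'a)" assume "z \<noteq> 0"
    define a where "a = (\<chi> i. z $ Inl i)"
    define b where "b = (\<chi> i. z $ Inr i)"
    have z: "a \<noteq> 0 \<or> b \<noteq> 0"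
      using \<open>z \<noteq> 0\<close> by (auto simp: a_def b_def vec_eq_iff all_plus_type)
    have split: "z \<bullet> w = a \<bullet> (\<chi> i. w $ Inl i) + b \<bullet> (\<chi> i. w $ Inr i)" for w
      by (simp add: inner_vec_def sum_plus_type a_def b_def)
    have block: "(\<chi> i. (block_matrix A B C D *v z) $ Inl i) = A *v a + B *v b"
      "(\<chi> i. (block_matrix A B C D *v z) $ Inr i) = C *v a + D *v b" for A B C D :: "real^'a^'a"
      by (simp_all add: vec_eq_iff matrix_vector_mult_def sum_plus_type a_def b_def)
    have "z \<bullet> (siegel_gram \<tau> *v z) =
       a \<bullet> (Y *v a) + (a \<bullet> (X *v (Z *v (X *v a))) + a \<bullet> (X *v (Z *v b)) + b \<bullet> (Z *v (X *v a)) + b \<bullet> (Z *v b))"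
      by (simp add: split P block matrix_vector_mult_add_rdistrib inner_add_right matrix_vector_mul_assoc matrix_mul_assoc)
    also have "\<dots> = a \<bullet> (Y *v a) + (X *v a + b) \<bullet> (Z *v (X *v a + b))"
      by (simp add: inner_add_left inner_add_right matrix_vector_right_distrib matrix_inner_transpose *)
    also have "\<dots> > 0"
    proof (cases "a = 0")
      case True
      then show ?thesis
        using z *(5) by (simp add: posdef_def)
    next
      case False
      have "0 \<le> (X *v a + b) \<bullet> (Z *v (X *v a + b))"
        using *(5) by (cases "X *v a + b = 0") (auto simp: posdef_def intro: less_imp_le)
      moreover have "0 < a \<bullet> (Y *v a)"
        using False *(4) by (simp add: posdef_def)
      ultimately show ?thesis by simp
    qed
    finally show "0 < z \<bullet> (siegel_gram \<tau> *v z)" .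
  qed
qed

lemma siegel_gram_symplectic:
  fixes \<tau> :: "'g::finite cmatrix"
  assumes "\<tau> \<in> siegel_space"
  shows "siegel_gram \<tau> ** symplectic_form ** siegel_gram \<tau> = symplectic_form"
proof -
  obtain X Y Z where inv: "Y ** Z = mat 1" "Z ** Y = mat 1" "\<And>Q :: 'g rmatrix. Q ** Y ** Z = Q" "\<And>Q :: 'g rmatrix. Q ** Z ** Y = Q"
    and P: "siegel_gram \<tau> = block_matrix (Y + X ** Z ** X) (X ** Z) (Z ** X) Z"
    using siegel_real_imag[OF assms] by metis
  show ?thesis
    unfolding P symplectic_form_def block_simps
    by (simp add: matrix_ring_simps inv)
qed

lemma siegel_gram_eigenspace:
  fixes \<tau> :: "'g::finite cmatrix" and G :: "complex^'g^('g + 'g)"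
  assumes "\<tau> \<in> siegel_space"
  shows "cmat (siegel_gram \<tau> ** symplectic_form) ** G = sm (- \<i>) G \<longleftrightarrow> (\<exists>Q. G = frame \<tau> ** Q)"
proof -
  obtain X Y Z where inv: "Y ** Z = mat 1" "Z ** Y = mat 1" "\<And>Q :: 'g rmatrix. Q ** Y ** Z = Q" "\<And>Q :: 'g rmatrix. Q ** Z ** Y = Q"
    and P: "siegel_gram \<tau> = block_matrix (Y + X ** Z ** X) (X ** Z) (Z ** X) Z"
    and \<tau>: "\<tau> = cmat X + sm \<i> (cmat Y)"
    using siegel_real_imag[OF assms] by metis
  have cinv: "cmat Y ** cmat Z = mat 1" "cmat Z ** cmat Y = mat 1"
    "\<And>Q :: 'g cmatrix. Q ** cmat Y ** cmat Z = Q" "\<And>Q :: 'g cmatrix. Q ** cmat Z ** cmat Y = Q"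
    using inv by (simp_all add: cmat_mult[symmetric] cmat_mat matrix_mul_assoc[symmetric])
  have i_sq: "sm (- \<i>) (sm \<i> A) = A" "sm \<i> (sm \<i> A) = - A" for A :: "'g cmatrix"
    by (simp_all add: matrix_eq_iff)
  obtain U V where G: "G = stack U V"
    by (rule stack_cases)
  have lhs: "cmat (siegel_gram \<tau> ** symplectic_form) ** G =
    stack (- (cmat X ** cmat Z ** U) + (cmat Y + cmat X ** cmat Z ** cmat X) ** V)
      (- (cmat Z ** U) + cmat Z ** cmat X ** V)"
    by (simp add: P G symplectic_form_def block_simps block_matrix_stack cmat_simps matrix_ring_simps)
  show ?thesis
  proof
    assume "cmat (siegel_gram \<tau> ** symplectic_form) ** G = sm (- \<i>) G"
    then have "- (cmat Z ** U) + cmat Z ** cmat X ** V = sm (- \<i>) V"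
      unfolding lhs unfolding G sm_stack stack_eq_iff by simp
    then have "cmat Y ** (- (cmat Z ** U) + cmat Z ** cmat X ** V) = cmat Y ** sm (- \<i>) V"
      by simp
    then have "cmat X ** V - U = - sm \<i> (cmat Y ** V)"
      by (simp add: matrix_ring_simps cinv sm_minus_left)
    moreover have "U = cmat X ** V - (cmat X ** V - U)"
      by simp
    ultimately have "U = cmat X ** V + sm \<i> (cmat Y ** V)"
      by (metis diff_minus_eq_add)
    then have "G = frame \<tau> ** V"
      by (simp add: G frame_mult \<tau> stack_eq_iff matrix_ring_simps)
    then show "\<exists>Q. G = frame \<tau> ** Q" ..
  next
    assume "\<exists>Q. G = frame \<tau> ** Q"
    then obtain Q where "G = frame \<tau> ** Q" ..
    then have U: "U = cmat X ** V + sm \<i> (cmat Y ** V)"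
      by (auto simp: G frame_mult \<tau> stack_eq_iff matrix_ring_simps)
    show "cmat (siegel_gram \<tau> ** symplectic_form) ** G = sm (- \<i>) G"
      unfolding lhs unfolding G sm_stack stack_eq_iff U
      by (simp add: matrix_ring_simps cinv i_sq sm_minus_left)
  qed
qed

text \<open>A symmetric symplectic square root of the Gram matrix of \<open>\<tau>\<close> moves \<open>\<i>\<close> to \<open>\<tau>\<close>; as a square
  root it commutes with every matrix that commutes with the Gram matrix.\<close>

lemma siegel_transitive:
  assumes "\<tau> \<in> siegel_space"
  obtains S Q where "similitude 1 S" "cmat S ** frame (mat \<i>) = frame \<tau> ** Q"
    "\<And>T. T ** siegel_gram \<tau> = siegel_gram \<tau> ** T \<Longrightarrow> T ** S = S ** T"
proof -
  let ?w = "symplectic_form :: 'a bmatrix"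
  obtain S where S: "posdef S" "S ** S = siegel_gram \<tau>" "S ** ?w ** S = ?w"
    "\<And>T. T ** siegel_gram \<tau> = siegel_gram \<tau> ** T \<Longrightarrow> T ** S = S ** T"
    using symplectic_square_root[OF siegel_gram_posdef[OF assms] siegel_gram_symplectic[OF assms]]
    by metis
  have sim: "similitude 1 S"
    using S(1,3) by (simp add: similitude_def posdef_def)
  have wF: "cmat ?w ** frame (mat \<i>) = sm (- \<i>) (frame (mat \<i>) :: complex^'a^('a+'a))"
    by (simp add: symplectic_form_def cmat_block_matrix frame_def block_matrix_stack sm_stack
        stack_eq_iff cmat_simps sm_mat minus_mult_left') (simp add: matrix_eq_iff mat_def)
  have "cmat (siegel_gram \<tau> ** ?w) ** (cmat S ** frame (mat \<i>)) = cmat (S ** (S ** ?w ** S)) ** frame (mat \<i>)"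
    by (simp add: S(2)[symmetric] cmat_mult matrix_mul_assoc)
  also have "\<dots> = cmat S ** (cmat ?w ** frame (mat \<i>))"
    unfolding S(3) by (simp add: cmat_mult matrix_mul_assoc)
  also have "\<dots> = sm (- \<i>) (cmat S ** frame (mat \<i>))"
    by (simp add: wF sm_mult_right)
  finally obtain Q where "cmat S ** frame (mat \<i>) = frame \<tau> ** Q"
    using siegel_gram_eigenspace[OF assms] by auto
  then show ?thesis
    using that sim S(4) by blast
qed

text \<open>The real and imaginary parts of \<open>\<tau> E \<tau> = - E\<close> are \<open>X E X -
  Y E Y = - E\<close> and \<open>X E Y + Y E X = 0\<close>. Multiplied by
  \<open>Y\<^sup>-\<^sup>1\<close> they become the four blocks of the commutation relation.\<close>

lemma siegel_gram_commutes:
  fixes \<tau> :: "'g::{finite,linorder} cmatrix"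
  assumes "\<tau> \<in> siegel_space" "\<tau> ** cmat (sig_matrix r) ** \<tau> = - cmat (sig_matrix r)"
  defines "K \<equiv> block_matrix 0 (sig_matrix r) (- sig_matrix r) 0"
  shows "K ** siegel_gram \<tau> = siegel_gram \<tau> ** K"
proof -
  let ?E = "sig_matrix r :: 'g rmatrix"
  obtain X Y Z where inv: "Y ** Z = mat 1" "Z ** Y = mat 1" "\<And>Q :: 'g rmatrix. Q ** Y ** Z = Q" "\<And>Q :: 'g rmatrix. Q ** Z ** Y = Q"
    and sym: "transpose X = X" "transpose Y = Y" "transpose Z = Z"
    and P: "siegel_gram \<tau> = block_matrix (Y + X ** Z ** X) (X ** Z) (Z ** X) Z"
    and \<tau>: "\<tau> = cmat X + sm \<i> (cmat Y)"
    using siegel_real_imag[OF assms(1)] by metis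
  have i_sq: "sm \<i> (sm \<i> A) = - A" for A :: "'g cmatrix"
    by (simp_all add: matrix_eq_iff)
  have "\<tau> ** cmat ?E ** \<tau> = cmat (X ** ?E ** X - Y ** ?E ** Y) + sm \<i> (cmat (X ** ?E ** Y + Y ** ?E ** X))"
    by (simp add: \<tau> matrix_ring_simps cmat_simps sm_minus_left)
  then have "cmat (X ** ?E ** X - Y ** ?E ** Y) + sm \<i> (cmat (X ** ?E ** Y + Y ** ?E ** X)) = - cmat ?E"
    using assms(2) by simp
  then have re: "X ** ?E ** X - Y ** ?E ** Y = - ?E" and im: "X ** ?E ** Y + Y ** ?E ** X = 0"
    by (simp_all add: matrix_eq_iff complex_eq_iff)
  have "Z ** (X ** ?E ** Y + Y ** ?E ** X) ** Z = 0"
    by (simp add: im)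
  then have 4: "Z ** X ** ?E = - (?E ** X ** Z)"
    by (simp add: matrix_ring_simps inv add_eq_0_iff2)
  have "?E ** (Z ** X ** ?E) ** ?E = ?E ** (- (?E ** X ** Z)) ** ?E"
    by (simp add: 4)
  then have 1: "?E ** Z ** X = - (X ** Z ** ?E)"
    by (simp add: matrix_ring_simps)
  have "(Y + X ** Z ** X) ** ?E = Y ** ?E + X ** (Z ** X ** ?E)"
    by (simp add: matrix_ring_simps)
  also have "\<dots> = - (X ** ?E ** X - Y ** ?E ** Y) ** Z"
    by (simp add: 4 matrix_ring_simps inv)
  also have "\<dots> = ?E ** Z"
    by (simp add: re)
  finally have 2: "(Y + X ** Z ** X) ** ?E = ?E ** Z" .
  have 3: "?E ** (Y + X ** Z ** X) = Z ** ?E"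
    using arg_cong[OF 2, of transpose] by (simp add: transpose_simps sym matrix_mul_assoc)
  show ?thesis
    unfolding K_def P block_simps
    using 1 2 3 4 by (simp add: minus_mult_left' minus_mult_right' matrix_mul_assoc)
qed

lemma base_point_in: "0 < \<Delta> \<Longrightarrow> base_point \<Delta> \<in> siegel_space"
proof -
  assume "0 < \<Delta>"
  have "map_matrix Im (base_point \<Delta> :: 'a cmatrix) *v x = (1 / sqrt (real \<Delta>)) *\<^sub>R x" for x
    by (simp add: vec_eq_iff matrix_vector_mult_def base_point_def mat_def if_distrib if_distribR cong: if_cong)
  then show ?thesis
    using \<open>0 < \<Delta>\<close> by (simp add: siegel_space_def) (simp add: base_point_def)
qed

lemma base_point_fixed: "0 < \<Delta> \<Longrightarrow> base_point \<Delta> \<in> fixset (cm_matrix \<Delta> r)"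
proof -
  assume "0 < \<Delta>"
  have "\<i> / of_real (sqrt (real \<Delta>)) * (\<i> / of_real (sqrt (real \<Delta>))) = - 1 / (of_real (sqrt (real \<Delta>) * sqrt (real \<Delta>)) :: complex)"
    by (simp del: real_sqrt_mult_self)
  then have "\<i> / of_real (sqrt (real \<Delta>)) * (\<i> / of_real (sqrt (real \<Delta>))) = (- 1 / of_nat \<Delta> :: complex)"
    by simp
  then show ?thesis
    unfolding fixset_cm_matrix[OF \<open>0 < \<Delta>\<close>]
    using base_point_in[OF \<open>0 < \<Delta>\<close>]
    by (simp add: base_point_def mat_mult_eq_sm mult_mat_eq_sm sm_mult_left sm_sm)
qed

text \<open>The orbit that defines the unitary domain is a closed set given by the equation
  \<open>\<tau> E \<tau> = - E / \<Delta>\<close>. One inclusion holds because \<open>\<alpha>(h,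
  k)\<close> commutes with \<open>\<alpha>(\<surd>(-\<Delta>))\<close>. For the other one, the
  square root of the Gram matrix moves \<open>\<i>\<close> to \<open>\<surd>\<Delta> \<tau>\<close>
  and commutes with \<open>\<alpha>(\<surd>(-\<Delta>))\<close>, hence comes from the unitary group
  after the base point is rescaled.\<close>

theorem unitary_domain_eq_fixset:
  fixes \<Delta> r :: nat
  assumes "0 < \<Delta>"
  shows "unitary_domain \<Delta> r = (fixset (cm_matrix \<Delta> r) :: 'g::{finite,linorder} cmatrix set)"
proof
  have \<Delta>: "real \<Delta> \<noteq> 0" "0 < sqrt (real \<Delta>)"
    using assms by auto
  show "unitary_domain \<Delta> r \<subseteq> (fixset (cm_matrix \<Delta> r) :: 'g cmatrix set)"
  proof
    fix \<tau> :: "'g cmatrix" assume "\<tau> \<in> unitary_domain \<Delta> r"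
    then obtain h k where hk: "(h, k) \<in> GU_pos \<Delta> r" and \<tau>: "\<tau> = siegel_action (alpha_embedding \<Delta> r (h, k)) (base_point \<Delta>)"
      by (auto simp: unitary_domain_def)
    obtain l where l: "0 < l" "similitude l (alpha_embedding \<Delta> r (h, k))"
      using hk unfolding GU_pos_iff[OF assms] by blast
    let ?M = "alpha_embedding \<Delta> r (h, k)"
    have "\<tau> \<in> fixset (?M ** cm_matrix \<Delta> r ** sadj ?M)"
      unfolding \<tau> using fixset_conj_sub[OF l(2,1) base_point_fixed[OF assms]] .
    moreover have "?M ** cm_matrix \<Delta> r ** sadj ?M = sm l (cm_matrix \<Delta> r)"
      using l(2) by (simp add: alpha_embedding_commutes matrix_mul_assoc[symmetric]
          similitude_iff_mult_sadj mult_mat_eq_sm)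
    ultimately show "\<tau> \<in> fixset (cm_matrix \<Delta> r)"
      using l by (simp add: fixset_sm)
  qed
  show "(fixset (cm_matrix \<Delta> r) :: 'g cmatrix set) \<subseteq> unitary_domain \<Delta> r"
  proof
    fix \<tau> :: "'g cmatrix" assume \<tau>: "\<tau> \<in> fixset (cm_matrix \<Delta> r)"
    let ?E = "sig_matrix r :: 'g rmatrix" and ?d = "sqrt (real \<Delta>)"
    let ?\<sigma> = "sm (of_real ?d) \<tau>"
    have H: "\<tau> \<in> siegel_space" and fix_eq: "\<tau> ** cmat ?E ** \<tau> = sm (- 1 / of_nat \<Delta>) (cmat ?E)"
      using \<tau> fixset_cm_matrix[OF assms] by blast+
    have im: "im_form ?\<sigma> w = ?d * im_form \<tau> w" for w
      by (simp add: im_form_def sm_vector inner_vec_def inner_complex_def sum_distrib_left algebra_simps)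
    have \<sigma>: "?\<sigma> \<in> siegel_space"
      using H \<Delta> by (simp add: siegel_space_iff im transpose_sm)
    have dd: "of_real ?d * of_real ?d = (of_nat \<Delta> :: complex)"
      using of_real_mult[of ?d ?d, where 'a = complex] by simp
    have "?\<sigma> ** cmat ?E ** ?\<sigma> = - cmat ?E"
      using assms by (simp add: sm_mult_left sm_mult_right sm_sm dd fix_eq) (simp add: sm_minus_left)
    then have comm: "block_matrix 0 ?E (- ?E) 0 ** siegel_gram ?\<sigma> = siegel_gram ?\<sigma> ** block_matrix 0 ?E (- ?E) 0"
      by (rule siegel_gram_commutes[OF \<sigma>])
    obtain S Q where S: "similitude 1 S" "cmat S ** frame (mat \<i>) = frame ?\<sigma> ** Q"
      and SK: "block_matrix 0 ?E (- ?E) 0 ** S = S ** block_matrix 0 ?E (- ?E) 0"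
      using siegel_transitive[OF \<sigma>] comm by metis
    obtain A B C D where S_block: "S = block_matrix A B C D"
      by (rule block_matrix_cases)
    have "?E ** C = - (B ** ?E)" "?E ** D = A ** ?E"
      using SK by (simp_all add: S_block block_simps minus_mult_left' minus_mult_right')
    then have CD: "C = - (?E ** B ** ?E)" "D = ?E ** A ** ?E"
      by (metis matrix_mul_assoc minus_mult_right' sig_matrix_square matrix_mul_lid)+
    define h where "h = A"
    define k where "k = sm (1 / ?d) (B ** ?E)"
    let ?M = "alpha_embedding \<Delta> r (h, k)"
    have d: "?d * ?d = real \<Delta>"
      by simp
    have M: "?M = block_matrix A (sm (1 / ?d) B) (sm ?d C) D"
      using \<Delta> d by (simp add: alpha_embedding_block block_matrix_eq_iff h_def k_def CD sm_mult_left
          sm_mult_right sm_sm matrix_mul_assoc sm_minus sm_minus_left) (simp add: real_div_sqrt)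
    have "similitude 1 ?M"
    proof -
      have "A ** transpose D + B ** (- transpose C) = mat 1" "A ** (- transpose B) + B ** transpose A = 0"
        "C ** transpose D + D ** (- transpose C) = 0" "C ** (- transpose B) + D ** transpose A = mat 1"
        using S(1) by (simp_all add: similitude_iff_mult_sadj S_block sadj_block block_simps mat_block[of 1])
      then have eqs: "A ** transpose D = mat 1 + B ** transpose C" "A ** transpose B = B ** transpose A"
        "C ** transpose D = D ** transpose C" "D ** transpose A = mat 1 + C ** transpose B"
        by (simp_all add: minus_mult_right' algebra_simps)
      show ?thesis
        unfolding similitude_iff_mult_sadj M sadj_block block_simps mat_block[of 1]
        using \<Delta> by (simp add: transpose_sm sm_mult_left sm_mult_right sm_sm minus_mult_right' sm_minus eqs)
    qed
    then have "(h, k) \<in> GU_pos \<Delta> r"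
      using GU_pos_iff[OF assms] zero_less_one by blast
    moreover have "siegel_action ?M (base_point \<Delta>) = \<tau>"
    proof (rule siegel_action_eqI[OF \<open>similitude 1 ?M\<close> _ base_point_in[OF assms]])
      have "cmat A ** mat \<i> + cmat B = ?\<sigma> ** Q" "cmat C ** mat \<i> + cmat D = Q"
        using S(2) by (simp_all add: S_block cmat_block_matrix frame_def block_matrix_stack stack_mult stack_eq_iff)
      moreover have "cmat A ** base_point \<Delta> + cmat (sm (1 / ?d) B) = sm (1 / of_real ?d) (cmat A ** mat \<i> + cmat B)"
        "cmat (sm ?d C) ** base_point \<Delta> = cmat C ** mat \<i>"
        using \<Delta> by (simp_all add: base_point_def mult_mat_eq_sm cmat_sm sm_sm sm_add)
      ultimately show "cmat ?M ** frame (base_point \<Delta>) = frame \<tau> ** Q"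
        using \<Delta> by (simp add: M cmat_block_matrix frame_def block_matrix_stack stack_mult stack_eq_iff sm_mult_left sm_sm)
    qed simp
    ultimately show "\<tau> \<in> unitary_domain \<Delta> r"
      by (force simp: unitary_domain_def)
  qed
qed

section \<open>Proper discontinuity\<close>

definition integral_similitudes :: "real \<Rightarrow> 'g::finite bmatrix set" where
  "integral_similitudes k = {M. (\<forall>i j. M $ i $ j \<in> \<int>) \<and> similitude k M}"

lemma finite_bounded_integral_matrices:
  "finite {M :: real^'n^'m. \<forall>i j. M $ i $ j \<in> \<int> \<and> \<bar>M $ i $ j\<bar> \<le> K}"
proof -
  define S where "S = {x :: real. x \<in> \<int> \<and> \<bar>x\<bar> \<le> K}"
  have "finite S"
    unfolding S_def by (rule finite_abs_int_segment)
  let ?f = "\<lambda>g :: 'm \<Rightarrow> 'n \<Rightarrow> real. \<chi> i j. g i j"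
  have "finite {g :: 'm \<times> 'n \<Rightarrow> real. \<forall>x. g x \<in> S}"
    using finite_PiE[of "UNIV :: ('m \<times> 'n) set" "\<lambda>_. S"] \<open>finite S\<close> by (simp add: PiE_UNIV_domain Pi_def del: split_paired_All)
  then have "finite ((\<lambda>g :: 'm \<times> 'n \<Rightarrow> real. (\<chi> i j. g (i, j))) ` {g. \<forall>x. g x \<in> S})"
    by (rule finite_imageI)
  moreover have "{M :: real^'n^'m. \<forall>i j. M $ i $ j \<in> \<int> \<and> \<bar>M $ i $ j\<bar> \<le> K} \<subseteq>
    (\<lambda>g :: 'm \<times> 'n \<Rightarrow> real. (\<chi> i j. g (i, j))) ` {g. \<forall>x. g x \<in> S}"
  proof
    fix M :: "real^'n^'m" assume "M \<in> {M. \<forall>i j. M $ i $ j \<in> \<int> \<and> \<bar>M $ i $ j\<bar> \<le> K}"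
    then show "M \<in> (\<lambda>g :: 'm \<times> 'n \<Rightarrow> real. (\<chi> i j. g (i, j))) ` {g. \<forall>x. g x \<in> S}"
      by (intro image_eqI[of _ _ "\<lambda>(i, j). M $ i $ j"]) (auto simp: S_def vec_eq_iff)
  qed
  ultimately show ?thesis
    by (rule finite_subset[rotated])
qed

lemma norm_matrix_vector_le:
  fixes A :: "'a::real_normed_field^'n^'m"
  shows "norm (A *v x) \<le> norm A * norm x"
proof -
  have "norm ((A *v x) $ i) \<le> norm (A $ i) * norm x" for i
  proof -
    have "norm ((A *v x) $ i) \<le> (\<Sum>j\<in>UNIV. norm (A $ i $ j * x $ j))"
      unfolding matrix_vector_mult_def by (simp add: norm_sum)
    also have "\<dots> = (\<Sum>j\<in>UNIV. \<bar>norm (A $ i $ j)\<bar> * \<bar>norm (x $ j)\<bar>)"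
      by (simp add: norm_mult)
    also have "\<dots> \<le> norm (A $ i) * norm x"
      unfolding norm_vec_def by (rule L2_set_mult_ineq)
    finally show ?thesis .
  qed
  then have "norm (A *v x) \<le> L2_set (\<lambda>i. norm (A $ i) * norm x) UNIV"
    unfolding norm_vec_def[of "A *v x"] by (intro L2_set_mono) auto
  also have "\<dots> = norm A * norm x"
    by (simp add: norm_vec_def[of A] L2_set_left_distrib)
  finally show ?thesis .
qed

lemma norm_map_Im_le: "norm (map_matrix Im A) \<le> norm A"
  and norm_map_Re_le: "norm (map_matrix Re A) \<le> norm A"
  unfolding norm_vec_def[of "map_matrix Im A"] norm_vec_def[of "map_matrix Re A"] norm_vec_def[of A]
  by (intro L2_set_mono; simp add: norm_vec_def L2_set_mono abs_Im_le_cmod abs_Re_le_cmod)+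

lemma siegel_space_local_bounds:
  fixes \<tau>0 :: "'g::finite cmatrix"
  assumes "\<tau>0 \<in> siegel_space"
  obtains e c B where "0 < e" "0 < c" "0 < B"
    "\<And>\<tau>. \<tau> \<in> ball \<tau>0 e \<Longrightarrow> norm \<tau> \<le> B"
    "\<And>\<tau> x. \<tau> \<in> ball \<tau>0 e \<Longrightarrow> c * (norm x)\<^sup>2 \<le> x \<bullet> (map_matrix Im \<tau> *v x)"
proof -
  let ?Y = "map_matrix Im \<tau>0"
  have "x \<noteq> 0 \<Longrightarrow> 0 < x \<bullet> (?Y *v x)" for x
    using assms by (simp add: siegel_space_def)
  then obtain m where "0 < m" and lower: "\<And>x. m * (norm x)\<^sup>2 \<le> x \<bullet> (?Y *v x)"
    using posdef_lower_bound[of ?Y] by metis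
  show ?thesis
  proof
    show "0 < m / 2" "0 < m / 2" "0 < norm \<tau>0 + m"
      using \<open>0 < m\<close> by (auto intro: add_nonneg_pos)
    fix \<tau> assume \<tau>: "\<tau> \<in> ball \<tau>0 (m / 2)"
    then have d: "norm (\<tau> - \<tau>0) < m / 2"
      by (simp add: dist_norm norm_minus_commute)
    then show "norm \<tau> \<le> norm \<tau>0 + m"
      using norm_triangle_sub[of \<tau> \<tau>0] \<open>0 < m\<close> by linarith
    fix x :: "real^'g"
    have "\<bar>x \<bullet> (map_matrix Im (\<tau> - \<tau>0) *v x)\<bar> \<le> norm x * (norm (map_matrix Im (\<tau> - \<tau>0)) * norm x)"
      by (rule order_trans[OF Cauchy_Schwarz_ineq2]) (intro mult_left_mono norm_matrix_vector_le norm_ge_zero)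
    also have "\<dots> \<le> norm x * (m / 2 * norm x)"
      using d norm_map_Im_le[of "\<tau> - \<tau>0"] by (intro mult_left_mono mult_right_mono) auto
    finally have "- (m / 2) * (norm x)\<^sup>2 \<le> x \<bullet> (map_matrix Im (\<tau> - \<tau>0) *v x)"
      by (simp add: power2_eq_square algebra_simps)
    moreover have "map_matrix Im \<tau> = ?Y + map_matrix Im (\<tau> - \<tau>0)"
      by (simp add: matrix_eq_iff)
    ultimately show "m / 2 * (norm x)\<^sup>2 \<le> x \<bullet> (map_matrix Im \<tau> *v x)"
      using lower[of x] by (simp add: matrix_vector_mult_add_rdistrib inner_add_right algebra_simps)
  qed
qed

lemma im_form_lower:
  assumes "transpose \<tau> = \<tau>" "\<And>x. c * (norm x)\<^sup>2 \<le> x \<bullet> (map_matrix Im \<tau> *v x)"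
  shows "c * (norm w)\<^sup>2 \<le> im_form \<tau> w"
proof -
  have "(norm w)\<^sup>2 = (norm (\<chi> i. Re (w $ i)))\<^sup>2 + (norm (\<chi> i. Im (w $ i)))\<^sup>2"
    by (simp add: power2_norm_eq_inner inner_vec_def inner_complex_def sum.distrib)
  then show ?thesis
    using assms(2)[of "\<chi> i. Re (w $ i)"] assms(2)[of "\<chi> i. Im (w $ i)"]
    unfolding im_form_real_imag[OF assms(1)] by (simp add: algebra_simps)
qed

lemma im_form_upper: "im_form \<tau> w \<le> norm \<tau> * (norm w)\<^sup>2"
proof -
  have "norm (\<i> *s w) = norm w"
    by (simp add: norm_vec_def norm_mult)
  then have "im_form \<tau> w \<le> norm w * norm (\<tau> *v w)"
    unfolding im_form_def using norm_cauchy_schwarz[of "\<i> *s w" "\<tau> *v w"] by simp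
  also have "\<dots> \<le> norm w * (norm \<tau> * norm w)"
    by (intro mult_left_mono norm_matrix_vector_le norm_ge_zero)
  finally show ?thesis
    by (simp add: power2_eq_square algebra_simps)
qed

text \<open>The factor of automorphy is bounded because it carries the Hermitian form of \<open>\<sigma>\<close> to a
  multiple of that of \<open>\<tau>\<close>; the real matrix is recovered from the complex product with the frame.\<close>

lemma finite_transporters:
  fixes \<tau>0 \<sigma>0 :: "'g::finite cmatrix"
  assumes "\<tau>0 \<in> siegel_space" "\<sigma>0 \<in> siegel_space" "0 < k"
  obtains e where "0 < e"
    "finite {M \<in> integral_similitudes k. \<exists>\<tau> \<in> siegel_space \<inter> ball \<tau>0 e. siegel_action M \<tau> \<in> ball \<sigma>0 e}"
proof -
  obtain e1 c1 B1 where 1: "0 < e1" "0 < c1" "0 < B1"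
    "\<And>\<tau>. \<tau> \<in> ball \<tau>0 e1 \<Longrightarrow> norm \<tau> \<le> B1"
    "\<And>\<tau> x. \<tau> \<in> ball \<tau>0 e1 \<Longrightarrow> c1 * (norm x)\<^sup>2 \<le> x \<bullet> (map_matrix Im \<tau> *v x)"
    using siegel_space_local_bounds[OF assms(1)] by metis
  obtain e2 c2 B2 where 2: "0 < e2" "0 < c2" "0 < B2"
    "\<And>\<tau>. \<tau> \<in> ball \<sigma>0 e2 \<Longrightarrow> norm \<tau> \<le> B2"
    "\<And>\<tau> x. \<tau> \<in> ball \<sigma>0 e2 \<Longrightarrow> c2 * (norm x)\<^sup>2 \<le> x \<bullet> (map_matrix Im \<tau> *v x)"
    using siegel_space_local_bounds[OF assms(2)] by metis
  (* L bounds the factor of automorphy, K the entries of the product with the frame, and R and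
     K' the left and the right half of a row of M. *)
  define L where "L = sqrt (k * B1 / c2)"
  define K where "K = max (B2 * L) L"
  define R where "R = real CARD('g) * K / c1"
  define K' where "K' = max R (K + B1 * R)"
  have bound: "\<bar>M $ i $ j\<bar> \<le> K'"
    if M: "similitude k M" and \<tau>: "\<tau> \<in> siegel_space" "\<tau> \<in> ball \<tau>0 (min e1 e2)"
      and \<sigma>: "siegel_action M \<tau> \<in> ball \<sigma>0 (min e1 e2)" for M \<tau> i j
  proof -
    let ?\<sigma> = "siegel_action M \<tau>" and ?a = "automorphy M \<tau>"
    have k: "k \<noteq> 0" using assms by simp
    have \<tau>1: "\<tau> \<in> ball \<tau>0 e1" and \<sigma>2: "?\<sigma> \<in> ball \<sigma>0 e2"
      using \<tau> \<sigma> by auto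
    have \<sigma>H: "?\<sigma> \<in> siegel_space"
      using siegel_action_in[OF M assms(3) \<tau>(1)] .
    have fr: "cmat M ** frame \<tau> = stack (?\<sigma> ** ?a) ?a"
      using similitude_frame[OF M k \<tau>(1)] by (simp add: frame_mult)
    then have top: "cmat (block_A M) ** \<tau> + cmat (block_B M) = ?\<sigma> ** ?a"
      by (simp add: cmat_mult_frame stack_eq_iff)
    have a: "norm (?a *v w) \<le> L * norm w" for w
    proof -
      have "c2 * (norm (?a *v w))\<^sup>2 \<le> im_form ?\<sigma> (?a *v w)"
        by (rule im_form_lower[OF siegel_spaceD[OF \<sigma>H] 2(5)[OF \<sigma>2]])
      also have "\<dots> = k * im_form \<tau> w"
        using im_form_automorphy[OF M k, of \<tau> w]
        by (simp add: im_form_def[of ?\<sigma>] top matrix_vector_mul_assoc)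
      also have "\<dots> \<le> k * (B1 * (norm w)\<^sup>2)"
        using im_form_upper[of \<tau> w] 1(4)[OF \<tau>1] assms(3)
        by (intro mult_left_mono order_trans[OF im_form_upper] mult_right_mono) auto
      finally have le: "(norm (?a *v w))\<^sup>2 \<le> (k * B1 / c2) * (norm w)\<^sup>2"
        using 2(2) by (simp add: field_simps)
      have eq: "(k * B1 / c2) * (norm w)\<^sup>2 = (L * norm w)\<^sup>2"
        using 1(3) 2(2) assms(3) by (simp add: L_def power_mult_distrib)
      have "0 \<le> L * norm w"
        using 1(3) 2(2) assms(3) by (simp add: L_def)
      then show ?thesis
        using le unfolding eq by (rule power2_le_imp_le[rotated])
    qed
    have "0 \<le> L"
      using 1(3) 2(2) assms(3) by (simp add: L_def)
    have entry: "norm ((A *v axis j' 1) $ i') = norm (A $ i' $ j')" for A :: "complex^'g^'n" and i' j'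
      by (simp add: matrix_vector_mult_def axis_def if_distrib if_distribR cong: if_cong)
    have ax: "norm (axis j' 1 :: complex^'g) = 1" for j'
      by (simp add: norm_eq_sqrt_inner inner_axis)
    have le: "norm ((cmat M ** frame \<tau>) $ i' $ j') \<le> K" for i' :: "'g + 'g" and j'
    proof (cases i')
      case (Inl i2)
      have "norm ((?\<sigma> ** ?a) $ i2 $ j') \<le> norm ((?\<sigma> ** ?a) *v axis j' 1)"
        unfolding entry[symmetric] by (rule Finite_Cartesian_Product.norm_nth_le)
      also have "\<dots> = norm (?\<sigma> *v (?a *v axis j' 1))"
        by (simp add: matrix_vector_mul_assoc)
      also have "\<dots> \<le> norm ?\<sigma> * norm (?a *v axis j' 1)"
        by (rule norm_matrix_vector_le)
      also have "\<dots> \<le> B2 * (L * norm (axis j' 1 :: complex^'g))"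
        using 2(4)[OF \<sigma>2] 2(3) by (intro mult_mono a) auto
      finally show ?thesis
        by (simp add: fr Inl ax K_def)
    next
      case (Inr i2)
      have "norm (?a $ i2 $ j') \<le> norm (?a *v axis j' 1)"
        unfolding entry[symmetric] by (rule Finite_Cartesian_Product.norm_nth_le)
      also have "\<dots> \<le> L * norm (axis j' 1 :: complex^'g)"
        by (rule a)
      finally show ?thesis
        by (simp add: fr Inr ax K_def)
    qed
    define p where "p = (\<chi> l. M $ i $ Inl l)"
    define q where "q = (\<chi> l. M $ i $ Inr l)"
    let ?X = "map_matrix Re \<tau>" and ?Y = "map_matrix Im \<tau>"
    have symt: "\<tau> $ l $ j' = \<tau> $ j' $ l" for l j'
      using arg_cong[OF siegel_spaceD[OF \<tau>(1)], of "\<lambda>A. A $ j' $ l"] by (simp add: transpose_def)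
    have row: "(cmat M ** frame \<tau>) $ i $ j' = Complex ((?X *v p) $ j' + q $ j') ((?Y *v p) $ j')" for j'
    proof -
      have "(cmat M ** frame \<tau>) $ i $ j' = (\<Sum>l\<in>UNIV. of_real (p $ l) * \<tau> $ l $ j') +
          (\<Sum>l\<in>UNIV. if l = j' then of_real (q $ l) else 0)"
        by (simp add: matrix_matrix_mult_def sum_plus_type frame_def mat_def p_def q_def
            if_distrib cong: if_cong)
      also have "\<dots> = (\<Sum>l\<in>UNIV. \<tau> $ j' $ l * of_real (p $ l)) + of_real (q $ j')"
        unfolding symt[of _ j'] by (simp add: mult.commute)
      finally show ?thesis
        by (simp add: complex_eq_iff matrix_vector_mult_def)
    qed
    have Yp: "\<bar>(?Y *v p) $ j'\<bar> \<le> K" and Xpq: "\<bar>(?X *v p) $ j' + q $ j'\<bar> \<le> K" for j'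
      using le[of i j'] abs_Im_le_cmod[of "(cmat M ** frame \<tau>) $ i $ j'"]
        abs_Re_le_cmod[of "(cmat M ** frame \<tau>) $ i $ j'"] by (auto simp: row)
    have "0 \<le> K"
      using Yp[of undefined] by linarith
    have "norm (?Y *v p) \<le> (\<Sum>j'\<in>UNIV. \<bar>(?Y *v p) $ j'\<bar>)"
      by (rule norm_le_l1_cart)
    also have "\<dots> \<le> real CARD('g) * K"
      using sum_bounded_above[of UNIV "\<lambda>j'. \<bar>(?Y *v p) $ j'\<bar>" K] Yp by simp
    finally have nYp: "norm (?Y *v p) \<le> real CARD('g) * K" .
    have "c1 * (norm p)\<^sup>2 \<le> p \<bullet> (?Y *v p)"
      by (rule 1(5)[OF \<tau>1])
    also have "\<dots> \<le> norm p * norm (?Y *v p)"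
      by (rule norm_cauchy_schwarz)
    also have "\<dots> \<le> norm p * (real CARD('g) * K)"
      by (intro mult_left_mono nYp norm_ge_zero)
    finally have "norm p * (c1 * norm p) \<le> norm p * (real CARD('g) * K)"
      by (simp add: power2_eq_square algebra_simps)
    then have p: "norm p \<le> R"
      using 1(2) \<open>0 \<le> K\<close> by (cases "p = 0") (auto simp: R_def field_simps)
    have "\<bar>q $ l\<bar> \<le> K + B1 * R" for l
    proof -
      have "\<bar>(?X *v p) $ l\<bar> \<le> norm (?X *v p)"
        using component_le_norm_cart by blast
      also have "\<dots> \<le> B1 * R"
        using 1(3) 1(4)[OF \<tau>1] norm_map_Re_le[of \<tau>] p
        by (intro order_trans[OF norm_matrix_vector_le] mult_mono) auto
      finally show ?thesis
        using Xpq[of l] by linarith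
    qed
    moreover have "\<bar>p $ l\<bar> \<le> R" for l
      using p component_le_norm_cart order_trans by blast
    ultimately show ?thesis
      by (cases j) (auto simp: K'_def p_def q_def le_max_iff_disj)
  qed
  have "{M \<in> integral_similitudes k. \<exists>\<tau> \<in> siegel_space \<inter> ball \<tau>0 (min e1 e2). siegel_action M \<tau> \<in> ball \<sigma>0 (min e1 e2)}
    \<subseteq> {M. \<forall>i j. M $ i $ j \<in> \<int> \<and> \<bar>M $ i $ j\<bar> \<le> K'}"
    using bound by (auto simp: integral_similitudes_def)
  then have "finite {M \<in> integral_similitudes k. \<exists>\<tau> \<in> siegel_space \<inter> ball \<tau>0 (min e1 e2). siegel_action M \<tau> \<in> ball \<sigma>0 (min e1 e2)}"
    using finite_bounded_integral_matrices finite_subset by blast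
  then show ?thesis
    using that[of "min e1 e2"] 1(1) 2(1) by auto
qed

text \<open>Although the fixed point sets are not compact, only finitely many of them pass near a
  given point: a \<open>j\<close> with a fixed point near \<open>\<tau>0\<close> moves a point near
  \<open>\<tau>0\<close> to a point near \<open>\<tau>0\<close>. This applies to the translates of
  the unitary domain.\<close>

lemma fixset_locally_finite:
  assumes "\<tau>0 \<in> siegel_space" "0 < k"
  obtains e where "0 < e" "finite {j \<in> integral_similitudes k. fixset j \<inter> ball \<tau>0 e \<noteq> {}}"
proof -
  obtain e where e: "0 < e"
    "finite {M \<in> integral_similitudes k. \<exists>\<tau> \<in> siegel_space \<inter> ball \<tau>0 e. siegel_action M \<tau> \<in> ball \<tau>0 e}"
    using finite_transporters[OF assms(1,1,2)] by blast
  have "{j \<in> integral_similitudes k. fixset j \<inter> ball \<tau>0 e \<noteq> {}} \<subseteq>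
    {M \<in> integral_similitudes k. \<exists>\<tau> \<in> siegel_space \<inter> ball \<tau>0 e. siegel_action M \<tau> \<in> ball \<tau>0 e}"
  proof
    fix j assume j: "j \<in> {j \<in> integral_similitudes k. fixset j \<inter> ball \<tau>0 e \<noteq> {}}"
    then obtain \<tau> where \<tau>: "\<tau> \<in> fixset j" "\<tau> \<in> ball \<tau>0 e"
      by auto
    have "similitude k j"
      using j by (simp add: integral_similitudes_def)
    then have "\<tau> \<in> siegel_space" "siegel_action j \<tau> = \<tau>"
      using fixset_iff_action[of k j \<tau>] assms(2) \<tau>(1) by auto
    then show "j \<in> {M \<in> integral_similitudes k. \<exists>\<tau> \<in> siegel_space \<inter> ball \<tau>0 e. siegel_action M \<tau> \<in> ball \<tau>0 e}"
      using j \<tau>(2) by (metis (no_types, lifting) IntI mem_Collect_eq)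
  qed
  then show ?thesis
    using that e finite_subset by blast
qed

section \<open>Analytic sets\<close>

lemma holomorphic_wrt_subset: "holomorphic_wrt sc f U \<Longrightarrow> V \<subseteq> U \<Longrightarrow> holomorphic_wrt sc f V"
  by (auto simp: holomorphic_wrt_def)

lemma holomorphic_wrt_const: "holomorphic_wrt sc (\<lambda>_. c) U"
  unfolding holomorphic_wrt_def by (auto intro!: exI[of _ "\<lambda>_. 0"] derivative_intros)

lemma holomorphic_wrt_add:
  assumes "holomorphic_wrt sc f U" "holomorphic_wrt sc g U"
  shows "holomorphic_wrt sc (\<lambda>x. f x + g x) U"
  unfolding holomorphic_wrt_def
proof
  fix x assume "x \<in> U"
  then obtain f' g' where "(f has_derivative f') (at x)" "\<forall>c v. f' (sc c v) = c * f' v"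
    "(g has_derivative g') (at x)" "\<forall>c v. g' (sc c v) = c * g' v"
    using assms unfolding holomorphic_wrt_def by meson
  then show "\<exists>h'. ((\<lambda>x. f x + g x) has_derivative h') (at x) \<and> (\<forall>c v. h' (sc c v) = c * h' v)"
    by (intro exI[of _ "\<lambda>v. f' v + g' v"]) (auto intro!: derivative_intros simp: algebra_simps)
qed

lemma holomorphic_wrt_mult:
  assumes "holomorphic_wrt sc f U" "holomorphic_wrt sc g U"
  shows "holomorphic_wrt sc (\<lambda>x. f x * g x) U"
  unfolding holomorphic_wrt_def
proof
  fix x assume "x \<in> U"
  then obtain f' g' where "(f has_derivative f') (at x)" "\<forall>c v. f' (sc c v) = c * f' v"
    "(g has_derivative g') (at x)" "\<forall>c v. g' (sc c v) = c * g' v"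
    using assms unfolding holomorphic_wrt_def by meson
  then show "\<exists>h'. ((\<lambda>x. f x * g x) has_derivative h') (at x) \<and> (\<forall>c v. h' (sc c v) = c * h' v)"
    by (intro exI[of _ "\<lambda>v. f x * g' v + f' v * g x"]) (auto intro!: derivative_intros simp: algebra_simps)
qed

lemma holomorphic_wrt_sum:
  "(\<And>i. i \<in> I \<Longrightarrow> holomorphic_wrt sc (f i) U) \<Longrightarrow> holomorphic_wrt sc (\<lambda>x. \<Sum>i\<in>I. f i x) U"
  by (induction I rule: infinite_finite_induct)
    (auto intro: holomorphic_wrt_add holomorphic_wrt_const)

definition holomorphic_matrix ::
  "(complex \<Rightarrow> 'a \<Rightarrow> 'a) \<Rightarrow> ('a::euclidean_space \<Rightarrow> complex^'n^'m) \<Rightarrow> 'a set \<Rightarrow> bool" where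
  "holomorphic_matrix sc \<Phi> U \<longleftrightarrow> (\<forall>i j. holomorphic_wrt sc (\<lambda>x. \<Phi> x $ i $ j) U)"

lemma holomorphic_matrix_const: "holomorphic_matrix sc (\<lambda>_. A) U"
  and holomorphic_matrix_add: "holomorphic_matrix sc \<Phi> U \<Longrightarrow> holomorphic_matrix sc \<Psi> U \<Longrightarrow>
    holomorphic_matrix sc (\<lambda>x. \<Phi> x + \<Psi> x) U"
  and holomorphic_matrix_diff: "holomorphic_matrix sc \<Phi> U \<Longrightarrow> holomorphic_matrix sc \<Psi> U \<Longrightarrow>
    holomorphic_matrix sc (\<lambda>x. \<Phi> x - \<Psi> x) U"
  and holomorphic_matrix_mult: "holomorphic_matrix sc \<Xi> U \<Longrightarrow> holomorphic_matrix sc \<Theta> U \<Longrightarrow>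
    holomorphic_matrix sc (\<lambda>x. \<Xi> x ** \<Theta> x) U"
proof -
  show "holomorphic_matrix sc (\<lambda>_. A) U"
    by (simp add: holomorphic_matrix_def holomorphic_wrt_const)
  show "holomorphic_matrix sc \<Phi> U \<Longrightarrow> holomorphic_matrix sc \<Psi> U \<Longrightarrow>
    holomorphic_matrix sc (\<lambda>x. \<Phi> x + \<Psi> x) U"
    by (simp add: holomorphic_matrix_def holomorphic_wrt_add)
  show "holomorphic_matrix sc (\<lambda>x. \<Phi> x - \<Psi> x) U"
    if "holomorphic_matrix sc \<Phi> U" "holomorphic_matrix sc \<Psi> U"
  proof -
    have "holomorphic_wrt sc (\<lambda>x. \<Phi> x $ i $ j + (- 1) * \<Psi> x $ i $ j) U" for i j
      using that by (intro holomorphic_wrt_add holomorphic_wrt_mult holomorphic_wrt_const)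
        (auto simp: holomorphic_matrix_def)
    then show ?thesis
      by (simp add: holomorphic_matrix_def)
  qed
  show "holomorphic_matrix sc \<Xi> U \<Longrightarrow> holomorphic_matrix sc \<Theta> U \<Longrightarrow>
    holomorphic_matrix sc (\<lambda>x. \<Xi> x ** \<Theta> x) U"
    by (simp add: holomorphic_matrix_def matrix_matrix_mult_def holomorphic_wrt_mult holomorphic_wrt_sum)
qed

lemmas holomorphic_matrix_intros = holomorphic_matrix_const holomorphic_matrix_add
  holomorphic_matrix_diff holomorphic_matrix_mult

lemma bounded_linear_entry: "bounded_linear (\<lambda>A :: complex^'n^'m. A $ i $ j)"
  by (intro bounded_linear_compose[OF bounded_linear_vec_nth bounded_linear_vec_nth])

lemma scale_matrix_eq_sm: "scale_matrix c A = sm c A"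
  by (simp add: scale_matrix_def mat_mult_eq_sm)

lemma holomorphic_matrix_id: "holomorphic_matrix scale_matrix (\<lambda>\<tau>. \<tau>) U"
  unfolding holomorphic_matrix_def holomorphic_wrt_def
  by (auto intro!: exI bounded_linear_imp_has_derivative bounded_linear_entry simp: scale_matrix_eq_sm)

lemma holomorphic_matrix_fst: "holomorphic_matrix scale_pair fst U"
  and holomorphic_matrix_snd: "holomorphic_matrix scale_pair snd U"
proof -
  have fst': "bounded_linear (\<lambda>x :: 'a cmatrix \<times> 'a cmatrix. fst x $ i $ j)"
    and snd': "bounded_linear (\<lambda>x :: 'a cmatrix \<times> 'a cmatrix. snd x $ i $ j)" for i j
    by (rule bounded_linear_compose[OF bounded_linear_entry bounded_linear_fst]
        bounded_linear_compose[OF bounded_linear_entry bounded_linear_snd])+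
  show "holomorphic_matrix scale_pair fst U" "holomorphic_matrix scale_pair snd U"
    unfolding holomorphic_matrix_def holomorphic_wrt_def
    by (auto intro!: exI bounded_linear_imp_has_derivative fst' snd'
        simp: scale_matrix_eq_sm scale_pair_def)
qed

text \<open>The condition of \<^const>\<open>analytic_subset\<close> at a single point.\<close>

definition analytic_at :: "(complex \<Rightarrow> 'a \<Rightarrow> 'a) \<Rightarrow> ('a::euclidean_space) set \<Rightarrow> 'a set \<Rightarrow> 'a \<Rightarrow> bool" where
  "analytic_at sc \<Omega> Z x \<longleftrightarrow> (\<exists>U F. open U \<and> x \<in> U \<and> finite F \<and> (\<forall>f\<in>F. holomorphic_wrt sc f U) \<and>
        Z \<inter> U = {u \<in> \<Omega> \<inter> U. \<forall>f\<in>F. f u = 0})"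

lemma analytic_subset_iff: "analytic_subset sc \<Omega> Z \<longleftrightarrow> Z \<subseteq> \<Omega> \<and> (\<forall>x\<in>\<Omega>. analytic_at sc \<Omega> Z x)"
  by (simp add: analytic_subset_def analytic_at_def)

lemma analytic_atE:
  assumes "analytic_at sc \<Omega> Z x"
  obtains U F where "open U" "x \<in> U" "finite F" "\<And>f. f \<in> F \<Longrightarrow> holomorphic_wrt sc f U"
    "\<And>u. u \<in> U \<Longrightarrow> u \<in> Z \<longleftrightarrow> u \<in> \<Omega> \<and> (\<forall>f\<in>F. f u = 0)"
proof -
  obtain U F where "open U" "x \<in> U" "finite F" "\<forall>f\<in>F. holomorphic_wrt sc f U"
    and eq: "Z \<inter> U = {u \<in> \<Omega> \<inter> U. \<forall>f\<in>F. f u = 0}"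
    using assms unfolding analytic_at_def by blast
  moreover have "u \<in> Z \<longleftrightarrow> u \<in> \<Omega> \<and> (\<forall>f\<in>F. f u = 0)" if "u \<in> U" for u
    using that eq by blast
  ultimately show ?thesis
    using that by blast
qed

lemma analytic_atI:
  assumes "open U" "x \<in> U" "finite F" "\<And>f. f \<in> F \<Longrightarrow> holomorphic_wrt sc f U"
    "\<And>u. u \<in> U \<Longrightarrow> u \<in> Z \<longleftrightarrow> u \<in> \<Omega> \<and> (\<forall>f\<in>F. f u = 0)"
  shows "analytic_at sc \<Omega> Z x"
  using assms unfolding analytic_at_def by blast

lemma analytic_at_cong:
  assumes "analytic_at sc \<Omega> Z x" "open V" "x \<in> V" "Z \<inter> V = Z' \<inter> V"
  shows "analytic_at sc \<Omega> Z' x"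
proof -
  obtain U F where U: "open U" "x \<in> U" "finite F" "\<And>f. f \<in> F \<Longrightarrow> holomorphic_wrt sc f U"
    "\<And>u. u \<in> U \<Longrightarrow> u \<in> Z \<longleftrightarrow> u \<in> \<Omega> \<and> (\<forall>f\<in>F. f u = 0)"
    using analytic_atE[OF assms(1)] by metis
  show ?thesis
    by (rule analytic_atI[of "U \<inter> V" _ F])
      (use U assms in \<open>auto intro: holomorphic_wrt_subset\<close>)
qed

lemma analytic_at_empty: "analytic_at sc \<Omega> {} x"
  by (rule analytic_atI[of UNIV _ "{\<lambda>_. 1}"]) (auto intro: holomorphic_wrt_const)

lemma analytic_at_Int:
  assumes "analytic_at sc \<Omega> Z x" "analytic_at sc \<Omega> Z' x"
  shows "analytic_at sc \<Omega> (Z \<inter> Z') x"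
proof -
  obtain U F where U: "open U" "x \<in> U" "finite F" "\<And>f. f \<in> F \<Longrightarrow> holomorphic_wrt sc f U"
    "\<And>u. u \<in> U \<Longrightarrow> u \<in> Z \<longleftrightarrow> u \<in> \<Omega> \<and> (\<forall>f\<in>F. f u = 0)"
    using analytic_atE[OF assms(1)] by metis
  obtain U' F' where U': "open U'" "x \<in> U'" "finite F'" "\<And>f. f \<in> F' \<Longrightarrow> holomorphic_wrt sc f U'"
    "\<And>u. u \<in> U' \<Longrightarrow> u \<in> Z' \<longleftrightarrow> u \<in> \<Omega> \<and> (\<forall>f\<in>F'. f u = 0)"
    using analytic_atE[OF assms(2)] by metis
  show ?thesis
    by (rule analytic_atI[of "U \<inter> U'" _ "F \<union> F'"])
      (use U U' in \<open>auto intro: holomorphic_wrt_subset[of sc _ U] holomorphic_wrt_subset[of sc _ U']\<close>)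
qed

text \<open>The union is cut out by the products of an equation of one set with an equation of the
  other.\<close>

lemma analytic_at_Un:
  assumes "analytic_at sc \<Omega> Z x" "analytic_at sc \<Omega> Z' x"
  shows "analytic_at sc \<Omega> (Z \<union> Z') x"
proof -
  obtain U F where U: "open U" "x \<in> U" "finite F" "\<And>f. f \<in> F \<Longrightarrow> holomorphic_wrt sc f U"
    "\<And>u. u \<in> U \<Longrightarrow> u \<in> Z \<longleftrightarrow> u \<in> \<Omega> \<and> (\<forall>f\<in>F. f u = 0)"
    using analytic_atE[OF assms(1)] by metis
  obtain U' F' where U': "open U'" "x \<in> U'" "finite F'" "\<And>f. f \<in> F' \<Longrightarrow> holomorphic_wrt sc f U'"
    "\<And>u. u \<in> U' \<Longrightarrow> u \<in> Z' \<longleftrightarrow> u \<in> \<Omega> \<and> (\<forall>f\<in>F'. f u = 0)"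
    using analytic_atE[OF assms(2)] by metis
  let ?G = "(\<lambda>(f, f') u. f u * f' u) ` (F \<times> F')"
  show ?thesis
  proof (rule analytic_atI[of "U \<inter> U'" _ ?G])
    show "open (U \<inter> U')" "x \<in> U \<inter> U'" "finite ?G"
      using U U' by auto
    fix g assume "g \<in> ?G"
    then show "holomorphic_wrt sc g (U \<inter> U')"
      using U(4) U'(4) by (auto intro!: holomorphic_wrt_mult intro: holomorphic_wrt_subset)
  next
    fix u assume "u \<in> U \<inter> U'"
    then show "u \<in> Z \<union> Z' \<longleftrightarrow> u \<in> \<Omega> \<and> (\<forall>g\<in>?G. g u = 0)"
      using U(5)[of u] U'(5)[of u] by (auto simp: ball_Un image_iff split_beta)
  qed
qed

lemma analytic_at_UN:
  "finite I \<Longrightarrow> (\<And>i. i \<in> I \<Longrightarrow> analytic_at sc \<Omega> (Z i) x) \<Longrightarrow> analytic_at sc \<Omega> (\<Union>i\<in>I. Z i) x"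
  by (induction I rule: finite_induct) (auto intro: analytic_at_empty analytic_at_Un)

lemma analytic_subset_Int:
  "analytic_subset sc \<Omega> Z \<Longrightarrow> analytic_subset sc \<Omega> Z' \<Longrightarrow> analytic_subset sc \<Omega> (Z \<inter> Z')"
  by (auto simp: analytic_subset_iff analytic_at_Int)

lemma analytic_subset_empty: "analytic_subset sc \<Omega> {}"
  by (simp add: analytic_subset_iff analytic_at_empty)

lemma analytic_subset_locally_finite_Union:
  assumes "\<And>Z. Z \<in> \<Z> \<Longrightarrow> analytic_subset sc \<Omega> Z"
    and "\<And>x. x \<in> \<Omega> \<Longrightarrow> \<exists>U. open U \<and> x \<in> U \<and> finite {Z \<in> \<Z>. Z \<inter> U \<noteq> {}}"
  shows "analytic_subset sc \<Omega> (\<Union>\<Z>)"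
  unfolding analytic_subset_iff
proof (intro conjI ballI)
  show "\<Union>\<Z> \<subseteq> \<Omega>"
    using assms(1) by (auto simp: analytic_subset_iff)
  fix x assume x: "x \<in> \<Omega>"
  then obtain U where U: "open U" "x \<in> U" "finite {Z \<in> \<Z>. Z \<inter> U \<noteq> {}}"
    using assms(2) by blast
  have "analytic_at sc \<Omega> (\<Union>Z\<in>{Z \<in> \<Z>. Z \<inter> U \<noteq> {}}. Z) x"
    using U(3) assms(1) x by (intro analytic_at_UN) (auto simp: analytic_subset_iff)
  then show "analytic_at sc \<Omega> (\<Union>\<Z>) x"
    by (rule analytic_at_cong[OF _ U(1,2)]) auto
qed

lemma analytic_subset_matrix_zeros:
  assumes "holomorphic_matrix sc \<Phi> UNIV"
  shows "analytic_subset sc \<Omega> {x \<in> \<Omega>. \<Phi> x = 0}"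
  unfolding analytic_subset_iff
proof (intro conjI ballI)
  let ?F = "range (\<lambda>(i, j) x. \<Phi> x $ i $ j)"
  fix x
  show "analytic_at sc \<Omega> {x \<in> \<Omega>. \<Phi> x = 0} x"
    by (rule analytic_atI[of UNIV _ ?F])
      (use assms in \<open>auto simp: holomorphic_matrix_def matrix_eq_iff\<close>)
qed auto

lemma analytic_fixset: "analytic_subset scale_matrix siegel_space (fixset j)"
proof -
  have "fixset j = {\<tau> \<in> siegel_space. cmat (block_A j) ** \<tau> + cmat (block_B j) - \<tau> ** automorphy j \<tau> = 0}"
    by (auto simp: fixset_iff_equation)
  also have "analytic_subset scale_matrix siegel_space \<dots>"
    unfolding automorphy_def
    by (intro analytic_subset_matrix_zeros holomorphic_matrix_intros holomorphic_matrix_id)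
  finally show ?thesis .
qed

definition fixset_graph :: "'g::finite bmatrix \<Rightarrow> 'g bmatrix \<Rightarrow> ('g cmatrix \<times> 'g cmatrix) set" where
  "fixset_graph j M = {(\<tau>, \<sigma>) \<in> siegel_space \<times> siegel_space. \<tau> \<in> fixset j \<and> siegel_action M \<tau> = \<sigma>}"

lemma analytic_fixset_graph:
  assumes "similitude k M" "k \<noteq> 0"
  shows "analytic_subset scale_pair (siegel_space \<times> siegel_space) (fixset_graph j M)"
proof -
  let ?\<Omega> = "siegel_space \<times> siegel_space"
  let ?\<Phi> = "\<lambda>x. cmat (block_A j) ** fst x + cmat (block_B j) - fst x ** (cmat (block_C j) ** fst x + cmat (block_D j))"
  let ?\<Psi> = "\<lambda>x. cmat (block_A M) ** fst x + cmat (block_B M) - snd x ** (cmat (block_C M) ** fst x + cmat (block_D M))"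
  have *: "siegel_action M \<tau> = \<sigma> \<longleftrightarrow> cmat (block_A M) ** \<tau> + cmat (block_B M) = \<sigma> ** automorphy M \<tau>"
    if "\<tau> \<in> siegel_space" for \<tau> \<sigma>
    using similitude_frame[OF assms that] siegel_action_eqI[OF assms that, of \<sigma> "automorphy M \<tau>"]
    by (auto simp: cmat_mult_frame frame_mult stack_eq_iff)
  have "x \<in> fixset_graph j M \<longleftrightarrow> x \<in> {x \<in> ?\<Omega>. ?\<Phi> x = 0} \<inter> {x \<in> ?\<Omega>. ?\<Psi> x = 0}" for x
  proof (cases "fst x \<in> siegel_space")
    case True
    show ?thesis
      using *[OF True, of "snd x"]
      by (simp add: fixset_graph_def split_beta mem_Times_iff fixset_iff_equation
          automorphy_def[symmetric] conj_ac)
  qed (auto simp: fixset_graph_def)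
  then have "fixset_graph j M = {x \<in> ?\<Omega>. ?\<Phi> x = 0} \<inter> {x \<in> ?\<Omega>. ?\<Psi> x = 0}"
    by blast
  also have "analytic_subset scale_pair ?\<Omega> \<dots>"
    by (intro analytic_subset_Int analytic_subset_matrix_zeros holomorphic_matrix_intros
        holomorphic_matrix_fst holomorphic_matrix_snd)
  finally show ?thesis .
qed

section \<open>Holomorphic curves\<close>

definition holomorphic_curve ::
  "(complex \<Rightarrow> 'a \<Rightarrow> 'a) \<Rightarrow> (complex \<Rightarrow> 'a::euclidean_space) \<Rightarrow> complex set \<Rightarrow> bool" where
  "holomorphic_curve sc \<phi> U \<longleftrightarrow> open U \<and> connected U \<and>
     (\<forall>z\<in>U. \<exists>w. (\<phi> has_derivative (\<lambda>h. sc h w)) (at z))"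

lemma holomorphic_curve_compose:
  assumes "holomorphic_curve sc \<phi> U" "holomorphic_wrt sc f W" "V \<subseteq> U" "open V" "\<phi> ` V \<subseteq> W"
  shows "(f \<circ> \<phi>) holomorphic_on V"
proof -
  have "\<exists>d. ((f \<circ> \<phi>) has_field_derivative d) (at z)" if z: "z \<in> V" for z
  proof -
    obtain w where w: "(\<phi> has_derivative (\<lambda>h. sc h w)) (at z)"
      using assms z unfolding holomorphic_curve_def by blast
    obtain f' where f': "(f has_derivative f') (at (\<phi> z))" "\<And>c v. f' (sc c v) = c * f' v"
      using assms z unfolding holomorphic_wrt_def by blast
    have "((f \<circ> \<phi>) has_derivative (f' \<circ> (\<lambda>h. sc h w))) (at z)"
      by (rule diff_chain_at[OF w f'(1)])
    then have "((f \<circ> \<phi>) has_derivative (\<lambda>h. f' w * h)) (at z)"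
      by (simp add: o_def f'(2) mult.commute)
    then show ?thesis
      by (auto simp: has_field_derivative_def)
  qed
  then show ?thesis
    using assms(4) by (simp add: holomorphic_on_open)
qed

text \<open>By the identity theorem, a curve lies in an analytic set or meets it in isolated points.\<close>

lemma curve_in_analytic_subset:
  assumes \<phi>: "holomorphic_curve sc \<phi> U" "\<phi> ` U \<subseteq> \<Omega>" and Z: "analytic_subset sc \<Omega> Z"
    and z: "z \<in> U" "z islimpt {u \<in> U. \<phi> u \<in> Z}"
  shows "\<phi> ` U \<subseteq> Z"
proof -
  define T where "T = {u \<in> U. \<phi> u \<in> Z}"
  have U: "open U" "connected U"
    using \<phi> by (auto simp: holomorphic_curve_def)
  have cont: "continuous_on U \<phi>"
    using \<phi>(1) unfolding holomorphic_curve_def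
    by (meson continuous_at_imp_continuous_on has_derivative_continuous)
  have near: "\<exists>e>0. ball x e \<subseteq> T" if x: "x \<in> U" "x islimpt T" for x
  proof -
    have "analytic_at sc \<Omega> Z (\<phi> x)"
      using Z \<phi>(2) x by (auto simp: analytic_subset_iff)
    then obtain W F where W: "open W" "\<phi> x \<in> W" "\<And>f. f \<in> F \<Longrightarrow> holomorphic_wrt sc f W"
      "\<And>u. u \<in> W \<Longrightarrow> u \<in> Z \<longleftrightarrow> u \<in> \<Omega> \<and> (\<forall>f\<in>F. f u = 0)"
      using analytic_atE by metis
    have "open (U \<inter> \<phi> -` W)"
      using continuous_open_preimage[OF cont U(1) W(1)] .
    then obtain e where e: "0 < e" "ball x e \<subseteq> U \<inter> \<phi> -` W"
      using x(1) W(2) open_contains_ball by (metis IntI vimageI)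
    have "f (\<phi> u) = 0" if "f \<in> F" "u \<in> ball x e" for f u
    proof -
      have "(f \<circ> \<phi>) holomorphic_on ball x e"
        using e by (intro holomorphic_curve_compose[OF \<phi>(1) W(3)[OF \<open>f \<in> F\<close>]]) auto
      then have "(f \<circ> \<phi>) u = 0"
      proof (rule analytic_continuation[where U = "T \<inter> ball x e" and \<xi> = x])
        show "x islimpt T \<inter> ball x e"
          using x(2) e(1) by (intro islimpt_Int_eventually eventually_at_in_open') auto
        fix y assume "y \<in> T \<inter> ball x e"
        then show "(f \<circ> \<phi>) y = 0"
          using W(4)[of "\<phi> y"] e(2) \<open>f \<in> F\<close> by (auto simp: T_def)
      qed (use e that in auto)
      then show ?thesis by simp
    qed
    then have "ball x e \<subseteq> T"
      using W(4) e(2) \<phi>(2) by (auto simp: T_def) (metis Int_iff image_subset_iff in_mono mem_ball vimage_eq)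
    then show ?thesis
      using e(1) by blast
  qed
  (* A is open because its points have a neighbourhood in T, and closed in U by definition. *)
  define A where "A = {x \<in> U. x islimpt T}"
  have "open A"
    unfolding open_contains_ball
  proof
    fix x assume x: "x \<in> A"
    then obtain e where e: "0 < e" "ball x e \<subseteq> T"
      using near by (auto simp: A_def)
    have "ball x e \<subseteq> A"
    proof
      fix y assume y: "y \<in> ball x e"
      have "y islimpt ball x e"
        using y e(1) by (intro open_imp_islimpt) auto
      then show "y \<in> A"
        using e(2) y islimpt_subset by (auto simp: A_def T_def)
    qed
    then show "\<exists>e>0. ball x e \<subseteq> A"
      using e(1) by blast
  qed
  moreover have "open (U - A)"
  proof -
    have "U - A = U - {x. x islimpt T}"
      by (auto simp: A_def)
    then show ?thesis
      using U(1) closed_limpts by (metis open_Diff)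
  qed
  moreover have "z \<in> A"
    using z by (simp add: A_def T_def)
  ultimately have "U - A = {}"
    using connectedD[OF U(2), of A "U - A"] z(1) by blast
  have "U \<subseteq> T"
  proof
    fix x assume "x \<in> U"
    then have "x \<in> U" "x islimpt T"
      using \<open>U - A = {}\<close> by (auto simp: A_def)
    then obtain e where "0 < e" "ball x e \<subseteq> T"
      using near by blast
    then show "x \<in> T"
      using centre_in_ball by blast
  qed
  then show ?thesis
    by (auto simp: T_def)
qed

lemma matrix_has_derivative:
  fixes \<phi> :: "complex \<Rightarrow> complex^'n^'m"
  assumes "\<And>i j. ((\<lambda>z. \<phi> z $ i $ j) has_field_derivative w $ i $ j) (at z)"
  shows "(\<phi> has_derivative (\<lambda>h. sm h w)) (at z)"
proof -
  define e where "e = (\<lambda>(i :: 'm) (j :: 'n) c :: complex. (\<chi> i' j'. if i' = i \<and> j' = j then c else 0) :: complex^'n^'m)"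
  have "linear (e i j)" for i j
    by (rule linearI) (auto simp: e_def vec_eq_iff)
  then have lin: "bounded_linear (e i j)" for i j
    by (simp add: linear_conv_bounded_linear)
  have expand: "A = (\<Sum>i\<in>UNIV. \<Sum>j\<in>UNIV. e i j (A $ i $ j))" for A
  proof -
    have "(\<Sum>i\<in>UNIV. \<Sum>j\<in>UNIV. e i j (A $ i $ j)) $ a $ b = A $ a $ b" for a b
    proof -
      have "(\<Sum>i\<in>UNIV. \<Sum>j\<in>UNIV. e i j (A $ i $ j)) $ a $ b =
        (\<Sum>i\<in>UNIV. \<Sum>j\<in>UNIV. if i = a then (if j = b then A $ i $ j else 0) else 0)"
        unfolding sum_component by (intro sum.cong refl) (auto simp: e_def)
      also have "\<dots> = A $ a $ b"
        by (subst sum.swap) simp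
      finally show ?thesis .
    qed
    then show ?thesis
      by (simp add: vec_eq_iff)
  qed
  have "((\<lambda>z. \<Sum>i\<in>UNIV. \<Sum>j\<in>UNIV. e i j (\<phi> z $ i $ j)) has_derivative
     (\<lambda>h. \<Sum>i\<in>UNIV. \<Sum>j\<in>UNIV. e i j (w $ i $ j * h))) (at z)"
    using assms
    by (intro has_derivative_sum bounded_linear.has_derivative[OF lin]) (simp add: has_field_derivative_def)
  also have "(\<lambda>z. \<Sum>i\<in>UNIV. \<Sum>j\<in>UNIV. e i j (\<phi> z $ i $ j)) = \<phi>"
    using expand by (simp add: fun_eq_iff)
  also have "(\<lambda>h. \<Sum>i\<in>UNIV. \<Sum>j\<in>UNIV. e i j (w $ i $ j * h)) = (\<lambda>h. sm h w)"
    using expand[of "sm _ w"] by (simp add: fun_eq_iff mult.commute)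
  finally show ?thesis .
qed

definition holomorphic_entries :: "(complex \<Rightarrow> complex^'n^'m) \<Rightarrow> complex set \<Rightarrow> bool" where
  "holomorphic_entries \<phi> U \<longleftrightarrow> (\<forall>i j. (\<lambda>z. \<phi> z $ i $ j) holomorphic_on U)"

lemma holomorphic_entries_const: "holomorphic_entries (\<lambda>_. A) U"
  and holomorphic_entries_add: "holomorphic_entries \<phi> U \<Longrightarrow> holomorphic_entries \<psi> U \<Longrightarrow>
    holomorphic_entries (\<lambda>z. \<phi> z + \<psi> z) U"
  and holomorphic_entries_diff: "holomorphic_entries \<phi> U \<Longrightarrow> holomorphic_entries \<psi> U \<Longrightarrow>
    holomorphic_entries (\<lambda>z. \<phi> z - \<psi> z) U"
  and holomorphic_entries_mult: "holomorphic_entries \<xi> U \<Longrightarrow> holomorphic_entries \<theta> U \<Longrightarrow>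
    holomorphic_entries (\<lambda>z. \<xi> z ** \<theta> z) U"
  and holomorphic_entries_sm: "f holomorphic_on U \<Longrightarrow> holomorphic_entries \<phi> U \<Longrightarrow>
    holomorphic_entries (\<lambda>z. sm (f z) (\<phi> z)) U"
  by (auto simp: holomorphic_entries_def matrix_matrix_mult_def intro!: holomorphic_intros)

lemma holomorphic_entries_mat:
  assumes "f holomorphic_on U"
  shows "holomorphic_entries (\<lambda>z. mat (f z)) U"
  unfolding holomorphic_entries_def
proof (intro allI)
  fix i j
  show "(\<lambda>z. mat (f z) $ i $ j) holomorphic_on U"
    using assms by (cases "i = j") (auto simp: mat_def)
qed

lemma holomorphic_det:
  fixes \<phi> :: "complex \<Rightarrow> complex^'n^'n"
  assumes "holomorphic_entries \<phi> U"
  shows "(\<lambda>z. det (\<phi> z)) holomorphic_on U"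
  unfolding det_def using assms
  by (intro holomorphic_intros) (auto simp: holomorphic_entries_def)

text \<open>The entries of the inverse are quotients of determinants, by Cramer's rule.\<close>

lemma holomorphic_entries_inverse:
  fixes \<phi> :: "complex \<Rightarrow> complex^'n^'n"
  assumes "holomorphic_entries \<phi> U" "\<And>z. z \<in> U \<Longrightarrow> invertible (\<phi> z)"
  shows "holomorphic_entries (\<lambda>z. matrix_inv (\<phi> z)) U"
  unfolding holomorphic_entries_def
proof (intro allI)
  fix k l :: 'n
  let ?C = "\<lambda>z. (\<chi> i j. if j = k then (axis l 1 :: complex^'n) $ i else \<phi> z $ i $ j) :: complex^'n^'n"
  have "matrix_inv (\<phi> z) $ k $ l = det (?C z) / det (\<phi> z)" if "z \<in> U" for z
  proof -
    have inv: "invertible (\<phi> z)"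
      using assms(2) that .
    then have "det (\<phi> z) \<noteq> 0"
      by (simp add: invertible_det_nz)
    moreover have "\<phi> z *v (matrix_inv (\<phi> z) *v axis l 1) = axis l 1"
      by (simp add: matrix_vector_mul_assoc matrix_inv_right[OF inv])
    ultimately have "matrix_inv (\<phi> z) *v axis l 1 =
      (\<chi> k. det (\<chi> i j. if j = k then (axis l 1 :: complex^'n) $ i else \<phi> z $ i $ j) / det (\<phi> z))"
      using cramer by blast
    then have "(matrix_inv (\<phi> z) *v axis l 1) $ k = det (?C z) / det (\<phi> z)"
      by simp
    then show ?thesis
      by (simp add: matrix_vector_mult_def axis_def if_distrib cong: if_cong)
  qed
  moreover have "(\<lambda>z. det (?C z) / det (\<phi> z)) holomorphic_on U"
  proof (intro holomorphic_on_divide holomorphic_det)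
    show "holomorphic_entries ?C U"
      unfolding holomorphic_entries_def
    proof (intro allI)
      fix i j
      show "(\<lambda>z. ?C z $ i $ j) holomorphic_on U"
        using assms(1) by (cases "j = k") (auto simp: holomorphic_entries_def)
    qed
    show "det (\<phi> z) \<noteq> 0" if "z \<in> U" for z
      using assms(2)[OF that] by (simp add: invertible_det_nz)
  qed (use assms in auto)
  ultimately show "(\<lambda>z. matrix_inv (\<phi> z) $ k $ l) holomorphic_on U"
    by (simp cong: holomorphic_cong)
qed

lemma holomorphic_entries_derivative:
  assumes "holomorphic_entries \<phi> U" "open U" "z \<in> U"
  obtains w where "(\<phi> has_derivative (\<lambda>h. scale_matrix h w)) (at z)"
proof -
  have "((\<lambda>z. \<phi> z $ i $ j) has_field_derivative (\<chi> i j. deriv (\<lambda>z. \<phi> z $ i $ j) z) $ i $ j) (at z)" for i j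
    using assms by (auto simp: holomorphic_entries_def intro!: holomorphic_derivI)
  then show ?thesis
    using that matrix_has_derivative[of \<phi> "\<chi> i j. deriv (\<lambda>z. \<phi> z $ i $ j) z" z]
    by (simp add: scale_matrix_eq_sm)
qed

lemma holomorphic_curve_matrix:
  assumes "holomorphic_entries \<phi> U" "open U" "connected U"
  shows "holomorphic_curve scale_matrix \<phi> U"
  unfolding holomorphic_curve_def
  using assms by (blast elim: holomorphic_entries_derivative)

lemma holomorphic_curve_pair:
  assumes "holomorphic_entries \<phi> U" "holomorphic_entries \<psi> U" "open U" "connected U"
  shows "holomorphic_curve scale_pair (\<lambda>z. (\<phi> z, \<psi> z)) U"
  unfolding holomorphic_curve_def
proof (intro conjI ballI assms)
  fix z assume z: "z \<in> U"
  obtain w where w: "(\<phi> has_derivative (\<lambda>h. scale_matrix h w)) (at z)"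
    using holomorphic_entries_derivative[OF assms(1,3) z] .
  obtain v where v: "(\<psi> has_derivative (\<lambda>h. scale_matrix h v)) (at z)"
    using holomorphic_entries_derivative[OF assms(2,3) z] .
  have "((\<lambda>z. (\<phi> z, \<psi> z)) has_derivative (\<lambda>h. scale_pair h (w, v))) (at z)"
    using has_derivative_Pair[OF w v] by (simp add: scale_pair_def)
  then show "\<exists>w. ((\<lambda>z. (\<phi> z, \<psi> z)) has_derivative (\<lambda>h. scale_pair h w)) (at z)" ..
qed

lemma holomorphic_entries_action:
  assumes "holomorphic_entries \<phi> U" "\<phi> ` U \<subseteq> siegel_space" "similitude k M" "k \<noteq> 0"
  shows "holomorphic_entries (\<lambda>z. siegel_action M (\<phi> z)) U"
proof -
  have "holomorphic_entries (\<lambda>z. automorphy M (\<phi> z)) U"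
    unfolding automorphy_def
    by (intro holomorphic_entries_add holomorphic_entries_mult holomorphic_entries_const assms)
  moreover have "invertible (automorphy M (\<phi> z))" if "z \<in> U" for z
    using assms that by (intro automorphy_invertible) auto
  ultimately show ?thesis
    unfolding siegel_action_def
    by (intro holomorphic_entries_add holomorphic_entries_mult holomorphic_entries_const
        holomorphic_entries_inverse assms)
qed

section \<open>Joining points of the unitary domain by curves\<close>

text \<open>The curve is the orbit of \<open>\<tau>\<close> under the complexified stabilizer of the base point,
  \<open>v \<mapsto> (\<tau> - v / \<Delta>) (1 + v \<tau>)\<^sup>-\<^sup>1\<close>. For real \<open>v\<close> it stays in the Siegel space, at \<open>v = 0\<close> it is
  at \<open>\<tau>\<close>, and as \<open>v\<close> moves down in the lower half plane it runs into the base point at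
  \<open>v = - \<i> \<surd>\<Delta>\<close>.\<close>

definition rotation_curve :: "nat \<Rightarrow> 'g::finite cmatrix \<Rightarrow> complex \<Rightarrow> 'g cmatrix" where
  "rotation_curve \<Delta> \<tau> v = (\<tau> - mat (v / of_nat \<Delta>)) ** matrix_inv (mat 1 + sm v \<tau>)"

text \<open>For \<open>\<tau>\<close> in the Siegel space, positivity of this form puts
  \<open>rotation_curve \<Delta> \<tau> v\<close> into the Siegel space. Both terms on the right are
  nonnegative for \<open>Im v \<le> 0\<close>, so the form is positive on the closed lower half
  plane, and, with bounds for the two terms, a little beyond it.\<close>

lemma rotation_form:
  fixes \<tau> :: "'g::finite cmatrix"
  shows "(\<i> *s ((mat 1 + sm v \<tau>) *v w)) \<bullet> ((\<tau> - mat (v / of_nat \<Delta>)) *v w) =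
    (1 + (cmod v)\<^sup>2 / real \<Delta>) * im_form \<tau> w - Im v * ((norm w)\<^sup>2 / real \<Delta> + (norm (\<tau> *v w))\<^sup>2)"
proof -
  let ?t = "\<tau> *v w"
  have "(\<i> *s ((mat 1 + sm v \<tau>) *v w)) \<bullet> ((\<tau> - mat (v / of_nat \<Delta>)) *v w) =
    (\<Sum>i\<in>UNIV. (\<i> * (w $ i + v * ?t $ i)) \<bullet> (?t $ i - v / of_nat \<Delta> * w $ i))"
  proof -
    have "mat c *v w = c *s w" for c
      using sm_vector[of c "mat 1" w] by (simp add: sm_mat)
    then show ?thesis
      by (simp add: matrix_vector_mult_add_rdistrib matrix_vector_mult_diff_rdistrib sm_vector inner_vec_def
          distrib_left mult.assoc)
  qed
  also have "\<dots> = (\<Sum>i\<in>UNIV. (1 + (cmod v)\<^sup>2 / real \<Delta>) * ((\<i> * w $ i) \<bullet> ?t $ i) -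
     Im v * ((w $ i \<bullet> w $ i) / real \<Delta> + ?t $ i \<bullet> ?t $ i))"
  proof (rule sum.cong[OF refl])
    fix i
    have "v / of_nat \<Delta> * w $ i = of_real (1 / real \<Delta>) * (v * w $ i)"
      by simp
    moreover have "(\<i> * (a + v * b)) \<bullet> (b - of_real d * (v * a)) =
      (1 + (cmod v)\<^sup>2 * d) * ((\<i> * a) \<bullet> b) - Im v * ((a \<bullet> a) * d + b \<bullet> b)" for a b :: complex and d :: real
      unfolding cmod_power2 by (simp add: inner_complex_def power2_eq_square algebra_simps)
    ultimately show "(\<i> * (w $ i + v * ?t $ i)) \<bullet> (?t $ i - v / of_nat \<Delta> * w $ i) =
      (1 + (cmod v)\<^sup>2 / real \<Delta>) * ((\<i> * w $ i) \<bullet> ?t $ i) -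
        Im v * ((w $ i \<bullet> w $ i) / real \<Delta> + ?t $ i \<bullet> ?t $ i)"
      by (metis (no_types, lifting) divide_inverse inverse_eq_divide)
  qed
  also have "\<dots> = (1 + (cmod v)\<^sup>2 / real \<Delta>) * im_form \<tau> w - Im v * ((norm w)\<^sup>2 / real \<Delta> + (norm ?t)\<^sup>2)"
    by (simp add: sum_subtractf sum_distrib_left[symmetric] sum.distrib sum_divide_distrib[symmetric]
        im_form_def inner_vec_def power2_norm_eq_inner)
  finally show ?thesis .
qed

lemma rotation_curve_properties:
  fixes \<tau> :: "'g::{finite,linorder} cmatrix"
  assumes \<Delta>: "0 < \<Delta>" and \<tau>: "\<tau> \<in> fixset (cm_matrix \<Delta> r)"
  obtains U where "open U" "connected U" "0 \<in> U" "- \<i> * of_real (sqrt (real \<Delta>)) \<in> U"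
    "holomorphic_entries (rotation_curve \<Delta> \<tau>) U"
    "rotation_curve \<Delta> \<tau> ` U \<subseteq> fixset (cm_matrix \<Delta> r)"
    "rotation_curve \<Delta> \<tau> 0 = \<tau>" "rotation_curve \<Delta> \<tau> (- \<i> * of_real (sqrt (real \<Delta>))) = base_point \<Delta>"
proof -
  have H: "\<tau> \<in> siegel_space" and eq: "\<tau> ** cmat (sig_matrix r) ** \<tau> = sm (- 1 / of_nat \<Delta>) (cmat (sig_matrix r))"
    using \<tau> fixset_cm_matrix[OF \<Delta>] by blast+
  have sym: "transpose \<tau> = \<tau>"
    using H by (rule siegel_spaceD)
  obtain c where c: "0 < c" "\<And>x. c * (norm x)\<^sup>2 \<le> x \<bullet> (map_matrix Im \<tau> *v x)"
    proof -
    obtain e c B where "0 < e" "0 < c" "\<And>\<sigma> x. \<sigma> \<in> ball \<tau> e \<Longrightarrow> c * (norm x)\<^sup>2 \<le> x \<bullet> (map_matrix Im \<sigma> *v x)"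
      using siegel_space_local_bounds[OF H] by metis
    then show ?thesis
      using that[of c] centre_in_ball by blast
  qed
  have lower: "c * (norm w)\<^sup>2 \<le> im_form \<tau> w" for w
    by (rule im_form_lower[OF sym c(2)])
  define K where "K = 1 / real \<Delta> + (norm \<tau>)\<^sup>2"
  have "0 < K"
    using \<Delta> by (simp add: K_def add_pos_nonneg)
  (* In rotation_form the factor of Im v is at most K |w|^2, and im_form is at least c |w|^2. *)
  define U where "U = {v. Im v < c / K}"
  have pos: "0 < (\<i> *s ((mat 1 + sm v \<tau>) *v w)) \<bullet> ((\<tau> - mat (v / of_nat \<Delta>)) *v w)"
    if v: "v \<in> U" and w: "w \<noteq> 0" for v w
  proof -
    have "(norm w)\<^sup>2 / real \<Delta> + (norm (\<tau> *v w))\<^sup>2 \<le> K * (norm w)\<^sup>2"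
      using power_mono[OF norm_matrix_vector_le[of \<tau> w], of 2]
      by (simp add: K_def power_mult_distrib algebra_simps)
    moreover have "0 \<le> (norm w)\<^sup>2 / real \<Delta> + (norm (\<tau> *v w))\<^sup>2"
      by simp
    moreover have "0 < im_form \<tau> w"
      using siegel_space_pos[OF H w] .
    moreover have "Im v * ((norm w)\<^sup>2 / real \<Delta> + (norm (\<tau> *v w))\<^sup>2) < im_form \<tau> w"
    proof (cases "Im v \<le> 0")
      case True
      then show ?thesis
        using mult_nonpos_nonneg[OF True] calculation(2,3) by (meson le_less_trans)
    next
      case False
      then have "Im v * ((norm w)\<^sup>2 / real \<Delta> + (norm (\<tau> *v w))\<^sup>2) \<le> Im v * (K * (norm w)\<^sup>2)"
        using calculation(1) by (intro mult_left_mono) auto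
      also have "\<dots> < (c / K) * (K * (norm w)\<^sup>2)"
        using v w \<open>0 < K\<close> by (intro mult_strict_right_mono) (auto simp: U_def)
      also have "\<dots> \<le> im_form \<tau> w"
        using lower[of w] \<open>0 < K\<close> by simp
      finally show ?thesis .
    qed
    moreover have "im_form \<tau> w \<le> (1 + (cmod v)\<^sup>2 / real \<Delta>) * im_form \<tau> w"
      using calculation(3) by (simp add: algebra_simps)
    ultimately show ?thesis
      unfolding rotation_form by linarith
  qed
  have inv: "invertible (mat 1 + sm v \<tau>)" if "v \<in> U" for v
  proof (rule invertible_if_injective)
    fix w assume "(mat 1 + sm v \<tau>) *v w = 0"
    then show "w = 0"
      using pos[OF that, of w] by (cases "w = 0") auto
  qed
  have num: "rotation_curve \<Delta> \<tau> v ** (mat 1 + sm v \<tau>) = \<tau> - mat (v / of_nat \<Delta>)" if "v \<in> U" for v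
    by (simp add: rotation_curve_def matrix_mul_assoc[symmetric] matrix_inv_left[OF inv[OF that]])
  have cancel: "A = A'" if "v \<in> U" "A ** (mat 1 + sm v \<tau>) = A' ** (mat 1 + sm v \<tau>)" for v and A A' :: "'g cmatrix"
  proof -
    have "A ** (mat 1 + sm v \<tau>) ** matrix_inv (mat 1 + sm v \<tau>) = A' ** (mat 1 + sm v \<tau>) ** matrix_inv (mat 1 + sm v \<tau>)"
      using that by simp
    then show ?thesis
      by (simp add: matrix_mul_assoc[symmetric] matrix_inv_right[OF inv[OF that(1)]])
  qed
  have num': "(mat 1 + sm v \<tau>) ** rotation_curve \<Delta> \<tau> v = \<tau> - mat (v / of_nat \<Delta>)" if "v \<in> U" for v
  proof (rule cancel[OF that])
    show "(mat 1 + sm v \<tau>) ** rotation_curve \<Delta> \<tau> v ** (mat 1 + sm v \<tau>) = (\<tau> - mat (v / of_nat \<Delta>)) ** (mat 1 + sm v \<tau>)"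
      by (simp only: matrix_mul_assoc[symmetric] num[OF that]) (simp add: matrix_ring_simps sm_mat algebra_simps)
  qed
  have tr: "transpose (mat 1 + sm v \<tau>) = mat 1 + sm v \<tau>" for v
    by (simp add: transpose_simps sym)
  have in_H: "rotation_curve \<Delta> \<tau> v \<in> siegel_space" if v: "v \<in> U" for v
    unfolding siegel_space_iff
  proof (intro conjI allI impI)
    have tr_num: "transpose (rotation_curve \<Delta> \<tau> v) ** (mat 1 + sm v \<tau>) = \<tau> - mat (v / of_nat \<Delta>)"
      using arg_cong[OF num'[OF v], of transpose] by (simp add: matrix_transpose_mul tr) (simp add: transpose_simps sym)
    show "transpose (rotation_curve \<Delta> \<tau> v) = rotation_curve \<Delta> \<tau> v"
      by (rule cancel[OF v]) (simp only: num[OF v] tr_num)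
    fix u :: "(complex, 'g) vec" assume "u \<noteq> 0"
    define w where "w = matrix_inv (mat 1 + sm v \<tau>) *v u"
    have u: "(mat 1 + sm v \<tau>) *v w = u"
      by (simp add: w_def matrix_vector_mul_assoc matrix_inv_right[OF inv[OF v]])
    then have "w \<noteq> 0"
      using \<open>u \<noteq> 0\<close> by auto
    moreover have "rotation_curve \<Delta> \<tau> v *v u = (\<tau> - mat (v / of_nat \<Delta>)) *v w"
      by (simp add: rotation_curve_def w_def matrix_vector_mul_assoc)
    ultimately show "0 < im_form (rotation_curve \<Delta> \<tau> v) u"
      using pos[OF v, of w] by (simp add: im_form_def u)
  qed
  have in_fix: "rotation_curve \<Delta> \<tau> v \<in> fixset (cm_matrix \<Delta> r)" if v: "v \<in> U" for v
  proof -
    let ?E = "cmat (sig_matrix r) :: 'g cmatrix" and ?R = "rotation_curve \<Delta> \<tau> v" and ?D = "mat 1 + sm v \<tau>"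
    have nz: "(of_nat \<Delta> :: complex) \<noteq> 0"
      using \<Delta> by simp
    have "?D ** (?R ** ?E ** ?R) ** ?D = (?D ** ?R) ** ?E ** (?R ** ?D)"
      by (simp add: matrix_mul_assoc)
    also have "\<dots> = (\<tau> - mat (v / of_nat \<Delta>)) ** ?E ** (\<tau> - mat (v / of_nat \<Delta>))"
      by (simp only: num[OF v] num'[OF v])
    also have "\<dots> = ?D ** sm (- 1 / of_nat \<Delta>) ?E ** ?D"
      using nz by (simp add: matrix_ring_simps eq) (simp add: matrix_eq_iff field_simps power2_eq_square)
    finally have "?D ** (?R ** ?E ** ?R) = ?D ** sm (- 1 / of_nat \<Delta>) ?E"
      by (rule cancel[OF v])
    then have "matrix_inv ?D ** (?D ** (?R ** ?E ** ?R)) = matrix_inv ?D ** (?D ** sm (- 1 / of_nat \<Delta>) ?E)"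
      by simp
    then have "?R ** ?E ** ?R = sm (- 1 / of_nat \<Delta>) ?E"
      by (simp only: matrix_mul_assoc matrix_inv_left[OF inv[OF v]] matrix_mul_lid)
    then show ?thesis
      using fixset_cm_matrix[OF \<Delta>] in_H[OF v] by blast
  qed
  show ?thesis
  proof (rule that)
    show "open U"
      unfolding U_def by (rule open_halfspace_Im_lt)
    show "connected U"
      unfolding U_def by (intro convex_connected convex_halfspace_Im_lt)
    show zero: "0 \<in> U" and end_pt: "- \<i> * of_real (sqrt (real \<Delta>)) \<in> U"
      using \<open>0 < K\<close> c(1) by (auto simp: U_def intro: le_less_trans[of _ 0])
    show "holomorphic_entries (rotation_curve \<Delta> \<tau>) U"
      unfolding rotation_curve_def
      by (intro holomorphic_entries_mult holomorphic_entries_diff holomorphic_entries_const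
          holomorphic_entries_mat holomorphic_entries_inverse holomorphic_entries_add
          holomorphic_entries_sm inv holomorphic_intros) (use \<Delta> in auto)
    show "rotation_curve \<Delta> \<tau> ` U \<subseteq> fixset (cm_matrix \<Delta> r)"
      using in_fix by blast
    show "rotation_curve \<Delta> \<tau> 0 = \<tau>"
      using num[OF zero] by simp
    let ?v = "- \<i> * of_real (sqrt (real \<Delta>)) :: complex"
    have s: "of_real (sqrt (real \<Delta>)) * of_real (sqrt (real \<Delta>)) = (of_nat \<Delta> :: complex)"
      using of_real_mult[of "sqrt (real \<Delta>)" "sqrt (real \<Delta>)", where 'a = complex] by simp
    have s0: "of_real (sqrt (real \<Delta>)) \<noteq> (0 :: complex)"
      using \<Delta> by simp
    have "?v / of_nat \<Delta> = - \<i> / of_real (sqrt (real \<Delta>))"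
      unfolding s[symmetric] using s0 by simp
    then have bp: "base_point \<Delta> ** (mat 1 + sm ?v \<tau>) = \<tau> - mat (?v / of_nat \<Delta>)"
      using s0 by (simp add: base_point_def mat_mult_eq_sm sm_add sm_sm sm_mat)
        (simp add: matrix_eq_iff mat_def)
    show "rotation_curve \<Delta> \<tau> ?v = base_point \<Delta>"
      by (rule cancel[OF end_pt]) (simp only: num[OF end_pt] bp)
  qed
qed

text \<open>A unitary similitude carries \<open>\<tau>\<close> to the base point, and a rotation
  curve joins any point of the domain to the base point.\<close>

lemma unitary_domain_curve:
  fixes \<tau> \<sigma> :: "'g::{finite,linorder} cmatrix"
  assumes \<Delta>: "0 < \<Delta>" and "\<tau> \<in> unitary_domain \<Delta> r" "\<sigma> \<in> unitary_domain \<Delta> r"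
  obtains \<phi> U z0 z1 where "open U" "connected U" "holomorphic_entries \<phi> U"
    "\<phi> ` U \<subseteq> unitary_domain \<Delta> r" "z0 \<in> U" "z1 \<in> U" "\<phi> z0 = \<tau>" "\<phi> z1 = \<sigma>"
proof -
  let ?D = "unitary_domain \<Delta> r :: 'g cmatrix set"
  note D = unitary_domain_eq_fixset[OF \<Delta>]
  obtain h k where hk: "(h, k) \<in> GU_pos \<Delta> r" and \<tau>: "\<tau> = siegel_action (alpha_embedding \<Delta> r (h, k)) (base_point \<Delta>)"
    using assms(2) by (auto simp: unitary_domain_def)
  let ?M = "alpha_embedding \<Delta> r (h, k)"
  obtain l where l: "0 < l" and M: "similitude l ?M"
    using hk unfolding GU_pos_iff[OF \<Delta>] by blast
  have M': "similitude l (sadj ?M)"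
    using similitude_sadj[OF M] l by simp
  have MJ: "?M ** cm_matrix \<Delta> r ** sadj ?M = sm l (cm_matrix \<Delta> r)"
    using M by (simp add: alpha_embedding_commutes matrix_mul_assoc[symmetric]
        similitude_iff_mult_sadj mult_mat_eq_sm)
  have act: "siegel_action ?M x \<in> ?D \<longleftrightarrow> x \<in> ?D" if "x \<in> siegel_space" for x
    using fixset_conj[OF M l that, of "cm_matrix \<Delta> r"] l by (simp add: MJ fixset_sm D)
  have "\<sigma> \<in> siegel_space"
    using assms(3) by (simp add: D fixset_def)
  define \<sigma>' where "\<sigma>' = siegel_action (sadj ?M) \<sigma>"
  have \<sigma>'H: "\<sigma>' \<in> siegel_space" and M\<sigma>: "siegel_action ?M \<sigma>' = \<sigma>"
    using siegel_action_in[OF M' l \<open>\<sigma> \<in> siegel_space\<close>] siegel_action_sadj[OF M l \<open>\<sigma> \<in> siegel_space\<close>]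
    by (auto simp: \<sigma>'_def)
  then have "\<sigma>' \<in> fixset (cm_matrix \<Delta> r)"
    using act[OF \<sigma>'H] assms(3) by (simp add: D)
  then obtain U where U: "open U" "connected U" "0 \<in> U" "- \<i> * of_real (sqrt (real \<Delta>)) \<in> U"
    "holomorphic_entries (rotation_curve \<Delta> \<sigma>') U"
    "rotation_curve \<Delta> \<sigma>' ` U \<subseteq> fixset (cm_matrix \<Delta> r)"
    "rotation_curve \<Delta> \<sigma>' 0 = \<sigma>'" "rotation_curve \<Delta> \<sigma>' (- \<i> * of_real (sqrt (real \<Delta>))) = base_point \<Delta>"
    using rotation_curve_properties[OF \<Delta>] by metis
  have H: "rotation_curve \<Delta> \<sigma>' ` U \<subseteq> siegel_space"
    using U(6) by (auto simp: fixset_def)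
  show ?thesis
  proof (rule that[of U "\<lambda>z. siegel_action ?M (rotation_curve \<Delta> \<sigma>' z)"])
    show "holomorphic_entries (\<lambda>z. siegel_action ?M (rotation_curve \<Delta> \<sigma>' z)) U"
      using holomorphic_entries_action[OF U(5) H M] l by simp
    show "(\<lambda>z. siegel_action ?M (rotation_curve \<Delta> \<sigma>' z)) ` U \<subseteq> ?D"
      using act H U(6) by (auto simp: D)
    show "siegel_action ?M (rotation_curve \<Delta> \<sigma>' (- \<i> * of_real (sqrt (real \<Delta>)))) = \<tau>"
      by (simp only: U(8) \<tau>)
    show "siegel_action ?M (rotation_curve \<Delta> \<sigma>' 0) = \<sigma>"
      by (simp only: U(7) M\<sigma>)
  qed (use U in auto)
qed

text \<open>A subset of the unitary domain is curve-closed if every holomorphic curve in the domain lies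
  in it or meets it in isolated points. This is the form in which analyticity enters below.\<close>

definition curve_closed :: "nat \<Rightarrow> nat \<Rightarrow> 'g::{finite,linorder} cmatrix set \<Rightarrow> bool" where
  "curve_closed \<Delta> r S \<longleftrightarrow> (\<forall>U \<phi> z. open U \<longrightarrow> connected U \<longrightarrow> holomorphic_entries \<phi> U \<longrightarrow>
     \<phi> ` U \<subseteq> unitary_domain \<Delta> r \<longrightarrow> z \<in> U \<longrightarrow> z islimpt {u \<in> U. \<phi> u \<in> S} \<longrightarrow> \<phi> ` U \<subseteq> S)"

lemma unitary_domain_subset: "0 < \<Delta> \<Longrightarrow> unitary_domain \<Delta> r \<subseteq> siegel_space"
  by (auto simp: unitary_domain_eq_fixset fixset_def)

lemma analytic_subset_curve_closed:
  assumes "0 < \<Delta>" "analytic_subset scale_matrix siegel_space S"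
  shows "curve_closed \<Delta> r S"
  unfolding curve_closed_def
proof (intro allI impI)
  fix U z and \<phi> :: "complex \<Rightarrow> 'a cmatrix"
  assume *: "open U" "connected U" "holomorphic_entries \<phi> U" "\<phi> ` U \<subseteq> unitary_domain \<Delta> r"
    "z \<in> U" "z islimpt {u \<in> U. \<phi> u \<in> S}"
  show "\<phi> ` U \<subseteq> S"
    using curve_in_analytic_subset[OF holomorphic_curve_matrix[OF *(3,1,2)] _ assms(2) *(5,6)] *(4)
      unitary_domain_subset[OF assms(1)] by blast
qed

lemma analytic_subset_pair_curve_closed:
  assumes "0 < \<Delta>" "analytic_subset scale_pair (siegel_space \<times> siegel_space) S"
    "similitude k M" "0 < k"
  shows "curve_closed \<Delta> r {\<tau> \<in> siegel_space. (\<tau>, siegel_action M \<tau>) \<in> S}"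
  unfolding curve_closed_def
proof (intro allI impI)
  fix U z and \<phi> :: "complex \<Rightarrow> 'a cmatrix"
  let ?S = "{\<tau> \<in> siegel_space. (\<tau>, siegel_action M \<tau>) \<in> S}"
  assume *: "open U" "connected U" "holomorphic_entries \<phi> U" "\<phi> ` U \<subseteq> unitary_domain \<Delta> r"
    "z \<in> U" "z islimpt {u \<in> U. \<phi> u \<in> ?S}"
  have H: "\<phi> ` U \<subseteq> siegel_space"
    using *(4) unitary_domain_subset[OF assms(1)] by blast
  have "holomorphic_curve scale_pair (\<lambda>z. (\<phi> z, siegel_action M (\<phi> z))) U"
    using holomorphic_curve_pair[OF *(3) holomorphic_entries_action[OF *(3) H assms(3)] *(1,2)] assms(4) by simp
  moreover have "(\<lambda>z. (\<phi> z, siegel_action M (\<phi> z))) ` U \<subseteq> siegel_space \<times> siegel_space"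
    using H siegel_action_in[OF assms(3,4)] by auto
  moreover have "z islimpt {u \<in> U. (\<phi> u, siegel_action M (\<phi> u)) \<in> S}"
    by (rule islimpt_subset[OF *(6)]) auto
  ultimately have "(\<lambda>z. (\<phi> z, siegel_action M (\<phi> z))) ` U \<subseteq> S"
    using curve_in_analytic_subset[OF _ _ assms(2) *(5)] by blast
  then show "\<phi> ` U \<subseteq> ?S"
    using H by blast
qed

lemma curve_avoids_finite:
  assumes \<phi>: "open U" "connected U" "holomorphic_entries \<phi> U" "\<phi> ` U \<subseteq> unitary_domain \<Delta> r"
    and "finite \<S>" "\<And>S. S \<in> \<S> \<Longrightarrow> curve_closed \<Delta> r S" "\<And>S. S \<in> \<S> \<Longrightarrow> \<not> \<phi> ` U \<subseteq> S"
    and "z \<in> U"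
  shows "\<not> z islimpt {u \<in> U. \<phi> u \<in> \<Union>\<S>}"
proof -
  have "\<not> z islimpt (\<Union>S\<in>\<S>. {u \<in> U. \<phi> u \<in> S})"
    unfolding islimpt_finite_union_iff[OF assms(5)]
  proof
    assume "\<exists>S\<in>\<S>. z islimpt {u \<in> U. \<phi> u \<in> S}"
    then obtain S where S: "S \<in> \<S>" "z islimpt {u \<in> U. \<phi> u \<in> S}" by blast
    have "\<phi> ` U \<subseteq> S"
      by (rule assms(6)[OF S(1), unfolded curve_closed_def, rule_format, OF \<phi> assms(8) S(2)])
    then show False
      using assms(7) S(1) by blast
  qed
  moreover have "(\<Union>S\<in>\<S>. {u \<in> U. \<phi> u \<in> S}) = {u \<in> U. \<phi> u \<in> \<Union>\<S>}"
    by auto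
  ultimately show ?thesis by simp
qed

text \<open>If \<open>\<tau>\<close> lies outside finitely many sets and \<open>\<sigma>\<close>
  outside one more, then a curve through \<open>\<tau>\<close> and \<open>\<sigma>\<close> meets
  each of these sets in isolated points only.\<close>

lemma unitary_domain_not_finite_union:
  fixes \<S> :: "'g::{finite,linorder} cmatrix set set"
  assumes "0 < \<Delta>" "finite \<S>" "\<And>S. S \<in> \<S> \<Longrightarrow> curve_closed \<Delta> r S"
    "\<And>S. S \<in> \<S> \<Longrightarrow> \<not> unitary_domain \<Delta> r \<subseteq> S"
  shows "\<exists>\<tau> \<in> unitary_domain \<Delta> r. \<tau> \<notin> \<Union>\<S>"
  using assms(2-)
proof (induction \<S> rule: finite_induct)
  case empty
  have "base_point \<Delta> \<in> (unitary_domain \<Delta> r :: 'g cmatrix set)"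
    using base_point_fixed[OF assms(1)] by (simp add: unitary_domain_eq_fixset[OF assms(1)])
  then show ?case by auto
next
  case (insert S \<S>)
  obtain \<tau> where \<tau>: "\<tau> \<in> unitary_domain \<Delta> r" "\<tau> \<notin> \<Union>\<S>"
    using insert by blast
  obtain \<sigma> where \<sigma>: "\<sigma> \<in> unitary_domain \<Delta> r" "\<sigma> \<notin> S"
    using insert.prems(2)[of S] by blast
  obtain \<phi> U z0 z1 where \<phi>: "open U" "connected U" "holomorphic_entries \<phi> U"
    "\<phi> ` U \<subseteq> unitary_domain \<Delta> r" "z0 \<in> U" "z1 \<in> U" "\<phi> z0 = \<tau>" "\<phi> z1 = \<sigma>"
    using unitary_domain_curve[OF assms(1) \<tau>(1) \<sigma>(1)] by metis
  have "\<not> z0 islimpt {u \<in> U. \<phi> u \<in> \<Union>(insert S \<S>)}"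
  proof (rule curve_avoids_finite[OF \<phi>(1-4)])
    show "\<not> \<phi> ` U \<subseteq> S'" if "S' \<in> insert S \<S>" for S'
      using that \<phi>(5-8) \<tau>(2) \<sigma>(2) by blast
  qed (use insert \<phi>(5) in auto)
  moreover have "z0 islimpt U"
    using \<phi>(1,5) by (intro open_imp_islimpt) auto
  ultimately have "\<not> U \<subseteq> {u \<in> U. \<phi> u \<in> \<Union>(insert S \<S>)}"
    using islimpt_subset by blast
  then show ?case
    using \<phi>(4) by blast
qed

text \<open>Near \<open>\<tau>0\<close> only finitely many members matter. If all members were
  proper, some \<open>\<sigma>\<close> would avoid these finitely many, and a curve from
  \<open>\<tau>0\<close> to \<open>\<sigma>\<close> would contain points near \<open>\<tau>0\<close>
  outside all members.\<close>

lemma unitary_domain_locally_finite_cover: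
  fixes \<S> :: "'g::{finite,linorder} cmatrix set set"
  assumes "0 < \<Delta>" "\<And>S. S \<in> \<S> \<Longrightarrow> curve_closed \<Delta> r S"
    "\<tau>0 \<in> unitary_domain \<Delta> r" "open W" "\<tau>0 \<in> W" "finite {S \<in> \<S>. S \<inter> W \<noteq> {}}"
    and cover: "unitary_domain \<Delta> r \<subseteq> \<Union>\<S>"
  obtains S where "S \<in> \<S>" "unitary_domain \<Delta> r \<subseteq> S"
proof (rule ccontr)
  assume "\<not> thesis"
  then have proper: "\<And>S. S \<in> \<S> \<Longrightarrow> \<not> unitary_domain \<Delta> r \<subseteq> S"
    using that by blast
  let ?T = "{S \<in> \<S>. S \<inter> W \<noteq> {}}"
  obtain \<sigma> where \<sigma>: "\<sigma> \<in> unitary_domain \<Delta> r" "\<sigma> \<notin> \<Union>?T"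
    using unitary_domain_not_finite_union[OF assms(1,6)] assms(2) proper by (metis (no_types, lifting) mem_Collect_eq)
  obtain \<phi> U z0 z1 where \<phi>: "open U" "connected U" "holomorphic_entries \<phi> U"
    "\<phi> ` U \<subseteq> unitary_domain \<Delta> r" "z0 \<in> U" "z1 \<in> U" "\<phi> z0 = \<tau>0" "\<phi> z1 = \<sigma>"
    using unitary_domain_curve[OF assms(1,3) \<sigma>(1)] by metis
  have "\<not> z0 islimpt {u \<in> U. \<phi> u \<in> \<Union>?T}"
  proof (rule curve_avoids_finite[OF \<phi>(1-4)])
    show "\<not> \<phi> ` U \<subseteq> S'" if "S' \<in> ?T" for S'
      using that \<phi>(6,8) \<sigma>(2) by blast
  qed (use assms(2,6) \<phi>(5) in auto)
  moreover have "U \<inter> \<phi> -` W \<subseteq> {u \<in> U. \<phi> u \<in> \<Union>?T}"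
    using cover \<phi>(4) by blast
  moreover have "z0 islimpt (U \<inter> \<phi> -` W)"
  proof (rule open_imp_islimpt)
    have "continuous_on U \<phi>"
      using holomorphic_curve_matrix[OF \<phi>(3,1,2)] unfolding holomorphic_curve_def
      by (meson continuous_at_imp_continuous_on has_derivative_continuous)
    then show "open (U \<inter> \<phi> -` W)"
      using continuous_open_preimage \<phi>(1) assms(4) by blast
  qed (use \<phi>(5,7) assms(5) in auto)
  ultimately show False
    using islimpt_subset by blast
qed

section \<open>Rigidity of the complex multiplication\<close>

text \<open>A real symmetric matrix with \<open>Y E Y = E\<close> that rotates hyperbolically in the plane of a positive
  index \<open>i\<close> and a negative index \<open>j\<close>; \<open>5/4\<close> and \<open>3/4\<close> are a rational \<open>cosh\<close> and \<open>sinh\<close>.\<close>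

definition boost :: "'g::finite \<Rightarrow> 'g \<Rightarrow> 'g rmatrix" where
  "boost i j = (\<chi> a b. if a = b then (if a = i \<or> a = j then 5/4 else 1)
     else if a = i \<and> b = j \<or> a = j \<and> b = i then 3/4 else 0)"

lemma boost_transpose: "transpose (boost i j) = boost i j"
  by (auto simp: matrix_eq_iff transpose_def boost_def)

lemma sum_mult_delta: "(\<Sum>k\<in>UNIV. f k * (if k = i then c else 0)) = f (i :: 'i::finite) * (c :: real)"
  by (simp add: if_distrib cong: if_cong)

lemma mult_boost:
  assumes "i \<noteq> j"
  shows "(M ** boost i j) $ a $ b =
    (if b = i then 5/4 * M $ a $ i + 3/4 * M $ a $ j
     else if b = j then 3/4 * M $ a $ i + 5/4 * M $ a $ j else M $ a $ b)"
proof -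
  have col: "b = i \<Longrightarrow> boost i j $ k $ b = (if k = i then 5/4 else 0) + (if k = j then 3/4 else 0)"
    "b = j \<Longrightarrow> boost i j $ k $ b = (if k = i then 3/4 else 0) + (if k = j then 5/4 else 0)"
    "b \<noteq> i \<Longrightarrow> b \<noteq> j \<Longrightarrow> boost i j $ k $ b = (if k = b then 1 else 0)" for k b
    using assms by (auto simp: boost_def)
  have "(M ** boost i j) $ a $ b = (\<Sum>k\<in>UNIV. M $ a $ k * boost i j $ k $ b)"
    by (simp add: matrix_matrix_mult_def)
  moreover consider "b = i" | "b = j" | "b \<noteq> i" "b \<noteq> j"
    by blast
  then have "(\<Sum>k\<in>UNIV. M $ a $ k * boost i j $ k $ b) =
    (if b = i then 5/4 * M $ a $ i + 3/4 * M $ a $ j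
     else if b = j then 3/4 * M $ a $ i + 5/4 * M $ a $ j else M $ a $ b)"
    by cases (use assms in \<open>simp_all add: col distrib_left sum.distrib sum_mult_delta\<close>)
  ultimately show ?thesis by simp
qed

lemma boost_mult:
  assumes "i \<noteq> j"
  shows "(boost i j ** M) $ a $ b =
    (if a = i then 5/4 * M $ i $ b + 3/4 * M $ j $ b
     else if a = j then 3/4 * M $ i $ b + 5/4 * M $ j $ b else M $ a $ b)"
proof -
  have "(boost i j ** M) $ a $ b = transpose (transpose M ** boost i j) $ a $ b"
    by (simp add: matrix_transpose_mul boost_transpose)
  also have "\<dots> = (transpose M ** boost i j) $ b $ a"
    by (simp add: transpose_def)
  finally show ?thesis
    by (simp add: mult_boost[OF assms]) (simp add: transpose_def)
qed

lemma boost_posdef: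
  assumes "i \<noteq> j" "x \<noteq> 0"
  shows "0 < x \<bullet> (boost i j *v x)"
proof -
  have row: "(boost i j *v x) $ a = x $ a + (if a = i then x $ i / 4 + 3/4 * x $ j else 0) +
     (if a = j then 3/4 * x $ i + x $ j / 4 else 0)" for a
  proof -
    have "(boost i j *v x) $ a = (boost i j ** (\<chi> a b. x $ a)) $ a $ undefined"
      by (simp add: matrix_vector_mult_def matrix_matrix_mult_def)
    then show ?thesis
      using assms(1) by (cases "a = i"; cases "a = j") (simp_all add: boost_mult)
  qed
  have "x \<bullet> (boost i j *v x) = x \<bullet> x + (x $ i)\<^sup>2 / 4 + 3/2 * (x $ i * x $ j) + (x $ j)\<^sup>2 / 4"
    unfolding inner_vec_def row
    by (simp add: distrib_left sum.distrib sum_mult_delta power2_eq_square)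
  moreover have "(x $ i)\<^sup>2 + (x $ j)\<^sup>2 \<le> x \<bullet> x"
  proof -
    have "(\<Sum>a\<in>{i, j}. (x $ a)\<^sup>2) \<le> (\<Sum>a\<in>UNIV. (x $ a)\<^sup>2)"
      by (rule sum_mono2) auto
    then show ?thesis
      using assms(1) by (simp add: inner_vec_def power2_eq_square)
  qed
  moreover have "0 \<le> (x $ i + x $ j)\<^sup>2"
    by simp
  moreover have "0 < x \<bullet> x"
    using assms(2) by simp
  moreover have "(x $ i + x $ j)\<^sup>2 = (x $ i)\<^sup>2 + 2 * (x $ i * x $ j) + (x $ j)\<^sup>2"
    by (simp add: power2_eq_square algebra_simps)
  ultimately show ?thesis
    by linarith
qed

lemma boost_in_unitary_domain:
  fixes i j :: "'g::{finite,linorder}"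
  assumes "0 < \<Delta>" "i \<noteq> j" and i: "sig_matrix r $ i $ i = (1 :: real)" and j: "sig_matrix r $ j $ j = (- 1 :: real)"
  shows "sm (\<i> / of_real (sqrt (real \<Delta>))) (cmat (boost i j)) \<in> unitary_domain \<Delta> r"
proof -
  let ?c = "\<i> / of_real (sqrt (real \<Delta>)) :: complex"
  let ?Y = "boost i j" and ?E = "sig_matrix r :: 'g rmatrix"
  have off: "a \<noteq> b \<Longrightarrow> ?E $ a $ b = 0" for a b
    by (simp add: sig_matrix_def)
  have "(?Y ** ?E ** ?Y) $ a $ b = ?E $ a $ b" for a b
    using assms(2) i j by (auto simp: mult_boost boost_mult off)
  then have YEY: "?Y ** ?E ** ?Y = ?E"
    by (simp add: matrix_eq_iff)
  have "of_real (sqrt (real \<Delta>)) * of_real (sqrt (real \<Delta>)) = (of_nat \<Delta> :: complex)"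
    using of_real_mult[of "sqrt (real \<Delta>)" "sqrt (real \<Delta>)", where 'a = complex] by simp
  then have cc: "?c * ?c = - 1 / of_nat \<Delta>"
    by simp
  have "map_matrix Im (sm ?c (cmat ?Y)) = sm (1 / sqrt (real \<Delta>)) ?Y"
    by (simp add: matrix_eq_iff Im_divide_of_real)
  moreover have "sm (1 / sqrt (real \<Delta>)) ?Y *v x = (1 / sqrt (real \<Delta>)) *\<^sub>R (?Y *v x)" for x
    by (simp add: vec_eq_iff matrix_vector_mult_def sum_distrib_left mult.assoc)
  moreover have "transpose (sm ?c (cmat ?Y)) = sm ?c (cmat ?Y)"
    by (simp only: transpose_sm cmat_transpose[symmetric] boost_transpose)
  ultimately have "sm ?c (cmat ?Y) \<in> siegel_space"
    using assms(1) boost_posdef[OF assms(2)] by (simp add: siegel_space_def)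
  moreover have "sm ?c (cmat ?Y) ** cmat ?E ** sm ?c (cmat ?Y) = sm (?c * ?c) (cmat (?Y ** ?E ** ?Y))"
    by (simp add: sm_mult_left sm_mult_right sm_sm cmat_mult)
  ultimately show ?thesis
    unfolding unitary_domain_eq_fixset[OF assms(1)] fixset_cm_matrix[OF assms(1)] by (simp only: YEY cc)
qed

lemma fixset_imaginary_point:
  assumes "0 < d" "sm (\<i> / of_real d) (cmat Y) \<in> fixset (block_matrix A B C D)"
  shows "A ** Y = Y ** D" "B = sm (- 1 / (d * d)) (Y ** C ** Y)"
proof -
  let ?c = "\<i> / of_real d :: complex"
  have "cmat A ** sm ?c (cmat Y) + cmat B = sm ?c (cmat Y) ** (cmat C ** sm ?c (cmat Y) + cmat D)"
    using assms(2) by (simp add: fixset_iff_equation automorphy_def)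
  then have "cmat B + sm ?c (cmat (A ** Y)) = cmat (sm (- 1 / (d * d)) (Y ** C ** Y)) + sm ?c (cmat (Y ** D))"
    by (simp add: matrix_ring_simps cmat_simps add.commute)
  then show "A ** Y = Y ** D" "B = sm (- 1 / (d * d)) (Y ** C ** Y)"
    using assms(1) by (simp_all add: matrix_eq_iff complex_eq_iff Re_divide_of_real Im_divide_of_real)
qed

lemma sig_matrix_entries:
  fixes a :: "'g::{finite,linorder}"
  shows "sig_matrix r $ a $ a = (1 :: real) \<or> sig_matrix r $ a $ a = (- 1 :: real)"
    and "a \<noteq> b \<Longrightarrow> sig_matrix r $ a $ b = (0 :: real)"
  by (simp_all add: sig_matrix_def)

lemma sig_matrix_both_signs:
  assumes "0 < r" "r < CARD('g::{finite,linorder})"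
  obtains i j :: "'g::{finite,linorder}" where "sig_matrix r $ i $ i = (1 :: real)" "sig_matrix r $ j $ j = (- 1 :: real)"
proof -
  define i where "i = Min (UNIV :: 'g set)"
  define j where "j = Max (UNIV :: 'g set)"
  have le: "i \<le> k" "k \<le> j" for k
    by (simp_all add: i_def j_def)
  have "{k. k < i} = {}"
    using leD[OF le(1)] by blast
  moreover have "{k. k < j} = UNIV - {j}"
    using le(2) by (auto simp: less_le)
  ultimately have "sig_matrix r $ i $ i = (1 :: real)" "sig_matrix r $ j $ j = (- 1 :: real)"
    using assms by (simp_all add: sig_matrix_def card_Diff_singleton)
  then show ?thesis
    using that by blast
qed

text \<open>The boosts and the base point determine an infinitesimal symplectic symmetry of the domain
  up to scalars. For two indices this is where \<open>sadj J = - J\<close> matters: in signature \<open>(1, 1)\<close> the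
  domain is a modular curve, whose points have more endomorphisms, but only the multiples of
  \<open>\<surd>(-\<Delta>)\<close> among them are antisymmetric for the polarization.\<close>

theorem unitary_domain_rigid:
  fixes J :: "'g::{finite,linorder} bmatrix"
  assumes \<Delta>: "0 < \<Delta>" and r: "0 < r" "r < CARD('g)"
    and skew: "sadj J = - J" and fixed: "unitary_domain \<Delta> r \<subseteq> fixset J"
  obtains b where "J = sm b (cm_matrix \<Delta> r)"
proof -
  let ?E = "sig_matrix r :: 'g rmatrix" and ?d = "sqrt (real \<Delta>)"
  have d: "0 < ?d" "?d * ?d = real \<Delta>"
    using \<Delta> by auto
  obtain A B C D where J: "J = block_matrix A B C D"
    by (rule block_matrix_cases)
  have D: "D = - transpose A" and B: "transpose B = B"
    using skew by (auto simp: J sadj_block block_simps)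
  have points: "A ** Y = Y ** D" "B = sm (- 1 / real \<Delta>) (Y ** C ** Y)"
    if "sm (\<i> / of_real ?d) (cmat Y) \<in> unitary_domain \<Delta> r" for Y
    using fixset_imaginary_point[of ?d Y A B C D] that fixed d unfolding J by auto
  have "base_point \<Delta> = sm (\<i> / of_real ?d) (cmat (mat 1 :: 'g rmatrix))"
    by (simp add: base_point_def cmat_mat sm_mat)
  moreover have "base_point \<Delta> \<in> (unitary_domain \<Delta> r :: 'g cmatrix set)"
    using base_point_fixed[OF \<Delta>] by (simp add: unitary_domain_eq_fixset[OF \<Delta>])
  ultimately have "sm (\<i> / of_real ?d) (cmat (mat 1 :: 'g rmatrix)) \<in> unitary_domain \<Delta> r"
    by (simp only:)
  from points[OF this] have "A = D" and BC: "B = sm (- 1 / real \<Delta>) C"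
    by simp_all
  then have A: "transpose A = - A"
    using D by (metis minus_minus)
  have C: "C = sm (- real \<Delta>) B"
    using \<Delta> by (simp add: BC sm_sm)
  have antisym: "A $ a $ b = - A $ b $ a" and sym: "B $ a $ b = B $ b $ a" for a b
    using arg_cong[OF A, of "\<lambda>M. M $ b $ a"] arg_cong[OF B, of "\<lambda>M. M $ b $ a"] by (simp_all add: transpose_def)
  have comm: "A ** boost i j = boost i j ** A" "B = boost i j ** B ** boost i j" and ne: "i \<noteq> j"
    if ij: "?E $ i $ i = 1" "?E $ j $ j = - 1" for i j
  proof -
    show "i \<noteq> j"
      using ij by auto
    note pt = points[OF boost_in_unitary_domain[OF \<Delta> this ij]]
    show "A ** boost i j = boost i j ** A"
      using pt(1) \<open>A = D\<close> by simp
    have "B = sm (- 1 / real \<Delta>) (boost i j ** sm (- real \<Delta>) B ** boost i j)"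
      using pt(2) by (simp only: C)
    then show "B = boost i j ** B ** boost i j"
      using \<Delta> by (simp add: sm_mult_left sm_mult_right sm_sm)
  qed
  have outside: "A $ k $ i = 0" "A $ k $ j = 0" "B $ k $ i = 0" "B $ k $ j = 0"
    if ij: "?E $ i $ i = 1" "?E $ j $ j = - 1" and k: "k \<noteq> i" "k \<noteq> j" for i j k
  proof -
    note e = mult_boost[OF ne[OF ij]] boost_mult[OF ne[OF ij]]
    have "5/4 * A $ k $ i + 3/4 * A $ k $ j = A $ k $ i" "3/4 * A $ k $ i + 5/4 * A $ k $ j = A $ k $ j"
      using arg_cong[OF comm(1)[OF ij], of "\<lambda>M. M $ k $ i"] arg_cong[OF comm(1)[OF ij], of "\<lambda>M. M $ k $ j"]
        k ne[OF ij] by (auto simp: e)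
    then show "A $ k $ i = 0" "A $ k $ j = 0"
      by linarith+
    have "5/4 * B $ k $ i + 3/4 * B $ k $ j = B $ k $ i" "3/4 * B $ k $ i + 5/4 * B $ k $ j = B $ k $ j"
      using arg_cong[OF comm(2)[OF ij, symmetric], of "\<lambda>M. M $ k $ i"] arg_cong[OF comm(2)[OF ij, symmetric], of "\<lambda>M. M $ k $ j"]
        k ne[OF ij] by (simp_all add: e)
    then show "B $ k $ i = 0" "B $ k $ j = 0"
      by linarith+
  qed
  have inside: "A $ i $ j = 0" "B $ i $ j = 0" "B $ i $ i = - B $ j $ j"
    if ij: "?E $ i $ i = 1" "?E $ j $ j = - 1" for i j
  proof -
    note e = mult_boost[OF ne[OF ij]] boost_mult[OF ne[OF ij]]
    have "5/4 * A $ i $ i + 3/4 * A $ i $ j = 5/4 * A $ i $ i + 3/4 * A $ j $ i"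
      using arg_cong[OF comm(1)[OF ij], of "\<lambda>M. M $ i $ i"] by (simp add: e)
    then show "A $ i $ j = 0"
      using antisym[of i j] by simp
    have "5/4 * (5/4 * B $ i $ i + 3/4 * B $ j $ i) + 3/4 * (5/4 * B $ i $ j + 3/4 * B $ j $ j) = B $ i $ i"
      using arg_cong[OF comm(2)[OF ij, symmetric], of "\<lambda>M. M $ i $ i"] ne[OF ij] by (simp add: e)
    moreover have "3/4 * (5/4 * B $ i $ i + 3/4 * B $ j $ i) + 5/4 * (5/4 * B $ i $ j + 3/4 * B $ j $ j) = B $ i $ j"
      using arg_cong[OF comm(2)[OF ij, symmetric], of "\<lambda>M. M $ i $ j"] ne[OF ij] by (simp add: e)
    ultimately have "9 * B $ i $ i + 30 * B $ i $ j + 9 * B $ j $ j = 0"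
      "15 * B $ i $ i + 18 * B $ i $ j + 15 * B $ j $ j = 0"
      using sym[of j i] by (simp_all add: field_simps)
    then show "B $ i $ j = 0" "B $ i $ i = - B $ j $ j"
      by linarith+
  qed
  obtain i0 j0 :: 'g where 0: "?E $ i0 $ i0 = 1" "?E $ j0 $ j0 = - 1"
    using sig_matrix_both_signs[OF r] by blast
  have off: "A $ a $ b = 0" "B $ a $ b = 0" if "a \<noteq> b" for a b
  proof -
    have "A $ a $ b = 0 \<and> B $ a $ b = 0"
    proof (cases "?E $ b $ b = 1")
      case True
      show ?thesis
      proof (cases "a = j0")
        case a: True
        show ?thesis
          using inside[OF True 0(2)] antisym[of a b] sym[of a b] a by simp
      next
        case False
        then show ?thesis
          using outside[OF True 0(2) that] by simp
      qed
    next
      case False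
      then have b: "?E $ b $ b = - 1"
        using sig_matrix_entries(1)[of r b] by auto
      then show ?thesis
        using inside[OF 0(1) b] outside[OF 0(1) b _ that] by (cases "a = i0") auto
    qed
    then show "A $ a $ b = 0" "B $ a $ b = 0" by auto
  qed
  have "A $ a $ b = 0" for a b
    using off(1)[of a b] antisym[of a a] by (cases "a = b") auto
  then have "A = 0"
    by (simp add: matrix_eq_iff)
  have "B $ a $ b = B $ i0 $ i0 * ?E $ a $ b" for a b
  proof (cases "a = b")
    case True
    consider "?E $ a $ a = 1" | "?E $ a $ a = - 1"
      using sig_matrix_entries(1)[of r a] by auto
    then show ?thesis
    proof cases
      case 1
      then show ?thesis
        using inside(3)[OF 1 0(2)] inside(3)[OF 0] True by simp
    next
      case 2
      then show ?thesis
        using inside(3)[OF 0(1) 2] True by simp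
    qed
  qed (simp add: off sig_matrix_entries)
  then have "B = sm (B $ i0 $ i0) ?E"
    unfolding matrix_eq_iff sm_nth by blast
  then obtain b where b: "B = sm b ?E"
    by blast
  have "J = sm b (cm_matrix \<Delta> r)"
    using \<open>A = 0\<close> \<open>A = D\<close> unfolding J C cm_matrix_def block_simps
    by (simp add: b sm_sm mult.commute)
  then show ?thesis
    by (rule that)
qed

text \<open>In definite signature \<open>E = \<plusminus>1\<close>, so the equation of the domain is \<open>\<tau>\<^sup>2 = - 1 / \<Delta>\<close>. It
  factors through \<open>\<tau> - \<tau>\<^sub>0\<close> and \<open>\<tau> + \<tau>\<^sub>0\<close>, where \<open>\<tau>\<^sub>0\<close> is the base point and the second factor is
  invertible.\<close>

lemma unitary_domain_definite:
  assumes \<Delta>: "0 < \<Delta>" and r: "r = 0 \<or> CARD('g::{finite,linorder}) \<le> r"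
  shows "unitary_domain \<Delta> r = {base_point \<Delta> :: 'g::{finite,linorder} cmatrix}"
proof -
  let ?b = "base_point \<Delta> :: 'g cmatrix"
  have "card {k. k < i} < CARD('g)" for i :: 'g
    by (rule psubset_card_mono) auto
  then have "card {k. k < i} < r \<longleftrightarrow> r \<noteq> 0" for i :: 'g
    using r by (auto intro: less_le_trans)
  then have "cmat (sig_matrix r :: 'g rmatrix) = mat 1 \<or> cmat (sig_matrix r :: 'g rmatrix) = - mat 1"
    by (cases "r = 0") (simp_all add: sig_matrix_def matrix_eq_iff mat_def)
  then have "\<tau> ** cmat (sig_matrix r) ** \<tau> = sm (- 1 / of_nat \<Delta>) (cmat (sig_matrix r)) \<longleftrightarrow>
      \<tau> ** \<tau> = mat (- 1 / of_nat \<Delta>)" for \<tau> :: "'g cmatrix"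
  proof
    assume "cmat (sig_matrix r :: 'g rmatrix) = mat 1"
    then show ?thesis by (simp add: sm_mat)
  next
    assume "cmat (sig_matrix r :: 'g rmatrix) = - mat 1"
    then show ?thesis
      by (simp add: minus_mult_left' minus_mult_right' sm_minus sm_mat)
  qed
  then have sq: "\<tau> \<in> unitary_domain \<Delta> r \<longleftrightarrow> \<tau> \<in> siegel_space \<and> \<tau> ** \<tau> = mat (- 1 / of_nat \<Delta>)" for \<tau> :: "'g cmatrix"
    unfolding unitary_domain_eq_fixset[OF \<Delta>] fixset_cm_matrix[OF \<Delta>] by simp
  have b: "?b \<in> unitary_domain \<Delta> r"
    using base_point_fixed[OF \<Delta>] by (simp add: unitary_domain_eq_fixset[OF \<Delta>])
  have "\<tau> = ?b" if \<tau>: "\<tau> \<in> unitary_domain \<Delta> r" for \<tau>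
  proof -
    have "(\<tau> + ?b) ** (\<tau> - ?b) = \<tau> ** \<tau> - ?b ** ?b"
      by (simp add: base_point_def matrix_ring_simps)
    then have "(\<tau> + ?b) ** (\<tau> - ?b) = 0"
      using \<tau> b by (simp add: sq)
    moreover have "invertible (\<tau> + ?b)"
    proof (rule invertible_if_injective)
      fix w assume w: "(\<tau> + ?b) *v w = 0"
      have "im_form (\<tau> + ?b) w = im_form \<tau> w + im_form ?b w"
        by (simp add: im_form_def matrix_vector_mult_add_rdistrib inner_add_right)
      moreover have "w \<noteq> 0 \<Longrightarrow> 0 < im_form \<tau> w" "w \<noteq> 0 \<Longrightarrow> 0 < im_form ?b w"
        using \<tau> b sq siegel_space_pos by blast+
      moreover have "im_form (\<tau> + ?b) w = 0"
        by (simp add: im_form_def w)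
      ultimately show "w = 0" by force
    qed
    ultimately have "matrix_inv (\<tau> + ?b) ** ((\<tau> + ?b) ** (\<tau> - ?b)) = 0"
      by simp
    then have "\<tau> - ?b = 0"
      by (simp only: matrix_mul_assoc matrix_inv_left[OF \<open>invertible (\<tau> + ?b)\<close>] matrix_mul_lid)
    then show ?thesis by simp
  qed
  then show ?thesis
    using b by blast
qed

section \<open>The arithmetic group and the double coset\<close>

definition multiple_of :: "nat \<Rightarrow> real \<Rightarrow> bool" where
  "multiple_of N x \<longleftrightarrow> (\<exists>m::int. x = of_int (int N * m))"

lemma multiple_of_simps: "multiple_of N 0" "multiple_of N x \<Longrightarrow> multiple_of N (- x)"
  "multiple_of N x \<Longrightarrow> multiple_of N y \<Longrightarrow> multiple_of N (x + y)"
  "multiple_of N x \<Longrightarrow> y \<in> \<int> \<Longrightarrow> multiple_of N (x * y)"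
  "multiple_of N x \<Longrightarrow> y \<in> \<int> \<Longrightarrow> multiple_of N (y * x)"
proof -
  show "multiple_of N 0"
    unfolding multiple_of_def by (rule exI[of _ 0]) simp
  show "multiple_of N (- x)" if x: "multiple_of N x"
  proof -
    obtain m where "x = of_int (int N * m)"
      using x by (auto simp: multiple_of_def)
    then show ?thesis
      unfolding multiple_of_def by (intro exI[of _ "- m"]) simp
  qed
  show "multiple_of N (x + y)" if xy: "multiple_of N x" "multiple_of N y"
  proof -
    obtain m l where "x = of_int (int N * m)" "y = of_int (int N * l)"
      using xy by (auto simp: multiple_of_def)
    then show ?thesis
      unfolding multiple_of_def by (intro exI[of _ "m + l"]) (simp add: algebra_simps)
  qed
  show xy: "multiple_of N (x * y)" if xy: "multiple_of N x" "y \<in> \<int>"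
  proof -
    obtain m l where "x = of_int (int N * m)" "y = of_int l"
      using xy by (auto simp: multiple_of_def elim!: Ints_cases)
    then show ?thesis
      unfolding multiple_of_def by (intro exI[of _ "m * l"]) simp
  qed
  then show "multiple_of N (y * x)" if "multiple_of N x" "y \<in> \<int>"
    using that by (simp add: mult.commute)
qed

lemma multiple_of_sum: "(\<And>i. i \<in> I \<Longrightarrow> multiple_of N (f i)) \<Longrightarrow> multiple_of N (\<Sum>i\<in>I. f i)"
  by (induction I rule: infinite_finite_induct) (auto intro: multiple_of_simps)

lemma multiple_of_coprime:
  assumes "coprime N p" "multiple_of N (real p * x)" "x \<in> \<int>"
  shows "multiple_of N x"
proof -
  obtain m where m: "real p * x = of_int (int N * m)"
    using assms(2) by (auto simp: multiple_of_def)
  obtain k where k: "x = of_int k"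
    using assms(3) by (auto elim: Ints_cases)
  have "of_int (int p * k) = (of_int (int N * m) :: real)"
    using m k by simp
  then have "int p * k = int N * m"
    by (simp only: of_int_eq_iff)
  then have "int N dvd int p * k"
    by simp
  moreover have "coprime (int N) (int p)"
    using assms(1) by simp
  ultimately have "int N dvd k"
    by (simp add: coprime_dvd_mult_right_iff)
  then show ?thesis
    by (auto simp: multiple_of_def k dvd_def)
qed

definition level_matrices :: "nat \<Rightarrow> 'g::finite bmatrix set" where
  "level_matrices N = {M. (\<forall>i j. M $ i $ j \<in> \<int>) \<and> (\<forall>i j. multiple_of N (block_C M $ i $ j))}"

lemma Gamma0_iff: "M \<in> Gamma0 N \<longleftrightarrow> M \<in> level_matrices N \<and> similitude 1 M"
  by (auto simp: Gamma0_def level_matrices_def multiple_of_def similitude_def)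

lemma level_matrices_mult:
  assumes "M \<in> level_matrices N" "M' \<in> level_matrices N"
  shows "M ** M' \<in> level_matrices N"
  unfolding level_matrices_def
proof (intro CollectI conjI allI)
  show "(M ** M') $ i $ j \<in> \<int>" for i j
    using assms by (auto simp: level_matrices_def matrix_matrix_mult_def intro!: Ints_sum Ints_mult)
  fix i j
  have "block_C (M ** M') $ i $ j = (\<Sum>k\<in>UNIV. block_C M $ i $ k * M' $ Inl k $ Inl j) +
      (\<Sum>k\<in>UNIV. M $ Inr i $ Inr k * block_C M' $ k $ j)"
    by (simp add: matrix_matrix_mult_def sum_plus_type)
  also have "multiple_of N \<dots>"
    by (intro multiple_of_simps(3) multiple_of_sum)
      (use assms in \<open>auto simp: level_matrices_def intro: multiple_of_simps(4) multiple_of_simps(5)\<close>)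
  finally show "multiple_of N (block_C (M ** M') $ i $ j)" .
qed

lemma level_matrices_sadj:
  assumes "M \<in> level_matrices N"
  shows "sadj M \<in> level_matrices N"
proof -
  obtain A B C D where M: "M = block_matrix A B C D"
    by (rule block_matrix_cases)
  have "A $ i $ j \<in> \<int>" "B $ i $ j \<in> \<int>" "D $ i $ j \<in> \<int>" "C $ i $ j \<in> \<int>" "multiple_of N (C $ i $ j)" for i j
    using assms by (auto simp: M level_matrices_def all_plus_type)
  then show ?thesis
    by (auto simp: M sadj_block level_matrices_def all_plus_type transpose_def intro: multiple_of_simps)
qed

lemma Gamma0_similitude: "M \<in> Gamma0 N \<Longrightarrow> similitude 1 M"
  by (simp add: Gamma0_iff)

lemma Gamma0_one: "mat 1 \<in> Gamma0 N"
  by (simp add: Gamma0_iff) (auto simp: level_matrices_def mat_def multiple_of_simps)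

lemma Gamma0_mult: "M \<in> Gamma0 N \<Longrightarrow> M' \<in> Gamma0 N \<Longrightarrow> M ** M' \<in> Gamma0 N"
  using similitude_mult[of 1 M 1 M'] by (simp add: Gamma0_iff level_matrices_mult)

lemma Gamma0_sadj: "M \<in> Gamma0 N \<Longrightarrow> sadj M \<in> Gamma0 N"
  by (simp add: Gamma0_iff level_matrices_sadj similitude_sadj)

lemma Gamma0_action_in: "M \<in> Gamma0 N \<Longrightarrow> \<tau> \<in> siegel_space \<Longrightarrow> siegel_action M \<tau> \<in> siegel_space"
  using siegel_action_in[OF Gamma0_similitude] by auto

lemma siegel_pt_eq_iff:
  assumes "\<tau> \<in> siegel_space" "\<sigma> \<in> siegel_space"
  shows "siegel_pt N \<tau> = siegel_pt N \<sigma> \<longleftrightarrow> (\<exists>M \<in> Gamma0 N. \<sigma> = siegel_action M \<tau>)"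
proof
  assume "siegel_pt N \<tau> = siegel_pt N \<sigma>"
  moreover have "\<sigma> \<in> siegel_pt N \<sigma>"
    unfolding siegel_pt_def using Gamma0_one siegel_action_one[OF assms(2)] by force
  ultimately show "\<exists>M \<in> Gamma0 N. \<sigma> = siegel_action M \<tau>"
    unfolding siegel_pt_def by auto
next
  have sub: "siegel_pt N (siegel_action M \<tau>) \<subseteq> siegel_pt N \<tau>" if M: "M \<in> Gamma0 N" and "\<tau> \<in> siegel_space" for M and \<tau> :: "'a cmatrix"
  proof
    fix x assume "x \<in> siegel_pt N (siegel_action M \<tau>)"
    then obtain M' where M': "M' \<in> Gamma0 N" "x = siegel_action M' (siegel_action M \<tau>)"
      by (auto simp: siegel_pt_def)
    then have "x = siegel_action (M' ** M) \<tau>" "M' ** M \<in> Gamma0 N"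
      using siegel_action_mult[OF Gamma0_similitude[OF M'(1)] _ Gamma0_similitude[OF M] _ that(2)]
        Gamma0_mult[OF M'(1) M] by auto
    then show "x \<in> siegel_pt N \<tau>"
      by (auto simp: siegel_pt_def)
  qed
  assume "\<exists>M \<in> Gamma0 N. \<sigma> = siegel_action M \<tau>"
  then obtain M where M: "M \<in> Gamma0 N" "\<sigma> = siegel_action M \<tau>"
    by blast
  have "\<tau> = siegel_action (sadj M) \<sigma>"
    using siegel_action_sadj(1)[OF Gamma0_similitude[OF M(1)] _ assms(1)] M(2) by simp
  then show "siegel_pt N \<tau> = siegel_pt N \<sigma>"
    using sub[OF M(1) assms(1)] sub[OF Gamma0_sadj[OF M(1)] assms(2)] M(2) by auto
qed

lemma siegel_pt_action:
  "M \<in> Gamma0 N \<Longrightarrow> \<tau> \<in> siegel_space \<Longrightarrow> siegel_pt N (siegel_action M \<tau>) = siegel_pt N \<tau>"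
  using siegel_pt_eq_iff[of \<tau> "siegel_action M \<tau>" N] Gamma0_action_in by blast

lemma hecke_coset_level:
  assumes "\<beta> \<in> hecke_coset N p"
  shows "\<beta> \<in> level_matrices N" "similitude (real p) \<beta>"
proof -
  let ?d = "block_matrix (mat 1) 0 0 (mat (real p)) :: 'a bmatrix"
  obtain M M' where M: "M \<in> Gamma0 N" "M' \<in> Gamma0 N" "\<beta> = M ** ?d ** M'"
    using assms by (auto simp: hecke_coset_def)
  have "?d \<in> level_matrices N"
    by (auto simp: level_matrices_def all_plus_type mat_def multiple_of_simps)
  then show "\<beta> \<in> level_matrices N"
    using M by (auto simp: Gamma0_iff intro!: level_matrices_mult)
  have "similitude (real p) ?d"
    unfolding similitude_iff_mult_sadj sadj_block block_simps mat_block[of "real p"]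
    by simp
  then have "similitude (1 * real p * 1) \<beta>"
    unfolding M(3) using M(1,2) by (intro similitude_mult) (auto simp: Gamma0_similitude)
  then show "similitude (real p) \<beta>"
    by simp
qed

lemma hecke_coset_mult:
  assumes "\<beta> \<in> hecke_coset N p" "M \<in> Gamma0 N"
  shows "M ** \<beta> \<in> hecke_coset N p" "\<beta> ** M \<in> hecke_coset N p"
proof -
  obtain L R where L: "L \<in> Gamma0 N" "R \<in> Gamma0 N"
    "\<beta> = L ** block_matrix (mat 1) 0 0 (mat (real p)) ** R"
    using assms by (auto simp: hecke_coset_def)
  have "M ** \<beta> = (M ** L) ** block_matrix (mat 1) 0 0 (mat (real p)) ** R"
    "\<beta> ** M = L ** block_matrix (mat 1) 0 0 (mat (real p)) ** (R ** M)"
    by (simp_all add: L(3) matrix_mul_assoc)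
  then show "M ** \<beta> \<in> hecke_coset N p" "\<beta> ** M \<in> hecke_coset N p"
    using L(1,2) assms(2) Gamma0_mult unfolding hecke_coset_def by blast+
qed

lemma similitude_sm: "similitude k M \<Longrightarrow> similitude (c\<^sup>2 * k) (sm c M)"
  by (simp add: similitude_def transpose_sm sm_mult_left sm_mult_right sm_sm power2_eq_square mult.assoc)

text \<open>Division by \<open>p\<close> preserves the level condition because \<open>p\<close> is prime to \<open>N\<close>.\<close>

lemma level_matrices_divide:
  assumes "coprime N p" "0 < p" "M \<in> level_matrices N" "\<And>i j. sm (1 / real p) M $ i $ j \<in> \<int>"
  shows "sm (1 / real p) M \<in> level_matrices N"
  unfolding level_matrices_def
proof (intro CollectI conjI allI assms(4))
  fix i j
  have "multiple_of N (real p * (block_C (sm (1 / real p) M) $ i $ j))"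
    using assms(2,3) by (simp add: level_matrices_def)
  then show "multiple_of N (block_C (sm (1 / real p) M) $ i $ j)"
    using assms(1,4) multiple_of_coprime by (metis block_nth(3))
qed

text \<open>If \<open>\<beta>' = \<beta> + p E\<close> with \<open>E\<close> integral, then
  \<open>\<beta>' \<beta>\<^sup>-\<^sup>1 = 1 + E sadj \<beta>\<close> is integral, because
  \<open>\<beta> sadj \<beta> = p\<close>. So the cosets \<open>\<Gamma> \<beta>\<close> in the
  double coset are determined by \<open>\<beta>\<close> modulo \<open>p\<close>.\<close>

lemma hecke_coset_congruent:
  assumes p: "0 < p" "coprime N p" and \<beta>: "\<beta> \<in> hecke_coset N p" "\<beta>' \<in> hecke_coset N p"
    and cong: "\<And>i j. \<exists>m::int. \<beta>' $ i $ j - \<beta> $ i $ j = of_int (int p * m)"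
  obtains M where "M \<in> Gamma0 N" "\<beta>' = M ** \<beta>"
proof -
  define M where "M = sm (1 / real p) (\<beta>' ** sadj \<beta>)"
  note sim = hecke_coset_level(2)[OF \<beta>(1)] hecke_coset_level(2)[OF \<beta>(2)]
  define E where "E = sm (1 / real p) (\<beta>' - \<beta>)"
  have "\<beta>' = \<beta> + sm (real p) E"
    using p(1) by (simp add: E_def sm_sm)
  then have "\<beta>' ** sadj \<beta> = mat (real p) + sm (real p) (E ** sadj \<beta>)"
    using sim(1) by (simp add: matrix_ring_simps similitude_iff_mult_sadj)
  then have M: "M = mat 1 + E ** sadj \<beta>"
    using p(1) by (simp add: M_def sm_add sm_sm sm_mat)
  have "E $ i $ j \<in> \<int>" for i j
    using cong[of i j] p(1) by (auto simp: E_def)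
  moreover have "sadj \<beta> $ i $ j \<in> \<int>" for i j
    using level_matrices_sadj[OF hecke_coset_level(1)[OF \<beta>(1)]] by (auto simp: level_matrices_def)
  ultimately have "M $ i $ j \<in> \<int>" for i j
    unfolding M by (auto simp: mat_def matrix_matrix_mult_def intro!: Ints_add Ints_sum Ints_mult)
  then have "M \<in> level_matrices N"
    unfolding M_def
    by (intro level_matrices_divide p level_matrices_mult hecke_coset_level(1)[OF \<beta>(2)]
        level_matrices_sadj hecke_coset_level(1)[OF \<beta>(1)])
  moreover have "similitude ((1 / real p)\<^sup>2 * (real p * real p)) M"
    unfolding M_def using p(1) sim by (intro similitude_sm similitude_mult similitude_sadj) auto
  then have "similitude 1 M"
    using p(1) by (simp add: power2_eq_square)
  moreover have "M ** \<beta> = \<beta>'"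
  proof -
    have "M ** \<beta> = sm (1 / real p) (\<beta>' ** (sadj \<beta> ** \<beta>))"
      by (simp add: M_def sm_mult_left matrix_mul_assoc)
    then show ?thesis
      using p(1) similitude_sadj_mult[OF sim(1)] by (simp add: mult_mat_eq_sm sm_sm)
  qed
  ultimately show ?thesis
    using that[of M] by (simp add: Gamma0_iff)
qed

section \<open>The irreducible components of the restricted correspondence\<close>

text \<open>The branch \<open>\<tau> \<mapsto> \<beta> \<tau>\<close> of the correspondence over
  \<open>V\<close>. These graphs turn out to be its irreducible components.\<close>

definition hecke_graph :: "nat \<Rightarrow> nat \<Rightarrow> nat \<Rightarrow> 'g bmatrix \<Rightarrow>
    ('g::{finite,linorder} cmatrix set \<times> 'g cmatrix set) set" where
  "hecke_graph \<Delta> N r \<beta> = (\<lambda>\<tau>. (siegel_pt N \<tau>, siegel_pt N (siegel_action \<beta> \<tau>))) ` unitary_domain \<Delta> r"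

lemma hecke_action:
  assumes "\<beta> \<in> hecke_coset N p" "0 < p" "\<tau> \<in> siegel_space"
  shows "siegel_action \<beta> \<tau> \<in> siegel_space"
  using siegel_action_in[OF hecke_coset_level(2)[OF assms(1)]] assms(2,3) by simp

lemma hecke_action_mult:
  assumes "\<beta> \<in> hecke_coset N p" "0 < p" "M \<in> Gamma0 N" "\<tau> \<in> siegel_space"
  shows "siegel_action (M ** \<beta>) \<tau> = siegel_action M (siegel_action \<beta> \<tau>)"
    "siegel_action (\<beta> ** M) \<tau> = siegel_action \<beta> (siegel_action M \<tau>)"
  using siegel_action_mult[OF Gamma0_similitude[OF assms(3)] _ hecke_coset_level(2)[OF assms(1)] _ assms(4)]
    siegel_action_mult[OF hecke_coset_level(2)[OF assms(1)] _ Gamma0_similitude[OF assms(3)] _ assms(4)]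
    assms(2) by auto

lemma hecke_graph_left:
  assumes "0 < \<Delta>" "0 < p" "\<beta> \<in> hecke_coset N p" "M \<in> Gamma0 N"
  shows "hecke_graph \<Delta> N r (M ** \<beta>) = hecke_graph \<Delta> N r \<beta>"
  unfolding hecke_graph_def
proof (rule image_cong[OF refl])
  fix \<tau> :: "'a cmatrix" assume "\<tau> \<in> unitary_domain \<Delta> r"
  then have "\<tau> \<in> siegel_space"
    using unitary_domain_subset[OF assms(1)] by blast
  then show "(siegel_pt N \<tau>, siegel_pt N (siegel_action (M ** \<beta>) \<tau>)) = (siegel_pt N \<tau>, siegel_pt N (siegel_action \<beta> \<tau>))"
    using hecke_action_mult(1)[OF assms(3,2,4)] siegel_pt_action[OF assms(4) hecke_action[OF assms(3,2)]] by simp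
qed

lemma hecke_graph_right:
  assumes "0 < \<Delta>" "0 < p" "\<beta> \<in> hecke_coset N p" "M \<in> Gamma0 N"
    and stab: "siegel_action M ` unitary_domain \<Delta> r = unitary_domain \<Delta> r"
  shows "hecke_graph \<Delta> N r (\<beta> ** M) = hecke_graph \<Delta> N r \<beta>"
proof -
  have "hecke_graph \<Delta> N r (\<beta> ** M) =
    (\<lambda>\<tau>. (siegel_pt N (siegel_action M \<tau>), siegel_pt N (siegel_action \<beta> (siegel_action M \<tau>)))) ` unitary_domain \<Delta> r"
    unfolding hecke_graph_def
  proof (rule image_cong[OF refl])
    fix \<tau> :: "'a cmatrix" assume "\<tau> \<in> unitary_domain \<Delta> r"
    then have "\<tau> \<in> siegel_space"
      using unitary_domain_subset[OF assms(1)] by blast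
    then show "(siegel_pt N \<tau>, siegel_pt N (siegel_action (\<beta> ** M) \<tau>)) =
      (siegel_pt N (siegel_action M \<tau>), siegel_pt N (siegel_action \<beta> (siegel_action M \<tau>)))"
      using hecke_action_mult(2)[OF assms(3,2,4)] siegel_pt_action[OF assms(4)] by simp
  qed
  also have "\<dots> = (\<lambda>\<tau>. (siegel_pt N \<tau>, siegel_pt N (siegel_action \<beta> \<tau>))) ` siegel_action M ` unitary_domain \<Delta> r"
    by (simp add: image_image)
  also have "\<dots> = hecke_graph \<Delta> N r \<beta>"
    by (simp only: stab hecke_graph_def)
  finally show ?thesis .
qed

lemma hecke_restriction_eq:
  assumes "0 < \<Delta>" "0 < p"
  shows "hecke_restriction \<Delta> N r p = (\<Union>\<beta>\<in>hecke_coset N p. hecke_graph \<Delta> N r \<beta>)"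
proof (intro equalityI subsetI)
  fix x assume "x \<in> hecke_restriction \<Delta> N r p"
  then obtain \<tau> \<beta> \<tau>0 where x: "x = (siegel_pt N \<tau>, siegel_pt N (siegel_action \<beta> \<tau>))"
    and \<tau>: "\<tau> \<in> siegel_space" and \<beta>: "\<beta> \<in> hecke_coset N p"
    and \<tau>0: "\<tau>0 \<in> unitary_domain \<Delta> r" "siegel_pt N \<tau>0 = siegel_pt N \<tau>"
    by (auto simp: hecke_restriction_def hecke_corr_def unitary_variety_def)
  have H: "\<tau>0 \<in> siegel_space"
    using \<tau>0(1) unitary_domain_subset[OF assms(1)] by blast
  then obtain M where M: "M \<in> Gamma0 N" "\<tau> = siegel_action M \<tau>0"
    using siegel_pt_eq_iff[OF H \<tau>] \<tau>0(2) by blast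
  have "x = (siegel_pt N \<tau>0, siegel_pt N (siegel_action (\<beta> ** M) \<tau>0))"
    using x \<tau>0(2) hecke_action_mult(2)[OF \<beta> assms(2) M(1) H] M(2) by simp
  then show "x \<in> (\<Union>\<beta>\<in>hecke_coset N p. hecke_graph \<Delta> N r \<beta>)"
    using \<tau>0(1) hecke_coset_mult(2)[OF \<beta> M(1)] by (auto simp: hecke_graph_def)
next
  fix x assume "x \<in> (\<Union>\<beta>\<in>hecke_coset N p. hecke_graph \<Delta> N r \<beta>)"
  then show "x \<in> hecke_restriction \<Delta> N r p"
    using unitary_domain_subset[OF assms(1)]
    by (fastforce simp: hecke_graph_def hecke_restriction_def hecke_corr_def unitary_variety_def)
qed

lemma finite_image_factor:
  assumes "finite (g ` S)" "\<And>x y. x \<in> S \<Longrightarrow> y \<in> S \<Longrightarrow> g x = g y \<Longrightarrow> f x = f y"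
  shows "finite (f ` S)"
proof -
  have "f ` S \<subseteq> (\<lambda>z. f (SOME x. x \<in> S \<and> g x = z)) ` g ` S"
  proof
    fix y assume "y \<in> f ` S"
    then obtain x where x: "x \<in> S" "y = f x" by blast
    let ?x = "SOME x'. x' \<in> S \<and> g x' = g x"
    have "?x \<in> S \<and> g ?x = g x"
      by (rule someI[of _ x]) (use x in simp)
    then have "f ?x = y"
      using assms(2) x by blast
    then show "y \<in> (\<lambda>z. f (SOME x. x \<in> S \<and> g x = z)) ` g ` S"
      using x(1) by blast
  qed
  then show ?thesis
    using assms(1) finite_subset by blast
qed

text \<open>The graph depends only on the coset \<open>\<Gamma> \<beta>\<close>, hence only on \<open>\<beta>\<close> modulo \<open>p\<close>.\<close>

lemma finite_hecke_graphs:
  assumes "0 < \<Delta>" "0 < p" "coprime N p"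
  shows "finite (hecke_graph \<Delta> N r ` hecke_coset N p)"
proof (rule finite_image_factor)
  let ?g = "\<lambda>\<beta> :: 'a bmatrix. (\<chi> i j. real_of_int (\<lfloor>\<beta> $ i $ j\<rfloor> mod int p)) :: 'a bmatrix"
  have "?g ` hecke_coset N p \<subseteq> {M. \<forall>i j. M $ i $ j \<in> \<int> \<and> \<bar>M $ i $ j\<bar> \<le> real p}"
    using assms(2) by (auto simp: less_imp_le) (metis less_imp_le of_int_le_iff of_int_of_nat_eq of_nat_0_less_iff pos_mod_bound)
  then show "finite (?g ` hecke_coset N p)"
    using finite_bounded_integral_matrices finite_subset by blast
  fix \<beta> \<beta>' :: "'a bmatrix"
  assume \<beta>: "\<beta> \<in> hecke_coset N p" "\<beta>' \<in> hecke_coset N p" and eq: "?g \<beta> = ?g \<beta>'"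
  have "\<exists>m::int. \<beta>' $ i $ j - \<beta> $ i $ j = of_int (int p * m)" for i j
  proof -
    have "\<beta> $ i $ j \<in> \<int>" "\<beta>' $ i $ j \<in> \<int>"
      using hecke_coset_level(1)[OF \<beta>(1)] hecke_coset_level(1)[OF \<beta>(2)] by (auto simp: level_matrices_def)
    then obtain a b where ab: "\<beta> $ i $ j = of_int a" "\<beta>' $ i $ j = of_int b"
      by (auto elim!: Ints_cases)
    have "?g \<beta> $ i $ j = ?g \<beta>' $ i $ j"
      by (simp only: eq)
    then have "a mod int p = b mod int p"
      by (simp add: ab)
    then obtain m where "b - a = int p * m"
      by (metis dvdE mod_eq_dvd_iff)
    then show ?thesis
      using ab by (metis of_int_diff)
  qed
  then obtain M where "M \<in> Gamma0 N" "\<beta>' = M ** \<beta>"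
    using hecke_coset_congruent[OF assms(2,3) \<beta>] by blast
  then show "hecke_graph \<Delta> N r \<beta> = hecke_graph \<Delta> N r \<beta>'"
    using hecke_graph_left[OF assms(1,2) \<beta>(1)] by metis
qed

lemma Gamma0_integral: "M \<in> Gamma0 N \<Longrightarrow> M \<in> integral_similitudes 1"
  by (auto simp: Gamma0_iff integral_similitudes_def level_matrices_def)

lemma hecke_coset_integral: "\<beta> \<in> hecke_coset N p \<Longrightarrow> \<beta> \<in> integral_similitudes (real p)"
  using hecke_coset_level[of \<beta> N p] by (simp add: integral_similitudes_def level_matrices_def)

lemma integral_similitudes_mult:
  assumes "M \<in> integral_similitudes k" "M' \<in> integral_similitudes l"
  shows "M ** M' \<in> integral_similitudes (k * l)"
  using assms similitude_mult[of k M l M']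
  by (auto simp: integral_similitudes_def matrix_matrix_mult_def intro!: Ints_sum Ints_mult)

lemma integral_similitudes_sadj:
  assumes "M \<in> integral_similitudes k" "k \<noteq> 0"
  shows "sadj M \<in> integral_similitudes k"
proof -
  obtain A B C D where M: "M = block_matrix A B C D"
    by (rule block_matrix_cases)
  show ?thesis
    using assms similitude_sadj[of k M]
    by (auto simp: M sadj_block integral_similitudes_def all_plus_type transpose_def)
qed

lemma cm_matrix_integral: "cm_matrix \<Delta> r \<in> integral_similitudes (real \<Delta>)"
  using cm_matrix_similitude
  by (auto simp: integral_similitudes_def cm_matrix_def all_plus_type sig_matrix_def)

text \<open>The conjugates of \<open>\<surd>(-\<Delta>)\<close>, up to a positive factor that makes them integral; their fixed
  point sets are the translates of the unitary domain.\<close>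

definition cm_conj :: "nat \<Rightarrow> nat \<Rightarrow> 'g::{finite,linorder} bmatrix \<Rightarrow> 'g bmatrix" where
  "cm_conj \<Delta> r M = M ** cm_matrix \<Delta> r ** sadj M"

lemma cm_conj_integral:
  assumes "M \<in> integral_similitudes k" "k \<noteq> 0"
  shows "cm_conj \<Delta> r M \<in> integral_similitudes (k * real \<Delta> * k)"
  unfolding cm_conj_def
  by (intro integral_similitudes_mult integral_similitudes_sadj cm_matrix_integral assms)

lemma fixset_cm_conj:
  assumes "0 < \<Delta>" "similitude k M" "0 < k" "\<tau> \<in> siegel_space"
  shows "siegel_action M \<tau> \<in> fixset (cm_conj \<Delta> r M) \<longleftrightarrow> \<tau> \<in> unitary_domain \<Delta> r"
  unfolding cm_conj_def unitary_domain_eq_fixset[OF assms(1)] by (rule fixset_conj[OF assms(2-4)])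

text \<open>Upstairs the graph is the union of the graphs of \<open>M' \<beta>
  M\<^sup>-\<^sup>1\<close> over the translates of the unitary domain by \<open>M\<close>.\<close>

lemma hecke_graph_preimage:
  assumes "0 < \<Delta>" "0 < p" "\<beta> \<in> hecke_coset N p"
  shows "{(\<tau>, \<sigma>) \<in> siegel_space \<times> siegel_space. (siegel_pt N \<tau>, siegel_pt N \<sigma>) \<in> hecke_graph \<Delta> N r \<beta>} =
    \<Union>{fixset_graph (cm_conj \<Delta> r M) (M' ** \<beta> ** sadj M) | M M'. M \<in> Gamma0 N \<and> M' \<in> Gamma0 N}"
    (is "?L = ?R")
proof -
  have key: "(\<tau>, \<sigma>) \<in> fixset_graph (cm_conj \<Delta> r M) (M' ** \<beta> ** sadj M) \<longleftrightarrow>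
      \<tau> \<in> siegel_space \<and> siegel_action (sadj M) \<tau> \<in> unitary_domain \<Delta> r \<and>
      \<sigma> = siegel_action M' (siegel_action \<beta> (siegel_action (sadj M) \<tau>))"
    if M: "M \<in> Gamma0 N" "M' \<in> Gamma0 N" for \<tau> \<sigma> M M'
  proof (cases "\<tau> \<in> siegel_space")
    case True
    let ?t = "siegel_action (sadj M) \<tau>"
    have H: "?t \<in> siegel_space"
      using Gamma0_action_in[OF Gamma0_sadj[OF M(1)] True] .
    have t: "siegel_action M ?t = \<tau>"
      using siegel_action_sadj(2)[OF Gamma0_similitude[OF M(1)] _ True] by simp
    have "siegel_action (M' ** \<beta> ** sadj M) \<tau> = siegel_action M' (siegel_action \<beta> ?t)"
      using hecke_action_mult(2)[OF hecke_coset_mult(1)[OF assms(3) M(2)] assms(2) Gamma0_sadj[OF M(1)] True]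
        hecke_action_mult(1)[OF assms(3,2) M(2) H] by simp
    moreover have "siegel_action M' (siegel_action \<beta> ?t) \<in> siegel_space"
      using Gamma0_action_in[OF M(2) hecke_action[OF assms(3,2) H]] .
    moreover have "\<tau> \<in> fixset (cm_conj \<Delta> r M) \<longleftrightarrow> ?t \<in> unitary_domain \<Delta> r"
      using fixset_cm_conj[OF assms(1) Gamma0_similitude[OF M(1)] _ H] t by simp
    ultimately show ?thesis
      using True by (auto simp: fixset_graph_def)
  qed (auto simp: fixset_graph_def)
  show ?thesis
  proof (intro equalityI subsetI)
    fix x assume "x \<in> ?L"
    then obtain \<tau> \<sigma> \<tau>1 where x: "x = (\<tau>, \<sigma>)" "\<tau> \<in> siegel_space" "\<sigma> \<in> siegel_space"
      and \<tau>1: "\<tau>1 \<in> unitary_domain \<Delta> r" "siegel_pt N \<tau> = siegel_pt N \<tau>1"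
      "siegel_pt N \<sigma> = siegel_pt N (siegel_action \<beta> \<tau>1)"
      by (auto simp: hecke_graph_def)
    have H: "\<tau>1 \<in> siegel_space"
      using \<tau>1(1) unitary_domain_subset[OF assms(1)] by blast
    obtain M where M: "M \<in> Gamma0 N" "\<tau> = siegel_action M \<tau>1"
      using siegel_pt_eq_iff[OF H x(2)] \<tau>1(2) by metis
    obtain M' where M': "M' \<in> Gamma0 N" "\<sigma> = siegel_action M' (siegel_action \<beta> \<tau>1)"
      using siegel_pt_eq_iff[OF hecke_action[OF assms(3,2) H] x(3)] \<tau>1(3) by metis
    have "siegel_action (sadj M) \<tau> = \<tau>1"
      using siegel_action_sadj(1)[OF Gamma0_similitude[OF M(1)] _ H] M(2) by simp
    then have "x \<in> fixset_graph (cm_conj \<Delta> r M) (M' ** \<beta> ** sadj M)"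
      using key[OF M(1) M'(1)] x \<tau>1(1) M'(2) by simp
    then show "x \<in> ?R"
      using M(1) M'(1) by blast
  next
    fix x assume "x \<in> ?R"
    then obtain M M' where M: "M \<in> Gamma0 N" "M' \<in> Gamma0 N"
      "x \<in> fixset_graph (cm_conj \<Delta> r M) (M' ** \<beta> ** sadj M)"
      by blast
    obtain \<tau> \<sigma> where x: "x = (\<tau>, \<sigma>)"
      by (cases x)
    let ?t = "siegel_action (sadj M) \<tau>"
    have \<tau>: "\<tau> \<in> siegel_space" "?t \<in> unitary_domain \<Delta> r" "\<sigma> = siegel_action M' (siegel_action \<beta> ?t)"
      using key[OF M(1,2)] M(3) x by auto
    have H: "?t \<in> siegel_space"
      using \<tau>(2) unitary_domain_subset[OF assms(1)] by blast
    have "siegel_pt N \<tau> = siegel_pt N ?t"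
      using siegel_pt_action[OF Gamma0_sadj[OF M(1)] \<tau>(1)] by simp
    moreover have "siegel_pt N \<sigma> = siegel_pt N (siegel_action \<beta> ?t)"
      using siegel_pt_action[OF M(2) hecke_action[OF assms(3,2) H]] \<tau>(3) by simp
    moreover have "\<sigma> \<in> siegel_space"
      using \<tau>(3) Gamma0_action_in[OF M(2) hecke_action[OF assms(3,2) H]] by simp
    ultimately show "x \<in> ?L"
      using \<tau> x by (auto simp: hecke_graph_def)
  qed
qed

lemma subvariety2_hecke_graph:
  fixes \<beta> :: "'g::{finite,linorder} bmatrix"
  assumes "0 < \<Delta>" "0 < p" "\<beta> \<in> hecke_coset N p"
  shows "subvariety2 N (hecke_graph \<Delta> N r \<beta>)"
  unfolding subvariety2_def
proof
  show "hecke_graph \<Delta> N r \<beta> \<subseteq> siegel_variety N \<times> siegel_variety N"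
    using unitary_domain_subset[OF assms(1)] hecke_action[OF assms(3,2)]
    by (fastforce simp: hecke_graph_def siegel_variety_def)
  let ?\<Z> = "{fixset_graph (cm_conj \<Delta> r M) (M' ** \<beta> ** sadj M) | M M'. M \<in> Gamma0 N \<and> M' \<in> Gamma0 N}"
  have coset: "M' ** \<beta> ** sadj M \<in> hecke_coset N p" if "M \<in> Gamma0 N" "M' \<in> Gamma0 N" for M M'
    using that assms(3) hecke_coset_mult Gamma0_sadj by blast
  have "analytic_subset scale_pair (siegel_space \<times> siegel_space) (\<Union>?\<Z>)"
  proof (rule analytic_subset_locally_finite_Union)
    fix Z assume "Z \<in> ?\<Z>"
    then show "analytic_subset scale_pair (siegel_space \<times> siegel_space) Z"
      using analytic_fixset_graph[OF hecke_coset_level(2)[OF coset]] assms(2) by auto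
  next
    fix x :: "'g cmatrix \<times> 'g cmatrix" assume "x \<in> siegel_space \<times> siegel_space"
    then obtain \<tau>0 \<sigma>0 where x: "x = (\<tau>0, \<sigma>0)" "\<tau>0 \<in> siegel_space" "\<sigma>0 \<in> siegel_space"
      by auto
    obtain e1 where e1: "0 < e1" "finite {j \<in> integral_similitudes (1 * real \<Delta> * 1). fixset j \<inter> ball \<tau>0 e1 \<noteq> {}}"
      using fixset_locally_finite[OF x(2), of "1 * real \<Delta> * 1"] assms(1) by auto
    obtain e2 where e2: "0 < e2" "finite {M \<in> integral_similitudes (real p).
        \<exists>\<tau> \<in> siegel_space \<inter> ball \<tau>0 e2. siegel_action M \<tau> \<in> ball \<sigma>0 e2}"
      using finite_transporters[OF x(2,3), of "real p"] assms(2) by auto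
    let ?J = "{j \<in> integral_similitudes (1 * real \<Delta> * 1). fixset j \<inter> ball \<tau>0 e1 \<noteq> {}}"
    let ?K = "{M \<in> integral_similitudes (real p). \<exists>\<tau> \<in> siegel_space \<inter> ball \<tau>0 e2. siegel_action M \<tau> \<in> ball \<sigma>0 e2}"
    let ?U = "(ball \<tau>0 e1 \<inter> ball \<tau>0 e2) \<times> ball \<sigma>0 e2"
    have "{Z \<in> ?\<Z>. Z \<inter> ?U \<noteq> {}} \<subseteq> (\<lambda>(j, M). fixset_graph j M) ` (?J \<times> ?K)"
    proof
      fix Z assume "Z \<in> {Z \<in> ?\<Z>. Z \<inter> ?U \<noteq> {}}"
      then obtain M M' \<tau> \<sigma> where Z: "Z = fixset_graph (cm_conj \<Delta> r M) (M' ** \<beta> ** sadj M)"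
        "M \<in> Gamma0 N" "M' \<in> Gamma0 N" and in_Z: "(\<tau>, \<sigma>) \<in> Z" and in_U: "(\<tau>, \<sigma>) \<in> ?U"
        by blast
      have "cm_conj \<Delta> r M \<in> ?J"
        using cm_conj_integral[OF Gamma0_integral[OF Z(2)]] in_Z in_U by (auto simp: Z(1) fixset_graph_def)
      moreover have "M' ** \<beta> ** sadj M \<in> ?K"
        using hecke_coset_integral[OF coset[OF Z(2,3)]] in_Z in_U by (auto simp: Z(1) fixset_graph_def)
      ultimately show "Z \<in> (\<lambda>(j, M). fixset_graph j M) ` (?J \<times> ?K)"
        unfolding Z(1) by (intro image_eqI[of _ _ "(cm_conj \<Delta> r M, M' ** \<beta> ** sadj M)"]) auto
    qed
    then have "finite {Z \<in> ?\<Z>. Z \<inter> ?U \<noteq> {}}"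
      by (rule finite_subset) (intro finite_imageI finite_cartesian_product e1 e2)
    moreover have "open ?U" "x \<in> ?U"
      using x(1) e1(1) e2(1) by (auto intro: open_Times)
    ultimately show "\<exists>U. open U \<and> x \<in> U \<and> finite {Z \<in> ?\<Z>. Z \<inter> U \<noteq> {}}"
      by blast
  qed
  then show "analytic_subset scale_pair (siegel_space \<times> siegel_space)
    {(\<tau>, \<sigma>) \<in> siegel_space \<times> siegel_space. (siegel_pt N \<tau>, siegel_pt N \<sigma>) \<in> hecke_graph \<Delta> N r \<beta>}"
    unfolding hecke_graph_preimage[OF assms] .
qed

lemma subvariety2_pullback_curve_closed:
  fixes \<beta> :: "'g::{finite,linorder} bmatrix"
  assumes "0 < \<Delta>" "0 < p" "\<beta> \<in> hecke_coset N p" "subvariety2 N A"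
  shows "curve_closed \<Delta> r {\<tau> \<in> siegel_space. (siegel_pt N \<tau>, siegel_pt N (siegel_action \<beta> \<tau>)) \<in> A}"
proof -
  let ?A = "{(\<tau>, \<sigma>) \<in> siegel_space \<times> siegel_space. (siegel_pt N \<tau>, siegel_pt N \<sigma>) \<in> A}"
  have "{\<tau> \<in> siegel_space. (siegel_pt N \<tau>, siegel_pt N (siegel_action \<beta> \<tau>)) \<in> A} =
    {\<tau> \<in> siegel_space. (\<tau>, siegel_action \<beta> \<tau>) \<in> ?A}"
    using hecke_action[OF assms(3,2)] by auto
  then show ?thesis
    using analytic_subset_pair_curve_closed[OF assms(1) _ hecke_coset_level(2)[OF assms(3)], of ?A r] assms(2,4)
    by (simp add: subvariety2_def)
qed

text \<open>A decomposition of the graph into two closed sets pulls back to a decomposition of the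
  unitary domain.\<close>

lemma irreducible_hecke_graph:
  fixes \<beta> :: "'g::{finite,linorder} bmatrix"
  assumes "0 < \<Delta>" "0 < p" "\<beta> \<in> hecke_coset N p"
  shows "irreducible_wrt (subvariety2 N) (hecke_graph \<Delta> N r \<beta>)"
  unfolding irreducible_wrt_def
proof (intro conjI allI impI)
  show "subvariety2 N (hecke_graph \<Delta> N r \<beta>)"
    by (rule subvariety2_hecke_graph[OF assms])
  have "base_point \<Delta> \<in> (unitary_domain \<Delta> r :: 'g cmatrix set)"
    using base_point_fixed[OF assms(1)] by (simp add: unitary_domain_eq_fixset[OF assms(1)])
  then show "hecke_graph \<Delta> N r \<beta> \<noteq> {}"
    by (auto simp: hecke_graph_def)
  fix A B assume AB: "subvariety2 N A \<and> subvariety2 N B \<and> hecke_graph \<Delta> N r \<beta> = A \<union> B"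
  define S where "S = (\<lambda>A. {\<tau> \<in> siegel_space. (siegel_pt N \<tau>, siegel_pt N (siegel_action \<beta> \<tau>)) \<in> A})"
  have "unitary_domain \<Delta> r \<subseteq> S A \<or> unitary_domain \<Delta> r \<subseteq> S B"
  proof (rule ccontr)
    assume "\<not> ?thesis"
    moreover have "curve_closed \<Delta> r (S A)" "curve_closed \<Delta> r (S B)"
      unfolding S_def using AB by (auto intro: subvariety2_pullback_curve_closed[OF assms])
    ultimately obtain \<tau> where "\<tau> \<in> unitary_domain \<Delta> r" "\<tau> \<notin> \<Union>{S A, S B}"
      using unitary_domain_not_finite_union[OF assms(1), of "{S A, S B}" r] by blast
    then have "(siegel_pt N \<tau>, siegel_pt N (siegel_action \<beta> \<tau>)) \<notin> A \<union> B"
      using unitary_domain_subset[OF assms(1)] by (auto simp: S_def)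
    then show False
      using AB \<open>\<tau> \<in> unitary_domain \<Delta> r\<close> by (auto simp: hecke_graph_def)
  qed
  moreover have "unitary_domain \<Delta> r \<subseteq> S X \<Longrightarrow> hecke_graph \<Delta> N r \<beta> \<subseteq> X" for X
    by (auto simp: hecke_graph_def S_def)
  ultimately show "hecke_graph \<Delta> N r \<beta> = A \<or> hecke_graph \<Delta> N r \<beta> = B"
    using AB by blast
qed

lemma irreducible_wrt_finite_union:
  assumes "irreducible_wrt cl Y" "finite \<G>" "\<And>G. G \<in> \<G> \<Longrightarrow> cl G" "Y \<subseteq> \<Union>\<G>"
    and "cl {}" "\<And>A B. cl A \<Longrightarrow> cl B \<Longrightarrow> cl (A \<union> B)" "\<And>A B. cl A \<Longrightarrow> cl B \<Longrightarrow> cl (A \<inter> B)"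
  obtains G where "G \<in> \<G>" "Y \<subseteq> G"
proof -
  have "\<exists>G\<in>\<G>. Y \<subseteq> G"
    using assms(2-4)
  proof (induction \<G> rule: finite_induct)
    case empty
    then show ?case
      using assms(1) by (simp add: irreducible_wrt_def)
  next
    case (insert G \<G>)
    have "cl (\<Union>\<G>)"
      using insert(1) insert.prems(1) assms(5,6) by (induction \<G> rule: finite_induct) auto
    then have "cl (Y \<inter> G)" "cl (Y \<inter> \<Union>\<G>)"
      using assms(1,7) insert.prems(1) by (auto simp: irreducible_wrt_def)
    moreover have "Y = (Y \<inter> G) \<union> (Y \<inter> \<Union>\<G>)"
      using insert.prems(2) by auto
    ultimately have "Y = Y \<inter> G \<or> Y = Y \<inter> \<Union>\<G>"
      using assms(1) unfolding irreducible_wrt_def by blast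
    then show ?case
    proof
      assume "Y = Y \<inter> \<Union>\<G>"
      then have "Y \<subseteq> \<Union>\<G>" by blast
      then have "\<exists>G\<in>\<G>. Y \<subseteq> G"
        using insert.IH insert.prems(1) by simp
      then show ?thesis by blast
    qed blast
  qed
  then show ?thesis
    using that by blast
qed

lemma subvariety2_empty: "subvariety2 N {}"
  by (simp add: subvariety2_def analytic_subset_empty)

lemma subvariety2_Un:
  assumes "subvariety2 N A" "subvariety2 N B"
  shows "subvariety2 N (A \<union> B)"
proof -
  let ?P = "\<lambda>A. {(\<tau>, \<sigma>) \<in> siegel_space \<times> siegel_space. (siegel_pt N \<tau>, siegel_pt N \<sigma>) \<in> A}"
  have "?P (A \<union> B) = ?P A \<union> ?P B"
    by auto
  then show ?thesis
    using assms unfolding subvariety2_def analytic_subset_iff by (auto intro: analytic_at_Un)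
qed

lemma subvariety2_Int:
  assumes "subvariety2 N A" "subvariety2 N B"
  shows "subvariety2 N (A \<inter> B)"
proof -
  let ?P = "\<lambda>A. {(\<tau>, \<sigma>) \<in> siegel_space \<times> siegel_space. (siegel_pt N \<tau>, siegel_pt N \<sigma>) \<in> A}"
  have "?P (A \<inter> B) = ?P A \<inter> ?P B"
    by auto
  then show ?thesis
    using assms unfolding subvariety2_def analytic_subset_iff by (auto intro: analytic_at_Int)
qed

text \<open>Finitely many closed graphs cover the restricted correspondence, so an irreducible component lies
  in one of them; as the graphs are irreducible, it is equal to it.\<close>

theorem hecke_component_is_graph:
  fixes C :: "('g::{finite,linorder} cmatrix set \<times> 'g cmatrix set) set"
  assumes "0 < \<Delta>" "0 < p" "coprime N p" "hecke_component \<Delta> N r p C"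
  obtains \<beta> where "\<beta> \<in> hecke_coset N p" "C = hecke_graph \<Delta> N r \<beta>"
proof -
  have C: "irreducible_wrt (subvariety2 N) C" "C \<subseteq> hecke_restriction \<Delta> N r p"
    and maximal: "\<And>Y. irreducible_wrt (subvariety2 N) Y \<Longrightarrow> C \<subseteq> Y \<Longrightarrow> Y \<subseteq> hecke_restriction \<Delta> N r p \<Longrightarrow> Y = C"
    using assms(4) unfolding hecke_component_def irreducible_component_def by blast+
  have cover: "C \<subseteq> \<Union>(hecke_graph \<Delta> N r ` hecke_coset N p)"
    using C(2) unfolding hecke_restriction_eq[OF assms(1,2)] .
  have closed: "subvariety2 N G" if "G \<in> hecke_graph \<Delta> N r ` hecke_coset N p" for G :: "('g cmatrix set \<times> 'g cmatrix set) set"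
    using that subvariety2_hecke_graph[OF assms(1,2)] by blast
  obtain G where G: "G \<in> hecke_graph \<Delta> N r ` hecke_coset N p" "C \<subseteq> G"
    by (rule irreducible_wrt_finite_union[OF C(1) finite_hecke_graphs[OF assms(1-3), of r]])
      (rule closed, assumption, rule cover, rule subvariety2_empty, rule subvariety2_Un, assumption,
        assumption, rule subvariety2_Int, assumption, assumption, blast)
  then obtain \<beta> where \<beta>: "\<beta> \<in> hecke_coset N p" "G = hecke_graph \<Delta> N r \<beta>"
    by blast
  have "hecke_graph \<Delta> N r \<beta> \<subseteq> hecke_restriction \<Delta> N r p"
    unfolding hecke_restriction_eq[OF assms(1,2)] using \<beta>(1) by blast
  then have "hecke_graph \<Delta> N r \<beta> = C"
    using maximal[OF irreducible_hecke_graph[OF assms(1,2) \<beta>(1)]] G(2) \<beta>(2) by blast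
  then show ?thesis
    using that \<beta>(1) by blast
qed

section \<open>Translates of the unitary domain\<close>

lemma sadj_cm_matrix: "sadj (cm_matrix \<Delta> r) = - cm_matrix \<Delta> r"
  unfolding cm_matrix_def sadj_block block_simps by (simp add: transpose_simps sm_minus_left)

lemma sadj_cm_conj: "sadj (cm_conj \<Delta> r M) = - cm_conj \<Delta> r M"
  by (simp add: cm_conj_def sadj_mult sadj_cm_matrix minus_mult_left' minus_mult_right' matrix_mul_assoc)

lemma cm_conj_mult: "cm_conj \<Delta> r (M ** M') = M ** cm_conj \<Delta> r M' ** sadj M"
  by (simp add: cm_conj_def sadj_mult matrix_mul_assoc)

text \<open>By rigidity a translate that contains the unitary domain is the fixed point set of a
  multiple of \<open>\<surd>(-\<Delta>)\<close>; squaring determines the multiple up to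
  sign.\<close>

lemma cm_conj_rigid:
  fixes M :: "'g::{finite,linorder} bmatrix"
  assumes \<Delta>: "0 < \<Delta>" and r: "0 < r" "r < CARD('g)" and M: "similitude k M" "0 < k"
    and sub: "unitary_domain \<Delta> r \<subseteq> fixset (cm_conj \<Delta> r M)"
  shows "cm_conj \<Delta> r M = sm k (cm_matrix \<Delta> r) \<or> cm_conj \<Delta> r M = sm (- k) (cm_matrix \<Delta> r)"
    and "fixset (cm_conj \<Delta> r M) = unitary_domain \<Delta> r"
proof -
  let ?J = "cm_matrix \<Delta> r :: 'g bmatrix"
  obtain b where b: "cm_conj \<Delta> r M = sm b ?J"
    using unitary_domain_rigid[OF \<Delta> r sadj_cm_conj sub] by blast
  have "cm_conj \<Delta> r M ** cm_conj \<Delta> r M = M ** ?J ** (sadj M ** M) ** ?J ** sadj M"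
    by (simp add: cm_conj_def matrix_mul_assoc)
  also have "\<dots> = sm k (M ** (?J ** ?J) ** sadj M)"
    using similitude_sadj_mult[OF M(1)] M(2) by (simp add: mult_mat_eq_sm sm_mult_left matrix_mul_assoc)
  also have "\<dots> = sm (k * - real \<Delta>) (M ** sadj M)"
    by (simp add: cm_matrix_square mult_mat_eq_sm sm_mult_left sm_sm)
  also have "\<dots> = mat (k * - real \<Delta> * k)"
    using M(1) by (simp add: similitude_iff_mult_sadj sm_mat)
  finally have "mat (b * b * - real \<Delta>) = (mat (k * - real \<Delta> * k) :: 'g bmatrix)"
    by (simp add: b sm_mult_left sm_mult_right sm_sm cm_matrix_square sm_mat mult.assoc)
  then have "b * b * - real \<Delta> = k * - real \<Delta> * k"
    by (simp add: matrix_eq_iff mat_def split: if_splits)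
  then have "b * b = k * k"
    using \<Delta> by simp
  then have "b = k \<or> b = - k"
    by (simp add: square_eq_iff)
  then show "cm_conj \<Delta> r M = sm k ?J \<or> cm_conj \<Delta> r M = sm (- k) ?J"
    using b by blast
  have "b \<noteq> 0"
    using \<open>b = k \<or> b = - k\<close> M(2) by auto
  then show "fixset (cm_conj \<Delta> r M) = unitary_domain \<Delta> r"
    unfolding b unitary_domain_eq_fixset[OF \<Delta>] by (rule fixset_sm)
qed

lemma image_unitary_domain:
  assumes "0 < \<Delta>" "similitude k M" "0 < k"
  shows "siegel_action M ` unitary_domain \<Delta> r = fixset (cm_conj \<Delta> r M)"
proof (intro equalityI subsetI)
  fix \<sigma> assume "\<sigma> \<in> siegel_action M ` unitary_domain \<Delta> r"
  then show "\<sigma> \<in> fixset (cm_conj \<Delta> r M)"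
    using fixset_cm_conj[OF assms] unitary_domain_subset[OF assms(1)] by blast
next
  fix \<sigma> assume \<sigma>: "\<sigma> \<in> fixset (cm_conj \<Delta> r M)"
  then have H: "\<sigma> \<in> siegel_space"
    by (simp add: fixset_def)
  have "similitude k (sadj M)"
    using similitude_sadj[OF assms(2)] assms(3) by simp
  then have t: "siegel_action (sadj M) \<sigma> \<in> siegel_space"
    using siegel_action_in assms(3) H by blast
  have "siegel_action M (siegel_action (sadj M) \<sigma>) = \<sigma>"
    by (rule siegel_action_sadj(2)[OF assms(2,3) H])
  then show "\<sigma> \<in> siegel_action M ` unitary_domain \<Delta> r"
    using fixset_cm_conj[OF assms t, of r] \<sigma> by (metis image_eqI)
qed

lemma base_point_in_domain: "0 < \<Delta> \<Longrightarrow> base_point \<Delta> \<in> unitary_domain \<Delta> r"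
  using base_point_fixed by (simp add: unitary_domain_eq_fixset)

section \<open>Goodness in terms of lattices\<close>

definition integral_vector :: "real^'n \<Rightarrow> bool" where
  "integral_vector y \<longleftrightarrow> (\<forall>i. y $ i \<in> \<int>)"

definition cvec :: "real^'n \<Rightarrow> complex^'n" where
  "cvec y = (\<chi> i. of_real (y $ i))"

lemma cvec_mult: "cvec y v* cmat M = cvec (y v* M)"
  by (simp add: cvec_def vec_eq_iff vector_matrix_mult_def)

lemma cvec_add: "cvec (x + y) = cvec x + cvec y"
  by (simp add: cvec_def vec_eq_iff)

lemma cvec_frame: "cvec y v* frame \<tau> = (\<chi> i. of_real (y $ Inl i)) v* \<tau> + (\<chi> i. of_real (y $ Inr i))"
  by (simp add: vec_eq_iff vector_matrix_mult_def sum_plus_type cvec_def frame_def mat_def if_distrib cong: if_cong)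

lemma period_lattice_eq: "period_lattice \<tau> = {cvec y v* frame \<tau> | y. integral_vector y}"
proof (intro equalityI subsetI)
  fix u assume "u \<in> period_lattice \<tau>"
  then obtain m n where u: "u = m v* \<tau> + n" and int: "\<forall>i. m $ i \<in> \<int>" "\<forall>i. n $ i \<in> \<int>"
    by (auto simp: period_lattice_def)
  define y :: "real^('a + 'a)" where "y = (\<chi> i. case i of Inl i' \<Rightarrow> Re (m $ i') | Inr i' \<Rightarrow> Re (n $ i'))"
  have re: "of_real (Re z) = z" "Re z \<in> \<int>" if "z \<in> \<int>" for z :: complex
    using that by (auto elim!: Ints_cases)
  have "cvec y v* frame \<tau> = u"
    unfolding cvec_frame u using int by (simp add: y_def re vec_eq_iff vector_matrix_mult_def)
  moreover have "integral_vector y"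
    using int re by (auto simp: integral_vector_def y_def split: sum.split)
  ultimately show "u \<in> {cvec y v* frame \<tau> | y. integral_vector y}"
    by blast
next
  fix u assume "u \<in> {cvec y v* frame \<tau> | y. integral_vector y}"
  then obtain y where u: "u = cvec y v* frame \<tau>" "integral_vector y"
    by blast
  have "of_real x \<in> (\<int> :: complex set)" if "x \<in> \<int>" for x :: real
    using that by (auto elim!: Ints_cases)
  then have "\<forall>i. (\<chi> i. complex_of_real (y $ Inl i)) $ i \<in> \<int>" "\<forall>i. (\<chi> i. complex_of_real (y $ Inr i)) $ i \<in> \<int>"
    using u(2) by (simp_all add: integral_vector_def)
  then show "u \<in> period_lattice \<tau>"
    unfolding period_lattice_def u(1) cvec_frame by blast
qed

lemma cvec_frame_inject:
  assumes "\<tau> \<in> siegel_space" "cvec x v* frame \<tau> = cvec y v* frame \<tau>"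
  shows "x = y"
proof -
  define z where "z = x - y"
  have "cvec z v* frame \<tau> = 0"
  proof -
    have "cvec x = cvec z + cvec y"
      by (simp add: z_def cvec_add[symmetric])
    then show ?thesis
      using assms(2) by (simp add: vector_matrix_left_distrib)
  qed
  then have eq: "(\<chi> i. of_real (z $ Inl i)) v* \<tau> + (\<chi> i. of_real (z $ Inr i)) = 0"
    by (simp add: cvec_frame)
  define m where "m = (\<chi> i. z $ Inl i)"
  have "m v* map_matrix Im \<tau> = 0"
  proof -
    have "Im (((\<chi> i. of_real (z $ Inl i)) v* \<tau> + (\<chi> i. of_real (z $ Inr i))) $ j) = 0" for j
      by (simp only: eq) simp
    then show ?thesis
      by (simp add: vec_eq_iff vector_matrix_mult_def m_def)
  qed
  then have "m \<bullet> (map_matrix Im \<tau> *v m) = 0"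
    by (simp add: dot_lmul_matrix[symmetric])
  then have "m = 0"
    using assms(1) by (auto simp: siegel_space_def)
  then have l: "z $ Inl i = 0" for i
    by (simp add: m_def vec_eq_iff)
  then have "(\<chi> i. complex_of_real (z $ Inl i)) = 0"
    by (simp add: vec_eq_iff)
  then have "(\<chi> i. complex_of_real (z $ Inr i)) = 0"
    using eq by simp
  then have "z $ Inr i = 0" for i
    by (simp add: vec_eq_iff)
  then have "z = 0"
    using l by (simp add: vec_eq_iff all_plus_type)
  then show ?thesis
    by (simp add: z_def)
qed

definition generates_lattice :: "nat \<Rightarrow> nat \<Rightarrow> 'g::{finite,linorder} bmatrix \<Rightarrow> bool" where
  "generates_lattice \<Delta> r \<beta> \<longleftrightarrow> (\<forall>y. integral_vector y \<longrightarrow>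
     (\<exists>x x'. integral_vector x \<and> integral_vector x' \<and> y = x v* \<beta> + x' v* (\<beta> ** cm_matrix \<Delta> r)))"

text \<open>In the basis of the periods of \<open>\<tau>\<close>, the lattice of \<open>W\<close> is \<open>p\<^sup>-\<^sup>1 \<int>\<^sup>2\<^sup>g \<beta>\<close>. So goodness says that
  \<open>\<int>\<^sup>2\<^sup>g \<beta>\<close> and its image under \<open>\<surd>(-\<Delta>)\<close> together span \<open>\<int>\<^sup>2\<^sup>g\<close>; this does not involve \<open>\<tau>\<close>.\<close>

lemma good_generates_lattice:
  fixes \<tau> :: "'g::{finite,linorder} cmatrix"
  assumes \<Delta>: "0 < \<Delta>" and p: "0 < p" and \<tau>: "\<tau> \<in> unitary_domain \<Delta> r" and \<beta>: "similitude (real p) \<beta>"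
    and good: "OK_span \<Delta> r \<tau> (hecke_subspace p \<beta> \<tau>) = torsion_lattice p \<tau>"
  shows "generates_lattice \<Delta> r \<beta>"
  unfolding generates_lattice_def
proof (intro allI impI)
  let ?J = "cm_matrix \<Delta> r :: 'g bmatrix"
  have fix\<tau>: "\<tau> \<in> fixset ?J"
    using \<tau> by (simp add: unitary_domain_eq_fixset[OF \<Delta>])
  then have H: "\<tau> \<in> siegel_space"
    by (simp add: fixset_def)
  have W: "hecke_subspace p \<beta> \<tau> = {(cvec (x v* \<beta>) v* frame \<tau>) /\<^sub>R real p | x. integral_vector x}"
  proof -
    have "(cvec x v* frame (siegel_action \<beta> \<tau>)) v* automorphy \<beta> \<tau> = cvec (x v* \<beta>) v* frame \<tau>" for x
    proof -
      have "(cvec x v* frame (siegel_action \<beta> \<tau>)) v* automorphy \<beta> \<tau> = cvec x v* (cmat \<beta> ** frame \<tau>)"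
        using similitude_frame[OF \<beta> _ H] p by (simp add: vector_matrix_mul_assoc)
      then show ?thesis
        by (simp add: vector_matrix_mul_assoc[symmetric] cvec_mult)
    qed
    then show ?thesis
      unfolding hecke_subspace_def period_lattice_eq by (auto; metis)
  qed
  have mult: "mult_sqrt_neg \<Delta> r \<tau> ((cvec x v* frame \<tau>) /\<^sub>R real p) = (cvec (x v* ?J) v* frame \<tau>) /\<^sub>R real p" for x
  proof -
    have "automorphy ?J \<tau> = mat (- of_nat \<Delta>) ** cmat (sig_matrix r) ** \<tau>"
      by (simp add: automorphy_def cm_matrix_def cmat_sm mat_mult_eq_sm)
    moreover have "cmat ?J ** frame \<tau> = frame \<tau> ** automorphy ?J \<tau>"
      using fix\<tau> by (simp add: fixset_iff_equation cmat_mult_frame frame_mult stack_eq_iff)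
    ultimately have "mult_sqrt_neg \<Delta> r \<tau> (cvec x v* frame \<tau>) = cvec x v* (cmat ?J ** frame \<tau>)"
      by (simp add: mult_sqrt_neg_def vector_matrix_mul_assoc)
    also have "\<dots> = cvec (x v* ?J) v* frame \<tau>"
      by (simp add: vector_matrix_mul_assoc[symmetric] cvec_mult)
    finally have "mult_sqrt_neg \<Delta> r \<tau> (cvec x v* frame \<tau>) = cvec (x v* ?J) v* frame \<tau>" .
    moreover have "mult_sqrt_neg \<Delta> r \<tau> (u /\<^sub>R real p) = mult_sqrt_neg \<Delta> r \<tau> u /\<^sub>R real p" for u
      by (simp add: mult_sqrt_neg_def vec_eq_iff vector_matrix_mult_def scaleR_sum_right)
    ultimately show ?thesis by simp
  qed
  fix y :: "real^('g + 'g)" assume "integral_vector y"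
  then have "(cvec y v* frame \<tau>) /\<^sub>R real p \<in> torsion_lattice p \<tau>"
    unfolding torsion_lattice_def period_lattice_eq by blast
  then obtain w w' where w: "w \<in> hecke_subspace p \<beta> \<tau>" "w' \<in> hecke_subspace p \<beta> \<tau>"
    "(cvec y v* frame \<tau>) /\<^sub>R real p = w + mult_sqrt_neg \<Delta> r \<tau> w'"
    unfolding good[symmetric] OK_span_def by blast
  obtain x x' where x: "integral_vector x" "integral_vector x'"
    "w = (cvec (x v* \<beta>) v* frame \<tau>) /\<^sub>R real p" "w' = (cvec (x' v* \<beta>) v* frame \<tau>) /\<^sub>R real p"
    using w(1,2) unfolding W by blast
  have "(cvec y v* frame \<tau>) /\<^sub>R real p =
    ((cvec (x v* \<beta>) v* frame \<tau>) + (cvec ((x' v* \<beta>) v* ?J) v* frame \<tau>)) /\<^sub>R real p"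
    unfolding w(3) x(3,4) mult by (simp add: scaleR_add_right)
  then have "cvec y v* frame \<tau> = cvec (x v* \<beta> + (x' v* \<beta>) v* ?J) v* frame \<tau>"
    using p by (simp add: cvec_add vector_matrix_left_distrib)
  then have "y = x v* \<beta> + x' v* (\<beta> ** ?J)"
    using cvec_frame_inject[OF H] by (simp add: vector_matrix_mul_assoc)
  then show "\<exists>x x'. integral_vector x \<and> integral_vector x' \<and> y = x v* \<beta> + x' v* (\<beta> ** ?J)"
    using x(1,2) by blast
qed

lemma integral_vector_mult:
  "integral_vector x \<Longrightarrow> (\<And>i j. M $ i $ j \<in> \<int>) \<Longrightarrow> integral_vector (x v* M)"
  by (auto simp: integral_vector_def vector_matrix_mult_def intro!: Ints_sum Ints_mult)

lemma integral_vector_add: "integral_vector x \<Longrightarrow> integral_vector y \<Longrightarrow> integral_vector (x + y)"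
  and integral_vector_minus: "integral_vector x \<Longrightarrow> integral_vector (- x)"
  by (auto simp: integral_vector_def)

text \<open>The heart of the matter. An automorphism of the lattice \<open>\<int>\<^sup>2\<^sup>g \<beta>\<close> that commutes or anticommutes
  with \<open>\<surd>(-\<Delta>)\<close> also preserves the \<open>\<surd>(-\<Delta>)\<close>-stable lattice that \<open>\<int>\<^sup>2\<^sup>g \<beta>\<close> generates; if \<open>\<beta>\<close> is good,
  this is \<open>\<int>\<^sup>2\<^sup>g\<close>.\<close>

lemma conjugate_in_Gamma0:
  fixes \<beta> :: "'g::{finite,linorder} bmatrix"
  assumes p: "0 < p" "coprime N p" and \<beta>: "\<beta> \<in> hecke_coset N p" and M: "M \<in> Gamma0 N"
    and gen: "generates_lattice \<Delta> r \<beta>"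
  defines "\<epsilon> \<equiv> sm (1 / real p) (sadj \<beta> ** M ** \<beta>)"
  assumes comm: "\<epsilon> ** cm_matrix \<Delta> r = cm_matrix \<Delta> r ** \<epsilon> \<or> \<epsilon> ** cm_matrix \<Delta> r = - (cm_matrix \<Delta> r ** \<epsilon>)"
  shows "\<epsilon> \<in> Gamma0 N"
proof -
  let ?J = "cm_matrix \<Delta> r :: 'g bmatrix"
  have sim: "similitude (real p) \<beta>"
    using hecke_coset_level(2)[OF \<beta>] .
  have "\<beta> ** \<epsilon> = sm (1 / real p) ((\<beta> ** sadj \<beta>) ** M ** \<beta>)"
    by (simp add: \<epsilon>_def sm_mult_right matrix_mul_assoc)
  then have \<beta>\<epsilon>: "\<beta> ** \<epsilon> = M ** \<beta>"
    using sim p(1) by (simp add: similitude_iff_mult_sadj mat_mult_eq_sm sm_mult_left sm_sm)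
  have int: "(M ** \<beta>) $ i $ j \<in> \<int>" "(M ** \<beta> ** ?J) $ i $ j \<in> \<int>" for i j
    using integral_similitudes_mult[OF Gamma0_integral[OF M] hecke_coset_integral[OF \<beta>]]
      integral_similitudes_mult[OF integral_similitudes_mult[OF Gamma0_integral[OF M] hecke_coset_integral[OF \<beta>]]
        cm_matrix_integral[of \<Delta> r]] by (auto simp: integral_similitudes_def)
  have "integral_vector (y v* \<epsilon>)" if y: "integral_vector y" for y
  proof -
    obtain x x' where x: "integral_vector x" "integral_vector x'" "y = x v* \<beta> + x' v* (\<beta> ** ?J)"
      using gen y unfolding generates_lattice_def by blast
    have "y v* \<epsilon> = x v* (M ** \<beta>) + x' v* (\<beta> ** (?J ** \<epsilon>))"
      by (simp add: x(3) vector_matrix_left_distrib vector_matrix_mul_assoc \<beta>\<epsilon>[symmetric] matrix_mul_assoc)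
    moreover have "?J ** \<epsilon> = \<epsilon> ** ?J \<or> ?J ** \<epsilon> = - (\<epsilon> ** ?J)"
      using comm by (metis minus_minus)
    moreover have "\<beta> ** (\<epsilon> ** ?J) = M ** \<beta> ** ?J" "\<beta> ** (- (\<epsilon> ** ?J)) = - (M ** \<beta> ** ?J)"
      by (simp_all add: matrix_mul_assoc \<beta>\<epsilon> minus_mult_right')
    moreover have "x' v* (- (M ** \<beta> ** ?J)) = - (x' v* (M ** \<beta> ** ?J))"
      by (simp add: vec_eq_iff vector_matrix_mult_def sum_negf)
    ultimately have "y v* \<epsilon> = x v* (M ** \<beta>) + x' v* (M ** \<beta> ** ?J) \<or>
      y v* \<epsilon> = x v* (M ** \<beta>) + - (x' v* (M ** \<beta> ** ?J))"
      by metis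
    moreover have "integral_vector (x v* (M ** \<beta>))" "integral_vector (x' v* (M ** \<beta> ** ?J))"
      using x(1,2) int by (auto intro: integral_vector_mult)
    ultimately show ?thesis
      using integral_vector_add integral_vector_minus by metis
  qed
  then have "integral_vector (axis i 1 v* \<epsilon>)" for i
    by (simp add: integral_vector_def axis_def)
  moreover have "(axis i 1 v* \<epsilon>) $ j = \<epsilon> $ i $ j" for i j
    by (simp add: vector_matrix_mult_def axis_def if_distrib if_distribR cong: if_cong)
  ultimately have entries: "\<epsilon> $ i $ j \<in> \<int>" for i j
    by (metis integral_vector_def)
  have "\<epsilon> \<in> level_matrices N"
    unfolding \<epsilon>_def
  proof (rule level_matrices_divide[OF p(2,1)])
    show "sadj \<beta> ** M ** \<beta> \<in> level_matrices N"
      using hecke_coset_level(1)[OF \<beta>] M by (intro level_matrices_mult level_matrices_sadj) (auto simp: Gamma0_iff)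
    show "sm (1 / real p) (sadj \<beta> ** M ** \<beta>) $ i $ j \<in> \<int>" for i j
      using entries by (simp add: \<epsilon>_def)
  qed
  moreover have "similitude ((1 / real p)\<^sup>2 * (real p * 1 * real p)) \<epsilon>"
    unfolding \<epsilon>_def using sim p(1) Gamma0_similitude[OF M]
    by (intro similitude_sm similitude_mult similitude_sadj) auto
  then have "similitude 1 \<epsilon>"
    using p(1) by (simp add: power2_eq_square)
  ultimately show ?thesis
    by (simp add: Gamma0_iff)
qed

section \<open>A good component is the graph of a good matrix\<close>

lemma stabilizer_of_domain:
  fixes M :: "'g::{finite,linorder} bmatrix"
  assumes "0 < \<Delta>" "M \<in> Gamma0 N" "fixset (cm_conj \<Delta> r (sadj M)) = unitary_domain \<Delta> r"
  shows "siegel_action M ` unitary_domain \<Delta> r = unitary_domain \<Delta> r"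
proof -
  have "siegel_action (sadj M) ` unitary_domain \<Delta> r = unitary_domain \<Delta> r"
    using image_unitary_domain[OF assms(1) Gamma0_similitude[OF Gamma0_sadj[OF assms(2)]]] assms(3) by simp
  then have "siegel_action M ` unitary_domain \<Delta> r = siegel_action M ` siegel_action (sadj M) ` unitary_domain \<Delta> r"
    by simp
  also have "\<dots> = id ` unitary_domain \<Delta> r"
    unfolding image_image
  proof (rule image_cong[OF refl])
    fix \<tau> :: "'g cmatrix" assume "\<tau> \<in> unitary_domain \<Delta> r"
    then have "\<tau> \<in> siegel_space"
      using unitary_domain_subset[OF assms(1)] by blast
    then show "siegel_action M (siegel_action (sadj M) \<tau>) = id \<tau>"
      using siegel_action_sadj(2)[OF Gamma0_similitude[OF assms(2)]] by simp
  qed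
  finally show ?thesis by simp
qed

lemma fixset_family_locally_finite:
  fixes \<tau>0 :: "'g::finite cmatrix"
  assumes "\<tau>0 \<in> siegel_space" "0 < k" "\<J> \<subseteq> integral_similitudes k"
  shows "\<exists>W. open W \<and> \<tau>0 \<in> W \<and> finite {j \<in> \<J>. fixset j \<inter> W \<noteq> {}}"
proof -
  obtain e where e: "0 < e" "finite {j \<in> integral_similitudes k. fixset j \<inter> ball \<tau>0 e \<noteq> {}}"
    using fixset_locally_finite[OF assms(1,2)] by blast
  then have "finite {j \<in> \<J>. fixset j \<inter> ball \<tau>0 e \<noteq> {}}"
    using assms(3) by (auto elim!: finite_subset[rotated])
  then show ?thesis
    using e(1) by (intro exI[of _ "ball \<tau>0 e"]) auto
qed

lemma fixset_intersections_locally_finite: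
  fixes \<tau>0 :: "'g::finite cmatrix"
  assumes "\<tau>0 \<in> siegel_space" "0 < k" "\<J> \<subseteq> integral_similitudes k"
  shows "\<exists>W. open W \<and> \<tau>0 \<in> W \<and>
    finite {Z \<in> {fixset j \<inter> fixset j' | j j'. j \<in> \<J> \<and> j' \<in> \<J>}. Z \<inter> W \<noteq> {}}"
proof -
  obtain W where W: "open W" "\<tau>0 \<in> W" "finite {j \<in> \<J>. fixset j \<inter> W \<noteq> {}}"
    using fixset_family_locally_finite[OF assms] by blast
  let ?K = "{j \<in> \<J>. fixset j \<inter> W \<noteq> {}}"
  have "{Z \<in> {fixset j \<inter> fixset j' | j j'. j \<in> \<J> \<and> j' \<in> \<J>}. Z \<inter> W \<noteq> {}} \<subseteq>
    (\<lambda>(j, j'). fixset j \<inter> fixset j') ` (?K \<times> ?K)"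
  proof
    fix Z assume "Z \<in> {Z \<in> {fixset j \<inter> fixset j' | j j'. j \<in> \<J> \<and> j' \<in> \<J>}. Z \<inter> W \<noteq> {}}"
    then obtain j j' where Z: "Z = fixset j \<inter> fixset j'" "j \<in> \<J>" "j' \<in> \<J>" "Z \<inter> W \<noteq> {}"
      by blast
    then have "j \<in> ?K" "j' \<in> ?K"
      by blast+
    then show "Z \<in> (\<lambda>(j, j'). fixset j \<inter> fixset j') ` (?K \<times> ?K)"
      unfolding Z(1) by (intro image_eqI[of _ _ "(j, j')"]) simp_all
  qed
  then have "finite {Z \<in> {fixset j \<inter> fixset j' | j j'. j \<in> \<J> \<and> j' \<in> \<J>}. Z \<inter> W \<noteq> {}}"
    by (rule finite_subset) (intro finite_imageI finite_cartesian_product W(3))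
  then show ?thesis
    using W(1,2) by blast
qed

text \<open>Goodness supplies, over a generic point of \<open>V\<close>, a point of \<open>C\<close> given by some good matrix. The
  conditions on \<open>\<tau>\<close> under which a particular good matrix occurs form a locally finite family of
  analytic sets, so one of them holds identically.\<close>

lemma good_component_is_good_graph:
  fixes C :: "('g::{finite,linorder} cmatrix set \<times> 'g cmatrix set) set"
  assumes \<Delta>: "0 < \<Delta>" and p: "0 < p" "coprime N p" and r: "0 < r" "r < CARD('g)"
    and good: "good_component \<Delta> N r p C"
  obtains \<beta> where "\<beta> \<in> hecke_coset N p" "generates_lattice \<Delta> r \<beta>" "C = hecke_graph \<Delta> N r \<beta>"
proof -
  let ?D = "unitary_domain \<Delta> r :: 'g cmatrix set"
  have DH: "?D \<subseteq> siegel_space"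
    by (rule unitary_domain_subset[OF \<Delta>])
  obtain \<beta>0 where \<beta>0: "\<beta>0 \<in> hecke_coset N p" "C = hecke_graph \<Delta> N r \<beta>0"
    using hecke_component_is_graph[OF \<Delta> p] good unfolding good_component_def by blast
  obtain Z where Z: "subvariety N Z" "Z \<subset> unitary_variety \<Delta> N r"
    and gen: "\<forall>t \<in> unitary_variety \<Delta> N r - Z. \<exists>\<tau> \<beta>. \<tau> \<in> ?D \<and> t = siegel_pt N \<tau> \<and>
       \<beta> \<in> hecke_coset N p \<and> (t, siegel_pt N (siegel_action \<beta> \<tau>)) \<in> C \<and>
       OK_span \<Delta> r \<tau> (hecke_subspace p \<beta> \<tau>) = torsion_lattice p \<tau>"
    using good[unfolded good_component_def generically_def, THEN conjunct2]
    by (elim exE conjE) (rule that; assumption)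
  define Z' where "Z' = {\<tau> \<in> siegel_space. siegel_pt N \<tau> \<in> Z}"
  define stab where "stab = {M \<in> Gamma0 N. siegel_action M ` ?D = ?D}"
  (* J1 records that tau lies on another translate of the domain, J2 that at tau the branch of
     some good matrix agrees with the branch of beta0. *)
  define \<J>1 where "\<J>1 = {cm_conj \<Delta> r M | M :: 'g bmatrix. M \<in> Gamma0 N \<and> fixset (cm_conj \<Delta> r M) \<noteq> ?D}"
  define \<J>2 where "\<J>2 = {sadj (L ** \<beta>0 ** M') ** (\<beta> ** M) | L \<beta> M M'. L \<in> Gamma0 N \<and>
    \<beta> \<in> hecke_coset N p \<and> generates_lattice \<Delta> r \<beta> \<and> M \<in> stab \<and> M' \<in> stab}"
  define \<S> where "\<S> = insert Z' (fixset ` \<J>1 \<union> fixset ` \<J>2)"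
  have \<J>1: "\<J>1 \<subseteq> integral_similitudes (1 * real \<Delta> * 1)"
    unfolding \<J>1_def using cm_conj_integral[OF Gamma0_integral, of _ N \<Delta> r] by fastforce
  have \<J>2: "\<J>2 \<subseteq> integral_similitudes (real p * real p)"
  proof
    fix j assume "j \<in> \<J>2"
    then obtain L \<beta> M M' where j: "j = sadj (L ** \<beta>0 ** M') ** (\<beta> ** M)" "L \<in> Gamma0 N"
      "\<beta> \<in> hecke_coset N p" "M \<in> Gamma0 N" "M' \<in> Gamma0 N"
      by (auto simp: \<J>2_def stab_def)
    have "L ** \<beta>0 ** M' \<in> hecke_coset N p" "\<beta> ** M \<in> hecke_coset N p"
      using hecke_coset_mult j \<beta>0(1) by blast+
    then show "j \<in> integral_similitudes (real p * real p)"
      unfolding j(1) using p(1)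
      by (intro integral_similitudes_mult integral_similitudes_sadj hecke_coset_integral) auto
  qed
  have Z'an: "analytic_subset scale_matrix siegel_space Z'"
    using Z(1) by (simp add: subvariety_def Z'_def)
  have move: "M \<in> stab \<or> \<tau> \<in> \<Union>\<S>"
    if "\<tau> \<in> ?D" "M \<in> Gamma0 N" "siegel_action M \<tau> \<in> ?D" for M \<tau>
  proof (cases "fixset (cm_conj \<Delta> r (sadj M)) = ?D")
    case True
    then show ?thesis
      using stabilizer_of_domain[OF \<Delta> that(2)] that(2) by (simp add: stab_def)
  next
    case False
    have "\<tau> \<in> siegel_space"
      using that(1) DH by blast
    then have "siegel_action (sadj M) (siegel_action M \<tau>) = \<tau>"
      using siegel_action_sadj(1)[OF Gamma0_similitude[OF that(2)]] by simp
    then have "\<tau> \<in> fixset (cm_conj \<Delta> r (sadj M))"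
      using image_unitary_domain[OF \<Delta> Gamma0_similitude[OF Gamma0_sadj[OF that(2)]], of r] that(3)
      by (metis image_eqI zero_less_one)
    moreover have "cm_conj \<Delta> r (sadj M) \<in> \<J>1"
      using Gamma0_sadj[OF that(2)] False by (auto simp: \<J>1_def)
    ultimately show ?thesis
      by (auto simp: \<S>_def)
  qed
  have cover: "?D \<subseteq> \<Union>\<S>"
  proof
    fix \<tau> assume \<tau>: "\<tau> \<in> ?D"
    then have H: "\<tau> \<in> siegel_space"
      using DH by blast
    show "\<tau> \<in> \<Union>\<S>"
    proof (cases "siegel_pt N \<tau> \<in> Z")
      case True
      then show ?thesis
        using H by (auto simp: \<S>_def Z'_def)
    next
      case False
      then have "siegel_pt N \<tau> \<in> unitary_variety \<Delta> N r - Z"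
        using \<tau> by (simp add: unitary_variety_def)
      from bspec[OF gen this] obtain \<tau>' \<beta> where *: "\<tau>' \<in> ?D" "siegel_pt N \<tau> = siegel_pt N \<tau>'" "\<beta> \<in> hecke_coset N p"
        "(siegel_pt N \<tau>, siegel_pt N (siegel_action \<beta> \<tau>')) \<in> C"
        "OK_span \<Delta> r \<tau>' (hecke_subspace p \<beta> \<tau>') = torsion_lattice p \<tau>'"
        by blast
      have gl: "generates_lattice \<Delta> r \<beta>"
        by (rule good_generates_lattice[OF \<Delta> p(1) *(1) hecke_coset_level(2)[OF *(3)] *(5)])
      have H': "\<tau>' \<in> siegel_space"
        using *(1) DH by blast
      obtain M where M: "M \<in> Gamma0 N" "\<tau>' = siegel_action M \<tau>"
        using siegel_pt_eq_iff[OF H H'] *(2) by blast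
      obtain \<tau>1 where \<tau>1: "\<tau>1 \<in> ?D" "siegel_pt N \<tau> = siegel_pt N \<tau>1"
        "siegel_pt N (siegel_action \<beta> \<tau>') = siegel_pt N (siegel_action \<beta>0 \<tau>1)"
        using *(4) unfolding \<beta>0(2) hecke_graph_def by blast
      have H1: "\<tau>1 \<in> siegel_space"
        using \<tau>1(1) DH by blast
      obtain M' where M': "M' \<in> Gamma0 N" "\<tau>1 = siegel_action M' \<tau>"
        using siegel_pt_eq_iff[OF H H1] \<tau>1(2) by blast
      obtain L where L: "L \<in> Gamma0 N" "siegel_action \<beta> \<tau>' = siegel_action L (siegel_action \<beta>0 \<tau>1)"
        using siegel_pt_eq_iff[OF hecke_action[OF \<beta>0(1) p(1) H1] hecke_action[OF *(3) p(1) H']] \<tau>1(3) by metis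
      let ?d1 = "\<beta> ** M" and ?d2 = "L ** \<beta>0 ** M'"
      have d1: "?d1 \<in> hecke_coset N p" and d2: "?d2 \<in> hecke_coset N p"
        using hecke_coset_mult *(3) \<beta>0(1) M(1) M'(1) L(1) by blast+
      have "siegel_action ?d1 \<tau> = siegel_action ?d2 \<tau>"
        using hecke_action_mult(2)[OF *(3) p(1) M(1) H] M(2) L(2) M'(2)
          hecke_action_mult(2)[OF hecke_coset_mult(1)[OF \<beta>0(1) L(1)] p(1) M'(1) H]
          hecke_action_mult(1)[OF \<beta>0(1) p(1) L(1) H1] by simp
      note s1 = hecke_coset_level(2)[OF d1] and s2 = hecke_coset_level(2)[OF d2]
      have s2': "similitude (real p) (sadj ?d2)"
        using similitude_sadj[OF s2] p(1) by simp
      have "siegel_action (sadj ?d2 ** ?d1) \<tau> = \<tau>"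
        using siegel_action_mult[OF s2' _ s1 _ H] siegel_action_sadj(1)[OF s2 _ H] p(1)
          \<open>siegel_action ?d1 \<tau> = siegel_action ?d2 \<tau>\<close> by simp
      then have fixed: "\<tau> \<in> fixset (sadj ?d2 ** ?d1)"
        using fixset_iff_action[OF similitude_mult[OF s2' s1]] p(1) H by simp
      show ?thesis
      proof (cases "M \<in> stab \<and> M' \<in> stab")
        case True
        then have "sadj ?d2 ** ?d1 \<in> \<J>2"
          using L(1) *(3) gl unfolding \<J>2_def by blast
        then show ?thesis
          using fixed by (auto simp: \<S>_def)
      next
        case False
        then show ?thesis
          using move[OF \<tau> M(1)] move[OF \<tau> M'(1)] *(1) M(2) \<tau>1(1) M'(2) by blast
      qed
    qed
  qed
  have closed: "curve_closed \<Delta> r S" if "S \<in> \<S>" for S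
    using that analytic_subset_curve_closed[OF \<Delta>] Z'an analytic_fixset by (auto simp: \<S>_def)
  let ?b = "base_point \<Delta> :: 'g cmatrix"
  have b: "?b \<in> ?D" "?b \<in> siegel_space"
    using base_point_in_domain[OF \<Delta>] base_point_in[OF \<Delta>] by auto
  obtain W1 where W1: "open W1" "?b \<in> W1" "finite {j \<in> \<J>1. fixset j \<inter> W1 \<noteq> {}}"
    using fixset_family_locally_finite[OF b(2) _ \<J>1] \<Delta> by auto
  obtain W2 where W2: "open W2" "?b \<in> W2" "finite {j \<in> \<J>2. fixset j \<inter> W2 \<noteq> {}}"
    using fixset_family_locally_finite[OF b(2) _ \<J>2] p by auto
  have "{S \<in> \<S>. S \<inter> (W1 \<inter> W2) \<noteq> {}} \<subseteq>
    insert Z' (fixset ` {j \<in> \<J>1. fixset j \<inter> W1 \<noteq> {}} \<union> fixset ` {j \<in> \<J>2. fixset j \<inter> W2 \<noteq> {}})"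
    by (auto simp: \<S>_def)
  then have fin: "finite {S \<in> \<S>. S \<inter> (W1 \<inter> W2) \<noteq> {}}"
    by (rule finite_subset) (use W1(3) W2(3) in simp)
  obtain S where S: "S \<in> \<S>" "?D \<subseteq> S"
    using unitary_domain_locally_finite_cover[OF \<Delta> closed b(1) _ _ fin cover] W1(1,2) W2(1,2) by auto
  consider "S = Z'" | "S \<in> fixset ` \<J>1" | "S \<in> fixset ` \<J>2"
    using S(1) by (auto simp: \<S>_def)
  then show ?thesis
  proof cases
    case 1
    then have "unitary_variety \<Delta> N r \<subseteq> Z"
      using S(2) by (auto simp: unitary_variety_def Z'_def)
    then show ?thesis
      using Z(2) by blast
  next
    case 2
    then obtain M where "M \<in> Gamma0 N" "S = fixset (cm_conj \<Delta> r M)" "S \<noteq> ?D"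
      by (auto simp: \<J>1_def)
    then show ?thesis
      using cm_conj_rigid(2)[OF \<Delta> r Gamma0_similitude] S(2) by (metis zero_less_one)
  next
    case 3
    then obtain L \<beta> M M' where *: "S = fixset (sadj (L ** \<beta>0 ** M') ** (\<beta> ** M))" "L \<in> Gamma0 N"
      "\<beta> \<in> hecke_coset N p" "generates_lattice \<Delta> r \<beta>" "M \<in> stab" "M' \<in> stab"
      by (auto simp: \<J>2_def)
    let ?d1 = "\<beta> ** M" and ?d2 = "L ** \<beta>0 ** M'"
    have M: "M \<in> Gamma0 N" "siegel_action M ` ?D = ?D" "M' \<in> Gamma0 N" "siegel_action M' ` ?D = ?D"
      using *(5,6) by (auto simp: stab_def)
    have d1: "?d1 \<in> hecke_coset N p" and L\<beta>0: "L ** \<beta>0 \<in> hecke_coset N p" and d2: "?d2 \<in> hecke_coset N p"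
      using hecke_coset_mult *(3) \<beta>0(1) M(1,3) *(2) by blast+
    note s1 = hecke_coset_level(2)[OF d1] and s2 = hecke_coset_level(2)[OF d2]
    have s2': "similitude (real p) (sadj ?d2)"
      using similitude_sadj[OF s2] p(1) by simp
    have "siegel_action ?d1 \<tau> = siegel_action ?d2 \<tau>" if "\<tau> \<in> ?D" for \<tau>
    proof -
      have H: "\<tau> \<in> siegel_space"
        using that DH by blast
      have "siegel_action (sadj ?d2 ** ?d1) \<tau> = \<tau>"
        using fixset_iff_action[OF similitude_mult[OF s2' s1]] S(2) that *(1) p(1) by auto
      then have "siegel_action (sadj ?d2) (siegel_action ?d1 \<tau>) = \<tau>"
        using siegel_action_mult[OF s2' _ s1 _ H] p(1) by simp
      then show ?thesis
        using siegel_action_sadj(2)[OF s2 _ hecke_action[OF d1 p(1) H]] p(1) by simp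
    qed
    then have "hecke_graph \<Delta> N r ?d1 = hecke_graph \<Delta> N r ?d2"
      unfolding hecke_graph_def by (intro image_cong) auto
    moreover have "hecke_graph \<Delta> N r ?d1 = hecke_graph \<Delta> N r \<beta>"
      by (rule hecke_graph_right[OF \<Delta> p(1) *(3) M(1,2)])
    moreover have "hecke_graph \<Delta> N r ?d2 = hecke_graph \<Delta> N r \<beta>0"
      using hecke_graph_right[OF \<Delta> p(1) L\<beta>0 M(3,4)] hecke_graph_left[OF \<Delta> p(1) \<beta>0(1) *(2)] by simp
    ultimately show ?thesis
      using that[OF *(3,4)] \<beta>0(2) by simp
  qed
qed

section \<open>The degenerate locus and the degree\<close>

text \<open>The image of \<open>C\<close> is covered by the translates \<open>\<gamma> \<beta> D\<close> of the unitary domain \<open>D\<close>. Outside the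
  intersections of distinct translates, all representations of a point come from one translate.\<close>

definition degenerate_locus :: "nat \<Rightarrow> nat \<Rightarrow> nat \<Rightarrow> 'g::{finite,linorder} bmatrix \<Rightarrow> 'g cmatrix set" where
  "degenerate_locus \<Delta> N r \<beta> = \<Union>{fixset (cm_conj \<Delta> r (M ** \<beta>)) \<inter> fixset (cm_conj \<Delta> r (M' ** \<beta>)) | M M'.
     M \<in> Gamma0 N \<and> M' \<in> Gamma0 N \<and> fixset (cm_conj \<Delta> r (M ** \<beta>)) \<noteq> fixset (cm_conj \<Delta> r (M' ** \<beta>))}"

lemma fixset_conj_eq_iff:
  assumes "similitude k M" "0 < k"
  shows "fixset (M ** j ** sadj M) = fixset (M ** j' ** sadj M) \<longleftrightarrow> fixset j = fixset j'"
proof -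
  have sub: "fixset i \<subseteq> siegel_space" for i :: "'a bmatrix"
    by (auto simp: fixset_def)
  have "similitude k (sadj M)"
    using similitude_sadj[OF assms(1)] assms(2) by simp
  then have inverse_in: "siegel_action (sadj M) \<sigma> \<in> siegel_space" if "\<sigma> \<in> siegel_space" for \<sigma>
    using siegel_action_in assms(2) that by blast
  have iff: "\<sigma> \<in> fixset (M ** i ** sadj M) \<longleftrightarrow> siegel_action (sadj M) \<sigma> \<in> fixset i" if "\<sigma> \<in> siegel_space" for \<sigma> i
    using fixset_conj[OF assms inverse_in[OF that], of i] siegel_action_sadj(2)[OF assms that] by simp
  show ?thesis
  proof
    assume "fixset j = fixset j'"
    then show "fixset (M ** j ** sadj M) = fixset (M ** j' ** sadj M)"
      using iff sub by blast
  next
    assume "fixset (M ** j ** sadj M) = fixset (M ** j' ** sadj M)"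
    then show "fixset j = fixset j'"
      using fixset_conj[OF assms] sub by blast
  qed
qed

lemma degenerate_locus_invariant:
  assumes "L \<in> Gamma0 N" "\<sigma> \<in> degenerate_locus \<Delta> N r \<beta>"
  shows "siegel_action L \<sigma> \<in> degenerate_locus \<Delta> N r \<beta>"
proof -
  obtain M M' where M: "M \<in> Gamma0 N" "M' \<in> Gamma0 N"
    "fixset (cm_conj \<Delta> r (M ** \<beta>)) \<noteq> fixset (cm_conj \<Delta> r (M' ** \<beta>))"
    "\<sigma> \<in> fixset (cm_conj \<Delta> r (M ** \<beta>))" "\<sigma> \<in> fixset (cm_conj \<Delta> r (M' ** \<beta>))"
    using assms(2) unfolding degenerate_locus_def by blast
  have eq: "cm_conj \<Delta> r (L ** M'' ** \<beta>) = L ** cm_conj \<Delta> r (M'' ** \<beta>) ** sadj L" for M''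
    using cm_conj_mult[of \<Delta> r L "M'' ** \<beta>"] by (simp add: matrix_mul_assoc)
  have "siegel_action L \<sigma> \<in> fixset (cm_conj \<Delta> r (L ** M ** \<beta>))" "siegel_action L \<sigma> \<in> fixset (cm_conj \<Delta> r (L ** M' ** \<beta>))"
    unfolding eq using fixset_conj_sub[OF Gamma0_similitude[OF assms(1)]] M(4,5) by auto
  moreover have "fixset (cm_conj \<Delta> r (L ** M ** \<beta>)) \<noteq> fixset (cm_conj \<Delta> r (L ** M' ** \<beta>))"
    unfolding eq using fixset_conj_eq_iff[OF Gamma0_similitude[OF assms(1)]] M(3) by auto
  ultimately show ?thesis
    unfolding degenerate_locus_def using Gamma0_mult[OF assms(1) M(1)] Gamma0_mult[OF assms(1) M(2)] by blast
qed

lemma degenerate_locus_subset: "degenerate_locus \<Delta> N r \<beta> \<subseteq> siegel_space"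
  by (auto simp: degenerate_locus_def fixset_def)

lemma degenerate_locus_subvariety:
  fixes \<beta> :: "'g::{finite,linorder} bmatrix"
  assumes \<Delta>: "0 < \<Delta>" and p: "0 < p" and \<beta>: "\<beta> \<in> hecke_coset N p"
  shows "subvariety N (siegel_pt N ` degenerate_locus \<Delta> N r \<beta>)"
  unfolding subvariety_def
proof
  show "siegel_pt N ` degenerate_locus \<Delta> N r \<beta> \<subseteq> siegel_variety N"
    using degenerate_locus_subset[of \<Delta> N r \<beta>] by (auto simp: siegel_variety_def)
  let ?\<Z> = "{fixset (cm_conj \<Delta> r (M ** \<beta>)) \<inter> fixset (cm_conj \<Delta> r (M' ** \<beta>)) | M M'.
     M \<in> Gamma0 N \<and> M' \<in> Gamma0 N \<and> fixset (cm_conj \<Delta> r (M ** \<beta>)) \<noteq> fixset (cm_conj \<Delta> r (M' ** \<beta>))}"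
  have "{\<tau> \<in> siegel_space. siegel_pt N \<tau> \<in> siegel_pt N ` degenerate_locus \<Delta> N r \<beta>} = degenerate_locus \<Delta> N r \<beta>"
  proof (intro equalityI subsetI)
    fix \<tau> assume "\<tau> \<in> {\<tau> \<in> siegel_space. siegel_pt N \<tau> \<in> siegel_pt N ` degenerate_locus \<Delta> N r \<beta>}"
    then obtain \<sigma> where \<sigma>: "\<tau> \<in> siegel_space" "\<sigma> \<in> degenerate_locus \<Delta> N r \<beta>" "siegel_pt N \<sigma> = siegel_pt N \<tau>"
      by auto
    then obtain L where "L \<in> Gamma0 N" "\<tau> = siegel_action L \<sigma>"
      using siegel_pt_eq_iff degenerate_locus_subset by blast
    then show "\<tau> \<in> degenerate_locus \<Delta> N r \<beta>"
      using degenerate_locus_invariant \<sigma>(2) by blast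
  qed (use degenerate_locus_subset[of \<Delta> N r \<beta>] in auto)
  moreover have "analytic_subset scale_matrix siegel_space (\<Union>?\<Z>)"
  proof (rule analytic_subset_locally_finite_Union)
    fix Z assume "Z \<in> ?\<Z>"
    then show "analytic_subset scale_matrix siegel_space Z"
      using analytic_subset_Int[OF analytic_fixset analytic_fixset] by auto
  next
    fix x :: "'g cmatrix" assume x: "x \<in> siegel_space"
    let ?\<J> = "{cm_conj \<Delta> r (M ** \<beta>) | M. M \<in> Gamma0 N}"
    have J: "?\<J> \<subseteq> integral_similitudes (real p * real \<Delta> * real p)"
    proof
      fix j assume "j \<in> ?\<J>"
      then obtain M where "M \<in> Gamma0 N" "j = cm_conj \<Delta> r (M ** \<beta>)"
        by blast
      then show "j \<in> integral_similitudes (real p * real \<Delta> * real p)"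
        using cm_conj_integral[OF hecke_coset_integral[OF hecke_coset_mult(1)[OF \<beta>]]] p by simp
    qed
    have k: "0 < real p * real \<Delta> * real p"
      using p \<Delta> by simp
    from fixset_intersections_locally_finite[OF x k J]
    obtain W where W: "open W" "x \<in> W"
      "finite {Z \<in> {fixset j \<inter> fixset j' | j j'. j \<in> ?\<J> \<and> j' \<in> ?\<J>}. Z \<inter> W \<noteq> {}}"
      by blast
    have "finite {Z \<in> ?\<Z>. Z \<inter> W \<noteq> {}}"
      by (rule finite_subset[OF _ W(3)]) blast
    then show "\<exists>U. open U \<and> x \<in> U \<and> finite {Z \<in> ?\<Z>. Z \<inter> U \<noteq> {}}"
      using W(1,2) by blast
  qed
  ultimately show "analytic_subset scale_matrix siegel_space
     {\<tau> \<in> siegel_space. siegel_pt N \<tau> \<in> siegel_pt N ` degenerate_locus \<Delta> N r \<beta>}"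
    by (simp add: degenerate_locus_def)
qed

text \<open>If the translate by \<open>\<beta>\<close> were covered by the intersections of distinct
  translates, it would be contained in one of them, and by rigidity both translates would be equal
  to it.\<close>

lemma degenerate_locus_proper:
  fixes \<beta> :: "'g::{finite,linorder} bmatrix"
  assumes \<Delta>: "0 < \<Delta>" and p: "0 < p" and r: "0 < r" "r < CARD('g)" and \<beta>: "\<beta> \<in> hecke_coset N p"
  shows "\<exists>\<tau> \<in> unitary_domain \<Delta> r. siegel_action \<beta> \<tau> \<notin> degenerate_locus \<Delta> N r \<beta>"
proof (rule ccontr)
  let ?D = "unitary_domain \<Delta> r :: 'g cmatrix set"
  assume "\<not> ?thesis"
  then have all: "\<And>\<tau>. \<tau> \<in> ?D \<Longrightarrow> siegel_action \<beta> \<tau> \<in> degenerate_locus \<Delta> N r \<beta>"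
    by blast
  note s\<beta> = hecke_coset_level(2)[OF \<beta>]
  have p': "0 < real p"
    using p by simp
  have s\<beta>': "similitude (real p) (sadj \<beta>)"
    using similitude_sadj[OF s\<beta>] p by simp
  let ?j = "\<lambda>M. cm_conj \<Delta> r (sadj \<beta> ** (M ** \<beta>))"
  have j: "?j M = sadj \<beta> ** cm_conj \<Delta> r (M ** \<beta>) ** sadj (sadj \<beta>)" for M
    by (rule cm_conj_mult)
  let ?\<J> = "{?j M | M. M \<in> Gamma0 N}"
  let ?\<S> = "{fixset (?j M) \<inter> fixset (?j M') | M M'. M \<in> Gamma0 N \<and> M' \<in> Gamma0 N \<and>
    fixset (?j M) \<noteq> fixset (?j M')}"
  have int: "sadj \<beta> ** (M ** \<beta>) \<in> integral_similitudes (real p * real p)" if "M \<in> Gamma0 N" for M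
    using hecke_coset_integral[OF \<beta>] hecke_coset_integral[OF hecke_coset_mult(1)[OF \<beta> that]] p
    by (intro integral_similitudes_mult integral_similitudes_sadj) auto
  let ?k = "real p * real p * real \<Delta> * (real p * real p)"
  have J: "?\<J> \<subseteq> integral_similitudes ?k"
  proof
    fix i assume "i \<in> ?\<J>"
    then obtain M where "M \<in> Gamma0 N" "i = ?j M"
      by blast
    then show "i \<in> integral_similitudes ?k"
      using cm_conj_integral[OF int, of M] p by simp
  qed
  have k: "0 < ?k"
    using p \<Delta> by simp
  from fixset_intersections_locally_finite[OF base_point_in[OF \<Delta>] k J]
  obtain W where W: "open W" "base_point \<Delta> \<in> W"
    "finite {Z \<in> {fixset i \<inter> fixset i' | i i'. i \<in> ?\<J> \<and> i' \<in> ?\<J>}. Z \<inter> W \<noteq> {}}"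
    by blast
  have fin: "finite {S \<in> ?\<S>. S \<inter> W \<noteq> {}}"
    by (rule finite_subset[OF _ W(3)]) blast
  have closed: "curve_closed \<Delta> r S" if "S \<in> ?\<S>" for S
    using that analytic_subset_curve_closed[OF \<Delta> analytic_subset_Int[OF analytic_fixset analytic_fixset]] by auto
  have cover: "?D \<subseteq> \<Union>?\<S>"
  proof
    fix \<tau> assume \<tau>: "\<tau> \<in> ?D"
    then have H: "\<tau> \<in> siegel_space"
      using unitary_domain_subset[OF \<Delta>] by blast
    obtain M M' where M: "M \<in> Gamma0 N" "M' \<in> Gamma0 N"
      "fixset (cm_conj \<Delta> r (M ** \<beta>)) \<noteq> fixset (cm_conj \<Delta> r (M' ** \<beta>))"
      "siegel_action \<beta> \<tau> \<in> fixset (cm_conj \<Delta> r (M ** \<beta>))" "siegel_action \<beta> \<tau> \<in> fixset (cm_conj \<Delta> r (M' ** \<beta>))"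
      using all[OF \<tau>] unfolding degenerate_locus_def by blast
    have "\<tau> \<in> fixset (?j M) \<inter> fixset (?j M')"
      unfolding j using fixset_conj_sub[OF s\<beta>' p' M(4)] fixset_conj_sub[OF s\<beta>' p' M(5)]
        siegel_action_sadj(1)[OF s\<beta> p' H] by simp
    moreover have "fixset (?j M) \<noteq> fixset (?j M')"
      unfolding j using fixset_conj_eq_iff[OF s\<beta>' p'] M(3) by blast
    ultimately show "\<tau> \<in> \<Union>?\<S>"
      using M(1,2) by blast
  qed
  obtain S where S: "S \<in> ?\<S>" "?D \<subseteq> S"
    by (rule unitary_domain_locally_finite_cover[OF \<Delta> closed base_point_in_domain[OF \<Delta>] W(1,2) fin cover])
  then obtain M M' where M: "M \<in> Gamma0 N" "M' \<in> Gamma0 N" "fixset (?j M) \<noteq> fixset (?j M')"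
    "?D \<subseteq> fixset (?j M)" "?D \<subseteq> fixset (?j M')"
    by blast
  have "fixset (?j L) = ?D" if "L \<in> Gamma0 N" "?D \<subseteq> fixset (?j L)" for L
    using cm_conj_rigid(2)[OF \<Delta> r _ _ that(2), of "real p * real p"] int[OF that(1)] p'
    by (simp add: integral_similitudes_def)
  then show False
    using M by metis
qed

lemma degenerate_locus_in_image:
  fixes \<beta> :: "'g::{finite,linorder} bmatrix"
  assumes \<Delta>: "0 < \<Delta>" and p: "0 < p" and r: "0 < r" "r < CARD('g)" and \<beta>: "\<beta> \<in> hecke_coset N p"
  defines "C \<equiv> hecke_graph \<Delta> N r \<beta>"
  shows "siegel_pt N ` degenerate_locus \<Delta> N r \<beta> \<subset> snd ` C"
proof
  let ?D = "unitary_domain \<Delta> r :: 'g cmatrix set" and ?X = "degenerate_locus \<Delta> N r \<beta>"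
  have p': "0 < real p"
    using p by simp
  have DH: "?D \<subseteq> siegel_space"
    by (rule unitary_domain_subset[OF \<Delta>])
  show "siegel_pt N ` ?X \<subseteq> snd ` C"
  proof
    fix x assume "x \<in> siegel_pt N ` ?X"
    then obtain \<sigma> M where \<sigma>: "x = siegel_pt N \<sigma>" "M \<in> Gamma0 N" "\<sigma> \<in> fixset (cm_conj \<Delta> r (M ** \<beta>))"
      unfolding degenerate_locus_def by blast
    have "similitude (real p) (M ** \<beta>)"
      using hecke_coset_level(2)[OF hecke_coset_mult(1)[OF \<beta> \<sigma>(2)]] .
    then obtain \<tau> where \<tau>: "\<tau> \<in> ?D" "\<sigma> = siegel_action (M ** \<beta>) \<tau>"
      using image_unitary_domain[OF \<Delta> _ p'] \<sigma>(3) by blast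
    have H: "\<tau> \<in> siegel_space"
      using \<tau>(1) DH by blast
    have "x = siegel_pt N (siegel_action \<beta> \<tau>)"
      using \<sigma>(1) \<tau>(2) hecke_action_mult(1)[OF \<beta> p \<sigma>(2) H] siegel_pt_action[OF \<sigma>(2) hecke_action[OF \<beta> p H]]
      by simp
    then show "x \<in> snd ` C"
      using \<tau>(1) by (force simp: C_def hecke_graph_def)
  qed
  show "siegel_pt N ` ?X \<noteq> snd ` C"
  proof
    assume eq: "siegel_pt N ` ?X = snd ` C"
    obtain \<tau> where \<tau>: "\<tau> \<in> ?D" "siegel_action \<beta> \<tau> \<notin> ?X"
      using degenerate_locus_proper[OF \<Delta> p r \<beta>] by blast
    then have "siegel_pt N (siegel_action \<beta> \<tau>) \<in> siegel_pt N ` ?X"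
      unfolding eq by (force simp: C_def hecke_graph_def)
    then obtain \<sigma> where \<sigma>: "\<sigma> \<in> ?X" "siegel_pt N \<sigma> = siegel_pt N (siegel_action \<beta> \<tau>)"
      by auto
    then obtain L where "L \<in> Gamma0 N" "siegel_action \<beta> \<tau> = siegel_action L \<sigma>"
      using siegel_pt_eq_iff[of \<sigma> "siegel_action \<beta> \<tau>" N] degenerate_locus_subset hecke_action[OF \<beta> p] \<tau>(1) DH by blast
    then show False
      using degenerate_locus_invariant \<sigma>(1) \<tau>(2) by metis
  qed
qed

text \<open>Let \<open>\<beta> \<tau> = M \<beta> \<tau>'\<close>. Off the degenerate locus the
  translates by \<open>\<beta>\<close> and by \<open>M \<beta>\<close> coincide, so
  \<open>\<beta>\<^sup>-\<^sup>1 M \<beta>\<close>, which carries \<open>\<tau>'\<close> to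
  \<open>\<tau>\<close>, preserves the unitary domain. By rigidity it commutes or anticommutes with
  \<open>\<surd>(-\<Delta>)\<close>, and goodness puts it into \<open>\<Gamma>\<close>.\<close>

lemma hecke_graph_fibre_unique:
  fixes \<beta> :: "'g::{finite,linorder} bmatrix"
  assumes \<Delta>: "0 < \<Delta>" and p: "0 < p" and cop: "coprime N p" and r: "0 < r" "r < CARD('g)"
    and \<beta>: "\<beta> \<in> hecke_coset N p" and gen: "generates_lattice \<Delta> r \<beta>"
    and s: "s \<notin> siegel_pt N ` degenerate_locus \<Delta> N r \<beta>"
    and t: "(t, s) \<in> hecke_graph \<Delta> N r \<beta>" "(t', s) \<in> hecke_graph \<Delta> N r \<beta>"
  shows "t = t'"
proof -
  let ?D = "unitary_domain \<Delta> r :: 'g cmatrix set" and ?X = "degenerate_locus \<Delta> N r \<beta>"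
  note s\<beta> = hecke_coset_level(2)[OF \<beta>]
  have p': "0 < real p"
    using p by simp
  have s\<beta>': "similitude (real p) (sadj \<beta>)"
    using similitude_sadj[OF s\<beta>] p by simp
  have DH: "?D \<subseteq> siegel_space"
    by (rule unitary_domain_subset[OF \<Delta>])
  obtain \<tau> where \<tau>: "\<tau> \<in> ?D" "t = siegel_pt N \<tau>" "s = siegel_pt N (siegel_action \<beta> \<tau>)"
    using t(1) by (auto simp: hecke_graph_def)
  obtain \<tau>' where \<tau>': "\<tau>' \<in> ?D" "t' = siegel_pt N \<tau>'" "s = siegel_pt N (siegel_action \<beta> \<tau>')"
    using t(2) by (auto simp: hecke_graph_def)
  have H: "\<tau> \<in> siegel_space" "\<tau>' \<in> siegel_space"
    using \<tau>(1) \<tau>'(1) DH by auto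
  let ?\<sigma> = "siegel_action \<beta> \<tau>"
  have "siegel_pt N (siegel_action \<beta> \<tau>') = siegel_pt N ?\<sigma>"
    using \<tau>(3) \<tau>'(3) by simp
  then obtain M where M: "M \<in> Gamma0 N" "?\<sigma> = siegel_action M (siegel_action \<beta> \<tau>')"
    using siegel_pt_eq_iff[OF hecke_action[OF \<beta> p H(2)] hecke_action[OF \<beta> p H(1)]] by blast
  have M\<beta>: "M ** \<beta> \<in> hecke_coset N p"
    using hecke_coset_mult(1)[OF \<beta> M(1)] .
  note sM\<beta> = hecke_coset_level(2)[OF M\<beta>]
  have \<sigma>: "?\<sigma> = siegel_action (M ** \<beta>) \<tau>'"
    using M(2) hecke_action_mult(1)[OF \<beta> p M(1) H(2)] by simp
  have "?\<sigma> \<in> fixset (cm_conj \<Delta> r (mat 1 ** \<beta>))"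
    unfolding matrix_mul_lid image_unitary_domain[OF \<Delta> s\<beta> p', symmetric] using \<tau>(1) by blast
  moreover have "?\<sigma> \<in> fixset (cm_conj \<Delta> r (M ** \<beta>))"
    unfolding \<sigma> image_unitary_domain[OF \<Delta> sM\<beta> p', symmetric] using \<tau>'(1) by blast
  moreover have "?\<sigma> \<notin> ?X"
    using s \<tau>(3) by blast
  ultimately have "fixset (cm_conj \<Delta> r (mat 1 ** \<beta>)) = fixset (cm_conj \<Delta> r (M ** \<beta>))"
    using Gamma0_one M(1) unfolding degenerate_locus_def by blast
  then have same: "fixset (cm_conj \<Delta> r \<beta>) = fixset (cm_conj \<Delta> r (M ** \<beta>))"
    by simp
  define E where "E = sadj \<beta> ** (M ** \<beta>)"
  have sE: "similitude (real p * real p) E"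
    unfolding E_def by (rule similitude_mult[OF s\<beta>' sM\<beta>])
  have "?D \<subseteq> fixset (cm_conj \<Delta> r E)"
  proof
    fix \<rho> assume \<rho>: "\<rho> \<in> ?D"
    then have "siegel_action \<beta> \<rho> \<in> fixset (cm_conj \<Delta> r (M ** \<beta>))"
      using image_unitary_domain[OF \<Delta> s\<beta> p', of r] same by auto
    then have "siegel_action (sadj \<beta>) (siegel_action \<beta> \<rho>) \<in> fixset (cm_conj \<Delta> r E)"
      unfolding E_def cm_conj_mult[of \<Delta> r "sadj \<beta>"] by (rule fixset_conj_sub[OF s\<beta>' p'])
    then show "\<rho> \<in> fixset (cm_conj \<Delta> r E)"
      using siegel_action_sadj(1)[OF s\<beta> p'] \<rho> DH by auto
  qed
  then have rigid: "cm_conj \<Delta> r E = sm (real p * real p) (cm_matrix \<Delta> r) \<or>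
      cm_conj \<Delta> r E = sm (- (real p * real p)) (cm_matrix \<Delta> r)"
    using cm_conj_rigid(1)[OF \<Delta> r sE] p' by simp
  let ?J = "cm_matrix \<Delta> r :: 'g bmatrix"
  have EE: "sadj E ** E = mat (real p * real p)"
    using similitude_sadj_mult[OF sE] p' by simp
  have "cm_conj \<Delta> r E ** E = sm (real p * real p) (E ** ?J)"
    by (simp add: cm_conj_def matrix_mul_assoc[symmetric] EE mult_mat_eq_sm sm_mult_right)
  then have "sm (real p * real p) (E ** ?J) = sm (real p * real p) (?J ** E) \<or>
      sm (real p * real p) (E ** ?J) = sm (real p * real p) (- (?J ** E))"
    using rigid by (auto simp: sm_mult_left sm_minus sm_minus_left minus_mult_left')
  then have comm: "E ** ?J = ?J ** E \<or> E ** ?J = - (?J ** E)"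
    using p' by (simp add: sm_cancel)
  define \<epsilon> where "\<epsilon> = sm (1 / real p) (sadj \<beta> ** M ** \<beta>)"
  have \<epsilon>: "\<epsilon> = sm (1 / real p) E"
    by (simp add: \<epsilon>_def E_def matrix_mul_assoc)
  have "\<epsilon> ** ?J = ?J ** \<epsilon> \<or> \<epsilon> ** ?J = - (?J ** \<epsilon>)"
    using comm by (auto simp: \<epsilon> sm_mult_left sm_mult_right sm_minus)
  then have "\<epsilon> \<in> Gamma0 N"
    unfolding \<epsilon>_def by (rule conjugate_in_Gamma0[OF p cop \<beta> M(1) gen])
  moreover have "siegel_action \<epsilon> \<tau>' = \<tau>"
  proof -
    have "siegel_action E \<tau>' = siegel_action (sadj \<beta>) (siegel_action (M ** \<beta>) \<tau>')"
      unfolding E_def using siegel_action_mult[OF s\<beta>' p' sM\<beta> p' H(2)] .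
    also have "\<dots> = \<tau>"
      using siegel_action_sadj(1)[OF s\<beta> p' H(1)] \<sigma> by simp
    finally have E: "siegel_action E \<tau>' = \<tau>" .
    have "E = mat (real p) ** \<epsilon>"
      using p' by (simp add: \<epsilon> mat_mult_eq_sm sm_sm)
    moreover have "similitude 1 \<epsilon>"
      using Gamma0_similitude[OF \<open>\<epsilon> \<in> Gamma0 N\<close>] .
    ultimately have "siegel_action E \<tau>' = siegel_action (mat (real p)) (siegel_action \<epsilon> \<tau>')"
      using siegel_action_mult[OF similitude_mat[of "real p"], of 1 \<epsilon> \<tau>'] p' H(2) by simp
    also have "\<dots> = siegel_action \<epsilon> \<tau>'"
      using siegel_action_mat[of "real p"] p' Gamma0_action_in[OF \<open>\<epsilon> \<in> Gamma0 N\<close> H(2)] by simp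
    finally show ?thesis
      using E by simp
  qed
  ultimately show "t = t'"
    using siegel_pt_action[of \<epsilon> N \<tau>'] H(2) \<tau>(2) \<tau>'(2) by simp
qed

theorem proposition3p4p1:
  fixes \<Delta> p N r s :: nat
    and C :: "('g::{finite,linorder} cmatrix set \<times> 'g cmatrix set) set"
  assumes "0 < \<Delta>" and "squarefree \<Delta>" and "class_number \<Delta> = 1"
    and "prime p" and "odd p" and "inert_prime \<Delta> p"
    and "0 < N" and "coprime N p"
    and "\<And>q. prime q \<Longrightarrow> q dvd N \<Longrightarrow> split_prime \<Delta> q"
    and "r + s = CARD('g)"
    and "good_component \<Delta> N r p C"
  shows "snd_degree N C 1"
proof -
  note \<Delta> = assms(1) and cop = assms(8) and good = assms(11)
  have p: "0 < p"
    using assms(4) by (simp add: prime_gt_0_nat)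
  let ?D = "unitary_domain \<Delta> r :: 'g cmatrix set"
  show ?thesis
  proof (cases "0 < r \<and> r < CARD('g)")
    case False
    then have D: "?D = {base_point \<Delta>}"
      using unitary_domain_definite[OF \<Delta>] by auto
    obtain \<beta> where "\<beta> \<in> hecke_coset N p" "C = hecke_graph \<Delta> N r \<beta>"
      using hecke_component_is_graph[OF \<Delta> p cop] good unfolding good_component_def by blast
    then obtain t0 s0 where C: "C = {(t0, s0)}"
      by (simp add: hecke_graph_def D)
    then have "{t. (t, s0) \<in> C} = {t0}" "snd ` C = {s0}"
      by auto
    moreover have "subvariety N ({} :: 'g cmatrix set set)"
      by (simp add: subvariety_def analytic_subset_empty)
    ultimately show ?thesis
      unfolding snd_degree_def generically_def by (intro exI[of _ "{}"]) auto
  next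
    case True
    then have r: "0 < r" "r < CARD('g)"
      by auto
    obtain \<beta> where \<beta>: "\<beta> \<in> hecke_coset N p" "generates_lattice \<Delta> r \<beta>" "C = hecke_graph \<Delta> N r \<beta>"
      using good_component_is_good_graph[OF \<Delta> p cop r good] by blast
    let ?X = "degenerate_locus \<Delta> N r \<beta>"
    show ?thesis
      unfolding snd_degree_def generically_def
    proof (intro exI[of _ "siegel_pt N ` ?X"] conjI ballI)
      show "subvariety N (siegel_pt N ` ?X)"
        by (rule degenerate_locus_subvariety[OF \<Delta> p \<beta>(1)])
      show "siegel_pt N ` ?X \<subset> snd ` C"
        using degenerate_locus_in_image[OF \<Delta> p r \<beta>(1)] \<beta>(3) by simp
      fix s assume s: "s \<in> snd ` C - siegel_pt N ` ?X"
      then obtain t where "(t, s) \<in> C"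
        by auto
      then have "{t. (t, s) \<in> C} = {t}"
        using hecke_graph_fibre_unique[OF \<Delta> p cop r \<beta>(1,2)] s unfolding \<beta>(3) by blast
      then show "finite {t. (t, s) \<in> C}" "card {t. (t, s) \<in> C} = 1"
        by simp_all
    qed
  qed
qed

end
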